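(* Let $\theta>0$, $\xi\in\mathbb{R}\setminus\{0\}$, $\varepsilon>0$, $m$ a positive integer, $k\in\{0,1,\ldots,m-1\}$ and $(\underline{x},\overline{x})\subset(k/m,(k+1)/m)$. Let $K$ be the (Cole--Hopf) solution, in the sense described in the context, of the KPZ equation $$\frac{\partial}{\partial t}K(t,x)=\theta\frac{\partial^2}{\partial x^2}K(t,x)+\frac{\xi}{2}\Big|\frac{\partial}{\partial x}K(t,x)\Big|^2+\frac{2\theta\varepsilon}{\xi}\frac{\partial}{\partial t}W(t,x),\quad t>0,\ x\in(\underline{x},\overline{x}),$$ with $K(t,\underline{x})=\frac{2\theta}{\xi}\ln|U(t,\underline{x})|$, $K(t,\overline{x})=\frac{2\theta}{\xi}\ln|U(t,\overline{x})|$ for $t\ge0$ and $K(0,x)=\frac{2\theta}{\xi}\ln[U_m(0)\sqrt2|\sin(m\pi x)|]$. Suppose that (A2) holds: $U_m(0)>0$ has a log-normal distribution with density $\frac{1}{u\sqrt{2\pi\nu_m(0)}}\exp\{-\frac{(\ln u-\mu_m(0))^2}{2\nu_m(0)}\}$ for $u>0$ and $0$ otherwise, where $\mu_m(0)=\mathbb{E}[\ln U_m(0)]\in\mathbb{R}$ and $\nu_m(0)=\mathrm{Var}[\ln U_m(0)]\in(0,\infty)$. Let $T>0$, $t\in[0,T]$, $\kappa\in\mathbb{R}$, and let $\hat K(s,x)$ be a solution of the stochastic differential equation $$d\hat K(s,x)=\frac{\partial\tilde\mu(T-s,x)}{\partial s}\,ds+\sqrt{-\frac{\partial\tilde\nu(T-s)}{\partial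 s}}\,dB(s),\quad T-t\le s\le T,$$ with initial condition $\hat K(T-t,x)=\kappa$ and $x\in(\underline{x},\overline{x})$, where $B$ is a standard scalar Brownian motion. Then the density function $p(\kappa,t,x)$ of $K(t,x)$ admits the probabilistic representation $$p(\kappa,t,x)=\mathbb{E}\big[p(\hat K(T,x),0,x)\,\big|\,\hat K(T-t,x)=\kappa\big],\quad(\kappa,t,x)\in\mathbb{R}\times[0,T]\times(\underline{x},\overline{x}).$$
   Context: Here $U$ is the solution of the stochastic heat equation $\frac{\partial}{\partial t}U=\theta\frac{\partial^2}{\partial x^2}U+\varepsilon U\frac{\partial}{\partial t}W$ on $(0,1)$ with $U(t,0)=U(t,1)=0$ and $U(0,x)=U_m(0)\sqrt2\sin(m\pi x)$, where $U_m(0)$ is independent of the $Q$-Wiener process $W$, which has mode intensities $q_n\ge0$, $\sum_nq_n^2<\infty$, and independent standard scalar Brownian motions $W_n$. Meaning of the solution: with $\tilde e_n(x)=\sqrt2\sin(n\pi x)$, $U(t,x)=\sum_nU_n(t)\tilde e_n(x)$, where the noise acts mode by mode, i.e. $dU_n(t)=-\theta(n\pi)^2U_n(t)\,dt+\varepsilon q_nU_n(t)\,dW_n(t)$ (Itô), with initial value $U_m(0)$ for $n=m$ and $U_n(0)=0$ for $n\ne m$. Hence $U(t,x)=U_m(t)\tilde e_m(x)$. The solution $K$ of the KPZ equation is given by the Cole--Hopf transformation $K(t,x)=\frac{2\theta}{\xi}\ln|U(t,x)|$ for $x\in(\underline{x},\overline{x})$. Functions: $\tilde\mu(t,x)=\frac{2\theta}{\xi}[\mathbb{E}[\ln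 U_m(0)]+\tilde b_mt+\ln|\tilde e_m(x)|]$ and $\tilde\nu(t)=\frac{4\theta^2}{\xi^2}[\mathrm{Var}[\ln U_m(0)]+(\varepsilon q_m)^2t]$, with $\tilde b_m=-\theta(m\pi)^2-(\varepsilon q_m)^2/2$. The density of $K(t,x)$ is $p(\kappa,t,x)=\frac{1}{\sqrt{2\pi\tilde\nu(t)}}\exp\{-\frac{(\kappa-\tilde\mu(t,x))^2}{2\tilde\nu(t)}\}$, $t\ge0$. *)

theory Defs
  imports "HOL-Probability.Probability"
begin

text \<open>
  Time is of type \<^typ>\<open>real\<close>, but only times \<open>t \<ge> 0\<close> are ever used.
\<close>

definition filtered_prob_space :: "'a measure \<Rightarrow> (real \<Rightarrow> 'a measure) \<Rightarrow> bool" where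
  "filtered_prob_space M F \<longleftrightarrow>
     prob_space M \<and> filtration (space M) F \<and> (\<forall>t. subalgebra M (F t))"

definition gen_sets :: "'a measure \<Rightarrow> ('a \<Rightarrow> real) \<Rightarrow> 'a set set" where
  "gen_sets M X = sets (vimage_algebra (space M) X borel)"

definition process_sets :: "'a measure \<Rightarrow> (real \<Rightarrow> 'a \<Rightarrow> real) \<Rightarrow> 'a set set" where
  "process_sets M X = sigma_sets (space M) (\<Union>t\<in>{0..}. gen_sets M (X t))"

definition brownian_motion ::
    "'a measure \<Rightarrow> (real \<Rightarrow> 'a measure) \<Rightarrow> (real \<Rightarrow> 'a \<Rightarrow> real) \<Rightarrow> bool" where
  "brownian_motion M F W \<longleftrightarrow>
     (\<forall>t\<ge>0. W t \<in> borel_measurable (F t)) \<and>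
     (AE \<omega> in M. W 0 \<omega> = 0) \<and>
     (\<forall>\<omega>\<in>space M. continuous_on {0..} (\<lambda>t. W t \<omega>)) \<and>
     (\<forall>s t. 0 \<le> s \<and> s < t \<longrightarrow>
        distributed M lborel (\<lambda>\<omega>. W t \<omega> - W s \<omega>) (\<lambda>y. ennreal (normal_density 0 (sqrt (t - s)) y)) \<and>
        prob_space.indep_set M (sets (F s)) (gen_sets M (\<lambda>\<omega>. W t \<omega> - W s \<omega>)))"

definition tendsto_in_prob ::
    "'a measure \<Rightarrow> (nat \<Rightarrow> 'a \<Rightarrow> real) \<Rightarrow> ('a \<Rightarrow> real) \<Rightarrow> bool" where
  "tendsto_in_prob M X Y \<longleftrightarrow>
     (\<forall>k. X k \<in> borel_measurable M) \<and> Y \<in> borel_measurable M \<and>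
     (\<forall>\<delta>>0. (\<lambda>k. measure M {\<omega> \<in> space M. \<bar>X k \<omega> - Y \<omega>\<bar> > \<delta>}) \<longlonglongrightarrow> 0)"

text \<open>
  An elementary (simple predictable) integrand on \<open>[a,b]\<close> is given by a partition
  \<open>a = \<tau> 0 < \<dots> < \<tau> n = b\<close> and bounded weights \<open>\<eta> i\<close>, where \<open>\<eta> i\<close> is known at time
  \<open>\<tau> i\<close>; it takes the value \<open>\<eta> i\<close> on \<open>(\<tau> i, \<tau> (i+1)]\<close>.
\<close>

definition elementary_integrand ::
    "'a measure \<Rightarrow> (real \<Rightarrow> 'a measure) \<Rightarrow> real \<Rightarrow> real \<Rightarrow> nat \<Rightarrow> (nat \<Rightarrow> real) \<Rightarrow> (nat \<Rightarrow> 'a \<Rightarrow> real) \<Rightarrow> bool" where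
  "elementary_integrand M F a b n \<tau> \<eta> \<longleftrightarrow>
     \<tau> 0 = a \<and> \<tau> n = b \<and> (\<forall>i<n. \<tau> i < \<tau> (Suc i)) \<and>
     (\<forall>i<n. \<eta> i \<in> borel_measurable (F (\<tau> i)) \<and> (\<exists>C. \<forall>\<omega>\<in>space M. \<bar>\<eta> i \<omega>\<bar> \<le> C))"

definition elementary_process ::
    "nat \<Rightarrow> (nat \<Rightarrow> real) \<Rightarrow> (nat \<Rightarrow> 'a \<Rightarrow> real) \<Rightarrow> real \<Rightarrow> 'a \<Rightarrow> real" where
  "elementary_process n \<tau> \<eta> s \<omega> = (\<Sum>i<n. \<eta> i \<omega> * indicator {\<tau> i<..\<tau> (Suc i)} s)"

definition elementary_integral ::
    "(real \<Rightarrow> 'a \<Rightarrow> real) \<Rightarrow> nat \<Rightarrow> (nat \<Rightarrow> real) \<Rightarrow> (nat \<Rightarrow> 'a \<Rightarrow> real) \<Rightarrow> 'a \<Rightarrow> real" where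
  "elementary_integral W n \<tau> \<eta> \<omega> = (\<Sum>i<n. \<eta> i \<omega> * (W (\<tau> (Suc i)) \<omega> - W (\<tau> i) \<omega>))"

definition progressively_measurable ::
    "(real \<Rightarrow> 'a measure) \<Rightarrow> real \<Rightarrow> real \<Rightarrow> (real \<Rightarrow> 'a \<Rightarrow> real) \<Rightarrow> bool" where
  "progressively_measurable F a b H \<longleftrightarrow>
     (\<forall>t\<in>{a..b}. (\<lambda>(s, \<omega>). H s \<omega>) \<in> borel_measurable (restrict_space borel {a..t} \<Otimes>\<^sub>M F t))"

text \<open>
  \<open>has_ito_integral M F W a b H I\<close> says that \<open>I\<close> is (a version of) the Ito integral of \<open>H\<close>
  against \<open>W\<close> over \<open>[a,b]\<close>, for progressively measurable \<open>H\<close> with almost surely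
  square-integrable paths: the limit in probability of the integrals of elementary integrands
  whose squared \<open>L\<^sup>2[a,b]\<close> distance from \<open>H\<close> tends to 0 in probability. The distance is
  written with the nonnegative integral, so that an infinite distance counts as infinite.
\<close>

definition has_ito_integral ::
    "'a measure \<Rightarrow> (real \<Rightarrow> 'a measure) \<Rightarrow> (real \<Rightarrow> 'a \<Rightarrow> real) \<Rightarrow> real \<Rightarrow> real \<Rightarrow>
     (real \<Rightarrow> 'a \<Rightarrow> real) \<Rightarrow> ('a \<Rightarrow> real) \<Rightarrow> bool" where
  "has_ito_integral M F W a b H I \<longleftrightarrow>
     progressively_measurable F a b H \<and>
     (AE \<omega> in M. (\<integral>\<^sup>+s\<in>{a..b}. ennreal ((H s \<omega>)\<^sup>2) \<partial>lborel) < \<infinity>) \<and>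
     (\<exists>n \<tau> \<eta>.
        (\<forall>k. elementary_integrand M F a b (n k) (\<tau> k) (\<eta> k)) \<and>
        (\<forall>\<delta>>0. (\<lambda>k. measure M {\<omega> \<in> space M.
             (\<integral>\<^sup>+s\<in>{a..b}. ennreal ((H s \<omega> - elementary_process (n k) (\<tau> k) (\<eta> k) s \<omega>)\<^sup>2) \<partial>lborel)
               > ennreal \<delta>}) \<longlonglongrightarrow> 0) \<and>
        tendsto_in_prob M (\<lambda>k. elementary_integral W (n k) (\<tau> k) (\<eta> k)) I)"

text \<open>
  \<open>sde_solution M F W b \<sigma> S a X\<close>: the continuous adapted process \<open>X\<close> solves
  \<open>dX(t) = b(t, X(t)) dt + \<sigma>(t, X(t)) dW(t)\<close> in integrated form on the time interval \<open>S\<close>,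
  whose left end point is \<open>a\<close>.
\<close>

definition sde_solution ::
    "'a measure \<Rightarrow> (real \<Rightarrow> 'a measure) \<Rightarrow> (real \<Rightarrow> 'a \<Rightarrow> real) \<Rightarrow> (real \<Rightarrow> real \<Rightarrow> real) \<Rightarrow>
     (real \<Rightarrow> real \<Rightarrow> real) \<Rightarrow> real set \<Rightarrow> real \<Rightarrow> (real \<Rightarrow> 'a \<Rightarrow> real) \<Rightarrow> bool" where
  "sde_solution M F W b \<sigma> S a X \<longleftrightarrow>
     (\<forall>t\<in>S. X t \<in> borel_measurable (F t)) \<and>
     (\<forall>\<omega>\<in>space M. continuous_on S (\<lambda>t. X t \<omega>)) \<and>
     (\<forall>t\<in>S.
        (AE \<omega> in M. set_integrable lborel {a..t} (\<lambda>s. b s (X s \<omega>))) \<and>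
        (\<exists>I. has_ito_integral M F W a t (\<lambda>s \<omega>. \<sigma> s (X s \<omega>)) I \<and>
             (AE \<omega> in M. X t \<omega> = X a \<omega> + (LBINT s:{a..t}. b s (X s \<omega>)) + I \<omega>)))"

text \<open>Modes are indexed by the positive integers; index 0 is never used.\<close>

definition eigf :: "nat \<Rightarrow> real \<Rightarrow> real" where
  "eigf n x = sqrt 2 * sin (real n * pi * x)"

text \<open>
  The noise is \<open>W(t,x) = (\<Sum>n\<ge>1. q n * W n t * eigf n x)\<close>; only its modes enter.
\<close>

definition q_wiener_modes ::
    "'a measure \<Rightarrow> (real \<Rightarrow> 'a measure) \<Rightarrow> (nat \<Rightarrow> real) \<Rightarrow> (nat \<Rightarrow> real \<Rightarrow> 'a \<Rightarrow> real) \<Rightarrow> bool" where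
  "q_wiener_modes M F q W \<longleftrightarrow>
     (\<forall>n\<ge>1. q n \<ge> 0) \<and> summable (\<lambda>n. (q (Suc n))\<^sup>2) \<and>
     (\<forall>n\<ge>1. brownian_motion M F (W n)) \<and>
     prob_space.indep_sets M (\<lambda>n. process_sets M (W n)) {1..}"

definition indep_of_noise ::
    "'a measure \<Rightarrow> ('a \<Rightarrow> real) \<Rightarrow> (nat \<Rightarrow> real \<Rightarrow> 'a \<Rightarrow> real) \<Rightarrow> bool" where
  "indep_of_noise M X W \<longleftrightarrow>
     prob_space.indep_set M (gen_sets M X) (sigma_sets (space M) (\<Union>n\<in>{1..}. process_sets M (W n)))"

text \<open>
  \<open>U n t\<close> is the \<open>n\<close>-th Fourier coefficient of the solution; the initial condition
  \<open>U(0,x) = U m 0 * eigf m x\<close> says that the other coefficients start at 0.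
\<close>

definition she_solution ::
    "'a measure \<Rightarrow> (real \<Rightarrow> 'a measure) \<Rightarrow> real \<Rightarrow> real \<Rightarrow> (nat \<Rightarrow> real) \<Rightarrow>
     (nat \<Rightarrow> real \<Rightarrow> 'a \<Rightarrow> real) \<Rightarrow> nat \<Rightarrow> (nat \<Rightarrow> real \<Rightarrow> 'a \<Rightarrow> real) \<Rightarrow> bool" where
  "she_solution M F \<theta> \<epsilon> q W m U \<longleftrightarrow>
     (\<forall>n\<ge>1. sde_solution M F (W n)
               (\<lambda>t u. - \<theta> * (real n * pi)\<^sup>2 * u) (\<lambda>t u. \<epsilon> * q n * u) {0..} 0 (U n)) \<and>
     (\<forall>n\<ge>1. n \<noteq> m \<longrightarrow> (AE \<omega> in M. U n 0 \<omega> = 0))"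

definition she_field :: "(nat \<Rightarrow> real \<Rightarrow> 'a \<Rightarrow> real) \<Rightarrow> real \<Rightarrow> real \<Rightarrow> 'a \<Rightarrow> real" where
  "she_field U t x \<omega> = (\<Sum>n. U (Suc n) t \<omega> * eigf (Suc n) x)"

text \<open>
  \<open>K\<close> is the Cole-Hopf solution of the KPZ equation on \<open>(xl,xr)\<close>, including the boundary
  values at \<open>xl\<close> and \<open>xr\<close>. If an end point is a zero of \<^term>\<open>eigf m\<close>, the boundary value,
  which would be \<open>\<plusminus>\<infinity>\<close>, is arbitrarily fixed by \<^term>\<open>ln (0::real) = 0\<close>.
\<close>

definition kpz_cole_hopf_solution ::
    "'a measure \<Rightarrow> real \<Rightarrow> real \<Rightarrow> nat \<Rightarrow> real \<Rightarrow> real \<Rightarrow> (nat \<Rightarrow> real \<Rightarrow> 'a \<Rightarrow> real) \<Rightarrow>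
     (real \<Rightarrow> real \<Rightarrow> 'a \<Rightarrow> real) \<Rightarrow> bool" where
  "kpz_cole_hopf_solution M \<theta> \<xi> m xl xr U K \<longleftrightarrow>
     (\<forall>t\<ge>0. \<forall>x\<in>{xl..xr}. \<forall>\<omega>\<in>space M. K t x \<omega> = 2 * \<theta> / \<xi> * ln \<bar>she_field U t x \<omega>\<bar>) \<and>
     (\<forall>x\<in>{xl<..<xr}. AE \<omega> in M.
        K 0 x \<omega> = 2 * \<theta> / \<xi> * ln (U m 0 \<omega> * sqrt 2 * \<bar>sin (real m * pi * x)\<bar>))"

definition log_mean :: "'a measure \<Rightarrow> ('a \<Rightarrow> real) \<Rightarrow> real" where
  "log_mean M X = (LINT \<omega>|M. ln (X \<omega>))"

definition log_var :: "'a measure \<Rightarrow> ('a \<Rightarrow> real) \<Rightarrow> real" where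
  "log_var M X = (LINT \<omega>|M. (ln (X \<omega>) - log_mean M X)\<^sup>2)"

definition lognormal_density :: "real \<Rightarrow> real \<Rightarrow> real \<Rightarrow> real" where
  "lognormal_density \<mu> \<nu> u =
     (if 0 < u then 1 / (u * sqrt (2 * pi * \<nu>)) * exp (- (ln u - \<mu>)\<^sup>2 / (2 * \<nu>)) else 0)"

definition lognormal_rv :: "'a measure \<Rightarrow> ('a \<Rightarrow> real) \<Rightarrow> bool" where
  "lognormal_rv M X \<longleftrightarrow>
     (AE \<omega> in M. X \<omega> > 0) \<and> log_var M X > 0 \<and>
     distributed M lborel X (\<lambda>u. ennreal (lognormal_density (log_mean M X) (log_var M X) u))"

definition b_tilde :: "real \<Rightarrow> real \<Rightarrow> (nat \<Rightarrow> real) \<Rightarrow> nat \<Rightarrow> real" where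
  "b_tilde \<theta> \<epsilon> q m = - \<theta> * (real m * pi)\<^sup>2 - (\<epsilon> * q m)\<^sup>2 / 2"

text \<open>In the following, \<open>X\<close> is the initial value \<open>U m 0\<close>.\<close>

definition mu_tilde ::
    "'a measure \<Rightarrow> ('a \<Rightarrow> real) \<Rightarrow> real \<Rightarrow> real \<Rightarrow> real \<Rightarrow> (nat \<Rightarrow> real) \<Rightarrow> nat \<Rightarrow> real \<Rightarrow> real \<Rightarrow> real" where
  "mu_tilde M X \<theta> \<xi> \<epsilon> q m t x =
     2 * \<theta> / \<xi> * (log_mean M X + b_tilde \<theta> \<epsilon> q m * t + ln \<bar>eigf m x\<bar>)"

definition nu_tilde ::
    "'a measure \<Rightarrow> ('a \<Rightarrow> real) \<Rightarrow> real \<Rightarrow> real \<Rightarrow> real \<Rightarrow> (nat \<Rightarrow> real) \<Rightarrow> nat \<Rightarrow> real \<Rightarrow> real" where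
  "nu_tilde M X \<theta> \<xi> \<epsilon> q m t = 4 * \<theta>\<^sup>2 / \<xi>\<^sup>2 * (log_var M X + (\<epsilon> * q m)\<^sup>2 * t)"

definition kpz_density ::
    "'a measure \<Rightarrow> ('a \<Rightarrow> real) \<Rightarrow> real \<Rightarrow> real \<Rightarrow> real \<Rightarrow> (nat \<Rightarrow> real) \<Rightarrow> nat \<Rightarrow> real \<Rightarrow> real \<Rightarrow> real \<Rightarrow> real" where
  "kpz_density M X \<theta> \<xi> \<epsilon> q m \<kappa> t x =
     1 / sqrt (2 * pi * nu_tilde M X \<theta> \<xi> \<epsilon> q m t) *
     exp (- (\<kappa> - mu_tilde M X \<theta> \<xi> \<epsilon> q m t x)\<^sup>2 / (2 * nu_tilde M X \<theta> \<xi> \<epsilon> q m t))"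

text \<open>
  Meaningful for events \<open>A\<close> of positive probability only.
\<close>

definition cond_expectation_event :: "'a measure \<Rightarrow> ('a \<Rightarrow> real) \<Rightarrow> 'a set \<Rightarrow> real" where
  "cond_expectation_event M Y A = (LINT \<omega>|uniform_measure M A. Y \<omega>)"

end

theory Submission
  imports Defs "HOL-Real_Asymp.Real_Asymp"
begin

text \<open>
  Both halves of the statement reduce to facts about Gaussian variables once two stochastic
  integrals have been identified.

  For the law of \<open>K(t,x)\<close>: the Fourier modes of the heat equation decouple, and each solves the
  linear equation \<open>dX = \<alpha> X dt + \<sigma> X dW\<close>. Any solution is
  \<open>X t = X 0 * exp ((\<alpha> - \<sigma>\<^sup>2/2) * t + \<sigma> * (W t - W 0))\<close> (\<open>linear_sde_solution_eq\<close>). Modes that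
  start at 0 therefore vanish, and the logarithm of the surviving mode \<open>m\<close> is the sum of the
  Gaussian variable \<open>ln (U m 0)\<close>, an independent multiple of \<open>W m t\<close> and a constant. Since \<open>x\<close>
  lies strictly between two neighbouring zeros of the eigenfunction, its logarithm is finite, and
  \<open>K(t,x)\<close> is Gaussian with mean \<open>mu_tilde\<close> and variance \<open>nu_tilde\<close> (\<open>kpz_distributed\<close>).

  For the representation: drift and diffusion coefficient of the equation for \<open>Khat\<close> are
  constants, so that \<open>Khat T = \<kappa> + d * t + c * (B T - B (T - t))\<close>. The average of the initial
  density over this Gaussian displacement is a convolution of two normal densities; the
  variances add up to \<open>nu_tilde t\<close> and the drift moves the mean to \<open>mu_tilde t\<close>
  (\<open>kpz_density_expectation\<close>). Conditioning on an event of probability 1 leaves the measure unchanged.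

  What needs work is the uniqueness for the linear equation, starting from the definition of the
  Ito integral as a limit in probability along some sequence of elementary integrands. Three
  ingredients are used.

  \<^item> A localised second-moment inequality (\<open>block_square_bound\<close>, \<open>transform_bound\<close>): if \<open>\<zeta> j\<close> is
    centred, independent of the past and of variance at most \<open>v j\<close>, then \<open>\<Sum>w j * \<zeta> j\<close> is small
    in probability whenever \<open>\<Sum>v j * (w j)\<^sup>2\<close> is, without any moment assumption on the
    adapted weights \<open>w\<close>. It takes the place of the Ito isometry and of stopping times.
  \<^item> Two elementary integrals are compared on a common refinement of their partitions
    (\<open>elementary_integral_compare\<close>). Hence the Ito integral of a continuous adapted integrand is
    the limit of its left-point Riemann sums over equidistant grids (\<open>ito_integral_riemann\<close>).
  \<^item> With \<open>E s = exp (- (\<alpha> - \<sigma>\<^sup>2/2) * s - \<sigma> * (W s - W 0))\<close>, the increments of \<open>E * X\<close> along a grid of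
    mesh \<open>t/n\<close> are expanded exactly (\<open>product_increment\<close>). Their sum \<open>E t * X t - X 0\<close> has three
    parts: a transform of the relative deviation of one Euler step from the exact step, whose mean
    and variance are \<open>o(1/n)\<close>; the error of a Riemann sum for the drift; and the differences
    between the stochastic integral and its left-point value on each cell. All three tend to 0
    in probability, while \<open>E t * X t - X 0\<close> does not depend on \<open>n\<close>, so it is 0.
\<close>

section \<open>Convergence in probability\<close>

context prob_space
begin

lemma tendsto_in_prob_measurable:
  assumes "tendsto_in_prob M X Y"
  shows "X k \<in> borel_measurable M" and "Y \<in> borel_measurable M"
  using assms by (auto simp: tendsto_in_prob_def)

lemma tendsto_in_probD:
  assumes "tendsto_in_prob M X Y" "\<delta> > 0"
  shows "(\<lambda>k. prob {\<omega>\<in>space M. \<bar>X k \<omega> - Y \<omega>\<bar> > \<delta>}) \<longlonglongrightarrow> 0"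
  using assms by (auto simp: tendsto_in_prob_def)

lemma tendsto_in_prob_AE:
  assumes [measurable]: "\<And>k. X k \<in> borel_measurable M" "Y \<in> borel_measurable M"
    and lim: "AE \<omega> in M. (\<lambda>k. X k \<omega>) \<longlonglongrightarrow> Y \<omega>"
  shows "tendsto_in_prob M X Y"
  unfolding tendsto_in_prob_def
proof (intro conjI allI impI)
  fix \<delta> :: real assume "\<delta> > 0"
  have "(\<lambda>k. LINT \<omega>|M. indicator {\<omega>\<in>space M. \<bar>X k \<omega> - Y \<omega>\<bar> > \<delta>} \<omega> :: real)
          \<longlonglongrightarrow> (LINT \<omega>|M. 0)"
  proof (rule integral_dominated_convergence[where w="\<lambda>_. 1"])
    show "AE \<omega> in M. (\<lambda>k. indicator {\<omega>\<in>space M. \<bar>X k \<omega> - Y \<omega>\<bar> > \<delta>} \<omega> :: real) \<longlonglongrightarrow> 0"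
      using lim
    proof eventually_elim
      case (elim \<omega>)
      from tendstoD[OF elim \<open>\<delta> > 0\<close>]
      have "\<forall>\<^sub>F k in sequentially.
        indicator {\<omega>\<in>space M. \<bar>X k \<omega> - Y \<omega>\<bar> > \<delta>} \<omega> = (0::real)"
        by eventually_elim (auto simp: dist_real_def)
      then show ?case by (rule tendsto_eventually)
    qed
  qed (auto simp: indicator_def)
  then show "(\<lambda>k. prob {\<omega>\<in>space M. \<bar>X k \<omega> - Y \<omega>\<bar> > \<delta>}) \<longlonglongrightarrow> 0"
    by simp
qed (use assms in auto)

lemma prob_le_add:
  assumes "{\<omega>\<in>space M. P \<omega>} \<subseteq> {\<omega>\<in>space M. Q \<omega>} \<union> {\<omega>\<in>space M. R \<omega>}"
    and "{\<omega>\<in>space M. Q \<omega>} \<in> events" "{\<omega>\<in>space M. R \<omega>} \<in> events"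
  shows "prob {\<omega>\<in>space M. P \<omega>} \<le> prob {\<omega>\<in>space M. Q \<omega>} + prob {\<omega>\<in>space M. R \<omega>}"
  using finite_measure_mono[OF assms(1)] measure_Un_le[OF assms(2,3)] assms(2,3)
  by (meson order_trans sets.Un)

lemma tendsto_in_prob_add:
  assumes "tendsto_in_prob M X Y" "tendsto_in_prob M X' Y'"
  shows "tendsto_in_prob M (\<lambda>k \<omega>. X k \<omega> + X' k \<omega>) (\<lambda>\<omega>. Y \<omega> + Y' \<omega>)"
proof -
  note [measurable] = tendsto_in_prob_measurable[OF assms(1)] tendsto_in_prob_measurable[OF assms(2)]
  show ?thesis unfolding tendsto_in_prob_def
  proof (intro conjI allI impI)
    fix \<delta> :: real assume "\<delta> > 0"
    then have lim: "(\<lambda>k. prob {\<omega>\<in>space M. \<bar>X k \<omega> - Y \<omega>\<bar> > \<delta>/2}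
                       + prob {\<omega>\<in>space M. \<bar>X' k \<omega> - Y' \<omega>\<bar> > \<delta>/2}) \<longlonglongrightarrow> 0"
      using assms by (intro tendsto_add_zero tendsto_in_probD) auto
    show "(\<lambda>k. prob {\<omega>\<in>space M. \<bar>X k \<omega> + X' k \<omega> - (Y \<omega> + Y' \<omega>)\<bar> > \<delta>}) \<longlonglongrightarrow> 0"
    proof (rule tendsto_sandwich[OF _ _ tendsto_const lim])
      show "\<forall>\<^sub>F k in sequentially. prob {\<omega>\<in>space M. \<bar>X k \<omega> + X' k \<omega> - (Y \<omega> + Y' \<omega>)\<bar> > \<delta>}
          \<le> prob {\<omega>\<in>space M. \<bar>X k \<omega> - Y \<omega>\<bar> > \<delta>/2} + prob {\<omega>\<in>space M. \<bar>X' k \<omega> - Y' \<omega>\<bar> > \<delta>/2}"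
        by (intro always_eventually allI prob_le_add) (auto simp: abs_if split: if_splits)
    qed auto
  qed auto
qed

lemma tendsto_in_prob_mult_rv:
  assumes "tendsto_in_prob M X Y" and [measurable]: "Z \<in> borel_measurable M"
  shows "tendsto_in_prob M (\<lambda>k \<omega>. Z \<omega> * X k \<omega>) (\<lambda>\<omega>. Z \<omega> * Y \<omega>)"
proof -
  note [measurable] = tendsto_in_prob_measurable[OF assms(1)]
  show ?thesis unfolding tendsto_in_prob_def
  proof (intro conjI allI impI)
    fix \<delta> :: real assume \<delta>: "\<delta> > 0"
    \<comment> \<open>\<open>Z\<close> need not be bounded, but it is at most \<open>R + 1\<close> outside an event of small probability.\<close>
    have tail: "(\<lambda>R. prob {\<omega>\<in>space M. \<bar>Z \<omega> * (1 / real (Suc R)) - 0\<bar> > 1}) \<longlonglongrightarrow> 0"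
    proof -
      have "(\<lambda>R. c * (1 / real (Suc R))) \<longlonglongrightarrow> 0" for c :: real
        using tendsto_mult[OF tendsto_const LIMSEQ_inverse_real_of_nat, of c]
        by (simp add: inverse_eq_divide)
      then have "tendsto_in_prob M (\<lambda>R \<omega>. Z \<omega> * (1 / real (Suc R))) (\<lambda>_. 0)"
        by (intro tendsto_in_prob_AE) auto
      from tendsto_in_probD[OF this, of 1] show ?thesis by simp
    qed
    show "(\<lambda>k. prob {\<omega>\<in>space M. \<bar>Z \<omega> * X k \<omega> - Z \<omega> * Y \<omega>\<bar> > \<delta>}) \<longlonglongrightarrow> 0"
    proof (rule LIMSEQ_I)
      fix r :: real assume r: "r > 0"
      from LIMSEQ_D[OF tail, of "r/2"] r obtain R where
        R: "prob {\<omega>\<in>space M. \<bar>Z \<omega> * (1 / real (Suc R)) - 0\<bar> > 1} < r/2"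
        by fastforce
      have "(\<lambda>k. prob {\<omega>\<in>space M. \<bar>X k \<omega> - Y \<omega>\<bar> > \<delta> / real (Suc R)}) \<longlonglongrightarrow> 0"
        using assms(1) \<delta> by (auto simp: tendsto_in_prob_def)
      from LIMSEQ_D[OF this, of "r/2"] r obtain K where
        K: "\<And>k. k \<ge> K \<Longrightarrow> prob {\<omega>\<in>space M. \<bar>X k \<omega> - Y \<omega>\<bar> > \<delta> / real (Suc R)} < r/2"
        by auto
      have "prob {\<omega>\<in>space M. \<bar>Z \<omega> * X k \<omega> - Z \<omega> * Y \<omega>\<bar> > \<delta>}
          \<le> prob {\<omega>\<in>space M. \<bar>Z \<omega> * (1 / real (Suc R)) - 0\<bar> > 1}
            + prob {\<omega>\<in>space M. \<bar>X k \<omega> - Y \<omega>\<bar> > \<delta> / real (Suc R)}" for k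
      proof (intro prob_le_add subsetI)
        fix \<omega> assume "\<omega> \<in> {\<omega>\<in>space M. \<bar>Z \<omega> * X k \<omega> - Z \<omega> * Y \<omega>\<bar> > \<delta>}"
        then have w: "\<omega> \<in> space M" "\<bar>Z \<omega>\<bar> * \<bar>X k \<omega> - Y \<omega>\<bar> > \<delta>"
          by (auto simp: abs_mult[symmetric] algebra_simps)
        have "\<bar>Z \<omega>\<bar> * \<bar>X k \<omega> - Y \<omega>\<bar> \<le> \<delta>"
          if "\<bar>Z \<omega>\<bar> \<le> real (Suc R)" "\<bar>X k \<omega> - Y \<omega>\<bar> \<le> \<delta> / real (Suc R)"
          using mult_mono[OF that] by simp
        with w have "\<bar>Z \<omega>\<bar> > real (Suc R) \<or> \<bar>X k \<omega> - Y \<omega>\<bar> > \<delta> / real (Suc R)"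
          by linarith
        then show "\<omega> \<in> {\<omega>\<in>space M. \<bar>Z \<omega> * (1 / real (Suc R)) - 0\<bar> > 1}
          \<union> {\<omega>\<in>space M. \<bar>X k \<omega> - Y \<omega>\<bar> > \<delta> / real (Suc R)}"
          using w(1) by (auto simp: abs_mult field_simps)
      qed auto
      with R K show "\<exists>no. \<forall>n\<ge>no.
          norm (prob {\<omega>\<in>space M. \<bar>Z \<omega> * X n \<omega> - Z \<omega> * Y \<omega>\<bar> > \<delta>} - 0) < r"
        by (intro exI[of _ K] allI impI) (smt (verit) field_sum_of_halves measure_nonneg real_norm_def)
    qed
  qed auto
qed

lemma tendsto_in_prob_diff:
  assumes "tendsto_in_prob M X Y" "tendsto_in_prob M X' Y'"
  shows "tendsto_in_prob M (\<lambda>k \<omega>. X k \<omega> - X' k \<omega>) (\<lambda>\<omega>. Y \<omega> - Y' \<omega>)"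
  using tendsto_in_prob_add[OF assms(1) tendsto_in_prob_mult_rv[OF assms(2), of "\<lambda>_. -1"]] by simp

lemma tendsto_in_prob_sum:
  assumes "\<And>i. i \<in> I \<Longrightarrow> tendsto_in_prob M (X i) (Y i)"
  shows "tendsto_in_prob M (\<lambda>k \<omega>. \<Sum>i\<in>I. X i k \<omega>) (\<lambda>\<omega>. \<Sum>i\<in>I. Y i \<omega>)"
  using assms
proof (induction I rule: infinite_finite_induct)
  case (insert i I)
  then show ?case using tendsto_in_prob_add[of "X i" "Y i"] by simp
qed (auto simp: tendsto_in_prob_def)

lemma tendsto_in_prob_unique:
  assumes "tendsto_in_prob M X Y" "tendsto_in_prob M X Z"
  shows "AE \<omega> in M. Y \<omega> = Z \<omega>"
proof -
  note [measurable] = tendsto_in_prob_measurable[OF assms(1)] tendsto_in_prob_measurable[OF assms(2)]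
  have D: "tendsto_in_prob M (\<lambda>k \<omega>. 0) (\<lambda>\<omega>. Y \<omega> - Z \<omega>)"
    using tendsto_in_prob_diff[OF assms] by simp
  have "AE \<omega> in M. \<not> \<bar>Y \<omega> - Z \<omega>\<bar> > 1 / real (Suc n)" for n
  proof -
    have "(\<lambda>k::nat. prob {\<omega>\<in>space M. \<bar>0 - (Y \<omega> - Z \<omega>)\<bar> > 1 / real (Suc n)}) \<longlonglongrightarrow> 0"
      using D by (auto simp: tendsto_in_prob_def)
    then have "prob {\<omega>\<in>space M. \<bar>Y \<omega> - Z \<omega>\<bar> > 1 / real (Suc n)} = 0"
      by (simp add: LIMSEQ_const_iff abs_minus_commute)
    then show ?thesis
      by (subst AE_iff_measurable[OF _ refl]) (auto simp: emeasure_eq_measure)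
  qed
  then have "AE \<omega> in M. \<forall>n. \<not> \<bar>Y \<omega> - Z \<omega>\<bar> > 1 / real (Suc n)"
    by (simp add: AE_all_countable)
  then show ?thesis
  proof eventually_elim
    case (elim \<omega>)
    show ?case
    proof (rule ccontr)
      assume "Y \<omega> \<noteq> Z \<omega>"
      then have "\<bar>Y \<omega> - Z \<omega>\<bar> > 0" by simp
      from nat_approx_posE[OF this] obtain n where "1 / real (Suc n) < \<bar>Y \<omega> - Z \<omega>\<bar>" by auto
      with elim show False by blast
    qed
  qed
qed

text \<open>
  The shape in which the localised inequality below delivers convergence: the bound
  holds for all \<open>e\<close>, so \<open>n\<close> is sent to infinity first and \<open>e\<close> to 0 afterwards.
\<close>

lemma tendsto_in_prob_zeroI:
  assumes [measurable]: "\<And>n. X n \<in> borel_measurable M"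
    and V: "tendsto_in_prob M V (\<lambda>_. 0)"
    and bound: "\<And>n \<delta> e. n > 0 \<Longrightarrow> \<delta> > 0 \<Longrightarrow> e > 0 \<Longrightarrow>
      prob {\<omega>\<in>space M. \<bar>X n \<omega>\<bar> > \<delta>} \<le> prob {\<omega>\<in>space M. V n \<omega> > e} + c \<delta> * e"
  shows "tendsto_in_prob M X (\<lambda>_. 0)"
  unfolding tendsto_in_prob_def
proof (intro conjI allI impI)
  fix \<delta> :: real assume \<delta>: "\<delta> > 0"
  note [measurable] = tendsto_in_prob_measurable(1)[OF V]
  show "(\<lambda>k. prob {\<omega>\<in>space M. \<bar>X k \<omega> - 0\<bar> > \<delta>}) \<longlonglongrightarrow> 0"
  proof (rule LIMSEQ_I)
    fix r :: real assume r: "r > 0"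
    define e where "e = r / (2 * (\<bar>c \<delta>\<bar> + 1))"
    have e: "e > 0" "c \<delta> * e < r/2 \<or> c \<delta> * e \<le> 0"
      using r by (auto simp: e_def field_simps abs_if add_pos_nonneg mult_le_0_iff intro!: divide_pos_pos)
    then have e': "c \<delta> * e \<le> r / 2" using r by auto
    have "(\<lambda>k. prob {\<omega>\<in>space M. \<bar>V k \<omega> - 0\<bar> > e}) \<longlonglongrightarrow> 0"
      using V e by (auto simp: tendsto_in_prob_def)
    from LIMSEQ_D[OF this, of "r/2"] r obtain K where
      K: "\<And>k. k \<ge> K \<Longrightarrow> prob {\<omega>\<in>space M. \<bar>V k \<omega> - 0\<bar> > e} < r/2" by auto
    show "\<exists>no. \<forall>n\<ge>no. norm (prob {\<omega>\<in>space M. \<bar>X n \<omega> - 0\<bar> > \<delta>} - 0) < r"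
    proof (intro exI allI impI)
      fix n assume "n \<ge> Suc K"
      then have "n \<ge> K" "n > 0" by auto
      have "prob {\<omega>\<in>space M. V n \<omega> > e} \<le> prob {\<omega>\<in>space M. \<bar>V n \<omega> - 0\<bar> > e}"
        by (intro finite_measure_mono) auto
      with K[OF \<open>n \<ge> K\<close>] bound[OF \<open>n > 0\<close> \<delta> e(1)] e'
      show "norm (prob {\<omega>\<in>space M. \<bar>X n \<omega> - 0\<bar> > \<delta>} - 0) < r" by simp
    qed
  qed
qed auto

lemma tendsto_in_prob_subseq:
  assumes "tendsto_in_prob M X Y" "strict_mono f"
  shows "tendsto_in_prob M (\<lambda>k. X (f k)) Y"
  unfolding tendsto_in_prob_def
proof (intro conjI allI impI)
  fix \<delta> :: real assume "\<delta> > 0"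
  from LIMSEQ_subseq_LIMSEQ[OF tendsto_in_probD[OF assms(1) this] assms(2)]
  show "(\<lambda>k. prob {\<omega>\<in>space M. \<bar>X (f k) \<omega> - Y \<omega>\<bar> > \<delta>}) \<longlonglongrightarrow> 0" by (simp add: comp_def)
qed (rule tendsto_in_prob_measurable[OF assms(1)])+

lemma tendsto_in_prob_const:
  "Y \<in> borel_measurable M \<Longrightarrow> tendsto_in_prob M (\<lambda>k. Y) Y"
  by (simp add: tendsto_in_prob_def)

text \<open>
  For two-scale approximations: each \<open>J n\<close> is approximated by the \<open>S n k\<close>, and these are small
  as \<open>n\<close> grows however \<open>k\<close> is chosen. Choosing \<open>k\<close> so large that \<open>S n k\<close> is within
  \<open>1/(n+1)\<close> of \<open>J n\<close>, up to an event of that probability, transfers the smallness to \<open>J\<close>.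
\<close>

lemma tendsto_in_prob_diagonal:
  assumes S: "\<And>n. tendsto_in_prob M (S n) (J n)"
    and diag: "\<And>K :: nat \<Rightarrow> nat. tendsto_in_prob M (\<lambda>n. S n (K n)) (\<lambda>_. 0)"
  shows "tendsto_in_prob M J (\<lambda>_. 0)"
proof -
  have "\<exists>k. prob {\<omega>\<in>space M. \<bar>S n k \<omega> - J n \<omega>\<bar> > 1 / real (Suc n)} < 1 / real (Suc n)" for n
  proof -
    have "\<forall>\<^sub>F k in sequentially. prob {\<omega>\<in>space M. \<bar>S n k \<omega> - J n \<omega>\<bar> > 1 / real (Suc n)} < 1 / real (Suc n)"
      by (rule order_tendstoD(2)[OF tendsto_in_probD[OF S]]) auto
    then show ?thesis by (rule eventually_happens'[OF sequentially_bot])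
  qed
  then obtain K where K: "\<And>n. prob {\<omega>\<in>space M. \<bar>S n (K n) \<omega> - J n \<omega>\<bar> > 1 / real (Suc n)} < 1 / real (Suc n)"
    by metis
  note [measurable] = tendsto_in_prob_measurable[OF S]
  have "tendsto_in_prob M (\<lambda>n \<omega>. S n (K n) \<omega> - J n \<omega>) (\<lambda>_. 0)"
    unfolding tendsto_in_prob_def
  proof (intro conjI allI impI)
    fix \<delta> :: real assume \<delta>: "\<delta> > 0"
    show "(\<lambda>n. prob {\<omega>\<in>space M. \<bar>S n (K n) \<omega> - J n \<omega> - 0\<bar> > \<delta>}) \<longlonglongrightarrow> 0"
    proof (rule Lim_null_comparison)
      have lim: "(\<lambda>n. 1 / real (Suc n)) \<longlonglongrightarrow> 0" by real_asymp
      show "(\<lambda>n. 1 / real (Suc n)) \<longlonglongrightarrow> 0" by (rule lim)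
      show "\<forall>\<^sub>F n in sequentially. norm (prob {\<omega>\<in>space M. \<bar>S n (K n) \<omega> - J n \<omega> - 0\<bar> > \<delta>}) \<le> 1 / real (Suc n)"
        using order_tendstoD(2)[OF lim \<delta>]
      proof eventually_elim
        case (elim n)
        have "prob {\<omega>\<in>space M. \<bar>S n (K n) \<omega> - J n \<omega> - 0\<bar> > \<delta>} \<le> prob {\<omega>\<in>space M. \<bar>S n (K n) \<omega> - J n \<omega>\<bar> > 1 / real (Suc n)}"
          using elim by (intro finite_measure_mono) auto
        with K[of n] show ?case by simp
      qed
    qed
  qed auto
  from tendsto_in_prob_diff[OF diag[of K] this] show ?thesis by simp
qed

end

section \<open>Transforms of centred noise by adapted weights\<close>

context prob_space
begin

lemma indep_mult_square_integrable:
  fixes Y Z :: "'a \<Rightarrow> real"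
  assumes "indep_var borel Y borel Z" "integrable M (\<lambda>\<omega>. (Y \<omega>)\<^sup>2)" "integrable M (\<lambda>\<omega>. (Z \<omega>)\<^sup>2)"
  shows "integrable M (\<lambda>\<omega>. (Y \<omega> * Z \<omega>)\<^sup>2)"
    and "expectation (\<lambda>\<omega>. (Y \<omega> * Z \<omega>)\<^sup>2) = expectation (\<lambda>\<omega>. (Y \<omega>)\<^sup>2) * expectation (\<lambda>\<omega>. (Z \<omega>)\<^sup>2)"
proof -
  have i: "indep_var borel (\<lambda>\<omega>. (Y \<omega>)\<^sup>2) borel (\<lambda>\<omega>. (Z \<omega>)\<^sup>2)"
    using indep_var_compose[OF assms(1), of "\<lambda>x. x\<^sup>2" borel "\<lambda>x. x\<^sup>2" borel] by (simp add: comp_def)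
  show "integrable M (\<lambda>\<omega>. (Y \<omega> * Z \<omega>)\<^sup>2)"
    using indep_var_integrable[OF i assms(2,3)] by (simp add: power_mult_distrib)
  show "expectation (\<lambda>\<omega>. (Y \<omega> * Z \<omega>)\<^sup>2) = expectation (\<lambda>\<omega>. (Y \<omega>)\<^sup>2) * expectation (\<lambda>\<omega>. (Z \<omega>)\<^sup>2)"
    using indep_var_lebesgue_integral[OF i assms(2,3)] by (simp add: power_mult_distrib)
qed

end

lemma measurable_sub:
  assumes "subalgebra M A" "f \<in> measurable A N" shows "f \<in> measurable M N"
  using measurable_from_subalg[OF assms] .

text \<open>
  \<open>\<zeta> j\<close> is the noise of step \<open>j\<close>: known at time \<open>j + 1\<close>, independent of the past \<open>A j\<close>, centred.
  The number \<open>v j\<close> is only an upper bound of its variance but must be positive: noise that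
  degenerates to 0 is then covered, while a bound on \<open>v j * (w j)\<^sup>2\<close> still bounds the weight.
\<close>

locale martingale_noise = prob_space M for M :: "'a measure" +
  fixes A :: "nat \<Rightarrow> 'a measure" and \<zeta> :: "nat \<Rightarrow> 'a \<Rightarrow> real" and v :: "nat \<Rightarrow> real" and L :: nat
  assumes sub: "\<And>j. subalgebra M (A j)"
    and mono: "\<And>i j. i \<le> j \<Longrightarrow> j \<le> L \<Longrightarrow> sets (A i) \<subseteq> sets (A j)"
    and adapted: "\<And>j. j < L \<Longrightarrow> \<zeta> j \<in> borel_measurable (A (Suc j))"
    and indep: "\<And>j Y. j < L \<Longrightarrow> Y \<in> borel_measurable (A j) \<Longrightarrow> indep_var borel Y borel (\<zeta> j)"
    and sq_int: "\<And>j. j < L \<Longrightarrow> integrable M (\<lambda>\<omega>. (\<zeta> j \<omega>)\<^sup>2)"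
    and mean_zero: "\<And>j. j < L \<Longrightarrow> expectation (\<zeta> j) = 0"
    and var_le: "\<And>j. j < L \<Longrightarrow> expectation (\<lambda>\<omega>. (\<zeta> j \<omega>)\<^sup>2) \<le> v j"
    and v_pos: "\<And>j. j < L \<Longrightarrow> v j > 0"
begin

lemma meas_mono: "i \<le> j \<Longrightarrow> j \<le> L \<Longrightarrow> f \<in> borel_measurable (A i) \<Longrightarrow> f \<in> borel_measurable (A j)"
  using measurable_from_subalg[of "A j" "A i" f borel] sub mono
  by (auto simp: subalgebra_def)

text \<open>
  Orthogonality: the last noise is independent of everything multiplied with it, so the
  mixed term has expectation 0 and the variances add up.
\<close>

lemma transform_variance:
  assumes w: "\<And>j. j < L \<Longrightarrow> w j \<in> borel_measurable (A j)"
    and wi: "\<And>j. j < L \<Longrightarrow> integrable M (\<lambda>\<omega>. (w j \<omega>)\<^sup>2)"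
    and r: "r \<le> L" "p \<le> r"
  shows "integrable M (\<lambda>\<omega>. (\<Sum>j=p..<r. w j \<omega> * \<zeta> j \<omega>)\<^sup>2) \<and>
    expectation (\<lambda>\<omega>. (\<Sum>j=p..<r. w j \<omega> * \<zeta> j \<omega>)\<^sup>2) \<le> (\<Sum>j=p..<r. v j * expectation (\<lambda>\<omega>. (w j \<omega>)\<^sup>2))"
  using r(2,1)
proof (induction r rule: dec_induct)
  case (step r)
  let ?S = "\<lambda>\<omega>. \<Sum>j=p..<r. w j \<omega> * \<zeta> j \<omega>"
  have r: "r < L" using step by simp
  have SA: "?S \<in> borel_measurable (A r)"
    using r by (intro borel_measurable_sum borel_measurable_times)
      (auto intro: meas_mono[OF _ _ w] meas_mono[OF _ _ adapted])
  have SM[measurable]: "?S \<in> borel_measurable M" by (rule measurable_sub[OF sub SA])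
  have wM[measurable]: "w r \<in> borel_measurable M" by (rule measurable_sub[OF sub w[OF r]])
  have zM[measurable]: "\<zeta> r \<in> borel_measurable M" by (rule measurable_sub[OF sub adapted[OF r]])
  have IS: "integrable M (\<lambda>\<omega>. (?S \<omega>)\<^sup>2)" using step r by auto
  note sq = indep_mult_square_integrable[OF indep[OF r w[OF r]] wi[OF r] sq_int[OF r]]
  have SwA: "(\<lambda>\<omega>. ?S \<omega> * w r \<omega>) \<in> borel_measurable (A r)"
    using SA w[OF r] by (rule borel_measurable_times)
  have Sw: "integrable M (\<lambda>\<omega>. ?S \<omega> * w r \<omega>)"
  proof (rule Bochner_Integration.integrable_bound)
    show "integrable M (\<lambda>\<omega>. (?S \<omega>)\<^sup>2 + (w r \<omega>)\<^sup>2)" using IS wi[OF r] by auto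
    have "\<bar>a * b\<bar> \<le> a\<^sup>2 + b\<^sup>2" for a b :: real
      using sum_squares_bound[of "\<bar>a\<bar>" "\<bar>b\<bar>"] mult_nonneg_nonneg[of "\<bar>a\<bar>" "\<bar>b\<bar>"]
      unfolding abs_mult by (simp add: mult.assoc del: zero_le_mult_iff mult_nonneg_nonneg)
    then show "AE \<omega> in M. norm (?S \<omega> * w r \<omega>) \<le> norm ((?S \<omega>)\<^sup>2 + (w r \<omega>)\<^sup>2)"
      by (auto intro!: AE_I2)
  qed auto
  have zi: "integrable M (\<zeta> r)" by (rule square_integrable_imp_integrable[OF zM sq_int[OF r]])
  have i3: "integrable M (\<lambda>\<omega>. ?S \<omega> * w r \<omega> * \<zeta> r \<omega>)"
    by (rule indep_var_integrable[OF indep[OF r SwA] Sw zi])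
  have e3: "expectation (\<lambda>\<omega>. ?S \<omega> * w r \<omega> * \<zeta> r \<omega>) = 0"
    using indep_var_lebesgue_integral[OF indep[OF r SwA] Sw zi] mean_zero[OF r] by simp
  have eq: "(\<lambda>\<omega>. (\<Sum>j=p..<Suc r. w j \<omega> * \<zeta> j \<omega>)\<^sup>2) =
      (\<lambda>\<omega>. (?S \<omega>)\<^sup>2 + 2 * (?S \<omega> * w r \<omega> * \<zeta> r \<omega>) + (w r \<omega> * \<zeta> r \<omega>)\<^sup>2)"
    using step by (auto simp: fun_eq_iff power2_sum algebra_simps)
  have "expectation (\<lambda>\<omega>. (\<Sum>j=p..<Suc r. w j \<omega> * \<zeta> j \<omega>)\<^sup>2)
      = expectation (\<lambda>\<omega>. (?S \<omega>)\<^sup>2) + expectation (\<lambda>\<omega>. (w r \<omega>)\<^sup>2) * expectation (\<lambda>\<omega>. (\<zeta> r \<omega>)\<^sup>2)"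
    unfolding eq using IS i3 e3 sq by simp
  also have "\<dots> \<le> (\<Sum>j=p..<r. v j * expectation (\<lambda>\<omega>. (w j \<omega>)\<^sup>2)) + expectation (\<lambda>\<omega>. (w r \<omega>)\<^sup>2) * v r"
    using step r var_le[OF r] by (intro add_mono mult_left_mono) auto
  finally show ?case
    unfolding eq using IS i3 sq step by (auto simp: algebra_simps)
qed auto

text \<open>
  Terms are kept as long as their running sum does not exceed \<open>e\<close>. Whether term \<open>j\<close> is kept is
  decided by the terms up to \<open>j\<close>, which keeps truncated weights adapted.
\<close>

lemma truncation_sum:
  fixes V :: "nat \<Rightarrow> real"
  assumes "\<And>j. j < n \<Longrightarrow> V j \<ge> 0" "e \<ge> 0"
  shows "(\<Sum>j<n. if (\<Sum>l\<le>j. V l) \<le> e then V j else 0) \<le> e"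
  using assms
proof (induction n)
  case (Suc n)
  show ?case
  proof (cases "(\<Sum>l\<le>n. V l) \<le> e")
    case True
    have "(\<Sum>j<Suc n. if (\<Sum>l\<le>j. V l) \<le> e then V j else 0) \<le> (\<Sum>j<Suc n. V j)"
      using Suc.prems by (intro sum_mono) auto
    also have "\<dots> \<le> e" using True by (simp add: lessThan_Suc_atMost)
    finally show ?thesis .
  next
    case False then show ?thesis using Suc by simp
  qed
qed auto

text \<open>
  The weights are switched off once the running sum of \<open>v j * (w j)\<^sup>2\<close> exceeds \<open>e\<close>. The truncated
  weights are bounded and adapted, the expected sum of the squared block sums is at most \<open>e\<close>, and
  Markov's inequality applies; they differ from the original ones only if the full sum exceeds
  \<open>e\<close>. The sum of squares over blocks is what the Cauchy-Schwarz argument in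
  \<open>block_residual_vanishes\<close> asks for; a single block gives \<open>transform_bound\<close>.
\<close>

lemma block_square_bound:
  assumes L: "L = n * N"
    and w: "\<And>j. j < L \<Longrightarrow> w j \<in> borel_measurable (A j)"
    and \<delta>: "\<delta> > 0" and e: "e > 0"
  shows "prob {\<omega>\<in>space M. (\<Sum>i<n. (\<Sum>j=i*N..<i*N+N. w j \<omega> * \<zeta> j \<omega>)\<^sup>2) > \<delta>}
      \<le> prob {\<omega>\<in>space M. (\<Sum>j<L. v j * (w j \<omega>)\<^sup>2) > e} + e / \<delta>"
proof -
  define w' where "w' j \<omega> = (if (\<Sum>l\<le>j. v l * (w l \<omega>)\<^sup>2) \<le> e then w j \<omega> else 0)" for j \<omega>
  have w'A: "w' j \<in> borel_measurable (A j)" if "j < L" for j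
  proof -
    have [measurable]: "w l \<in> borel_measurable (A j)" if "l \<le> j" for l
      using that w[of l] meas_mono[of l j] \<open>j < L\<close> by auto
    show ?thesis unfolding w'_def by measurable
  qed
  have wM[measurable]: "w j \<in> borel_measurable M" if "j < L" for j
    using measurable_sub[OF sub w] that by blast
  have w'M[measurable]: "w' j \<in> borel_measurable M" if "j < L" for j
    using measurable_sub[OF sub w'A] that by blast
  have zM[measurable]: "\<zeta> j \<in> borel_measurable M" if "j < L" for j
    using measurable_sub[OF sub adapted] that by blast
  have w'b: "(w' j \<omega>)\<^sup>2 \<le> e / v j" if j: "j < L" for j \<omega>
  proof (cases "(\<Sum>l\<le>j. v l * (w l \<omega>)\<^sup>2) \<le> e")
    case True
    have "v j * (w j \<omega>)\<^sup>2 \<le> (\<Sum>l\<le>j. v l * (w l \<omega>)\<^sup>2)"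
      using j by (intro member_le_sum) (auto intro!: mult_nonneg_nonneg less_imp_le[OF v_pos])
    with True show ?thesis using v_pos[OF j] by (auto simp: w'_def field_simps)
  qed (use e v_pos[OF j] in \<open>auto simp: w'_def\<close>)
  have w'i: "integrable M (\<lambda>\<omega>. (w' j \<omega>)\<^sup>2)" if "j < L" for j
    using w'b[OF that] w'M[OF that] by (intro integrable_const_bound[where B="e / v j"]) auto
  let ?Q = "\<lambda>w \<omega>. \<Sum>i<n. (\<Sum>j=i*N..<i*N+N. w j \<omega> * \<zeta> j \<omega>)\<^sup>2"
  have idx: "i*N+N \<le> L" if "i < n" for i
    using that mult_le_mono1[of "Suc i" n N] by (simp add: L)
  note tv = transform_variance[of w', OF w'A w'i idx, OF _ _ _ le_add1]
  have Qi: "integrable M (?Q w')" using tv by auto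
  have "expectation (?Q w') \<le> (\<Sum>i<n. \<Sum>j=i*N..<i*N+N. v j * expectation (\<lambda>\<omega>. (w' j \<omega>)\<^sup>2))"
    using tv by (subst Bochner_Integration.integral_sum) (auto intro!: sum_mono)
  also have "\<dots> = (\<Sum>j<L. v j * expectation (\<lambda>\<omega>. (w' j \<omega>)\<^sup>2))"
    unfolding L sum.nat_group by simp
  also have "\<dots> = expectation (\<lambda>\<omega>. \<Sum>j<L. v j * (w' j \<omega>)\<^sup>2)"
    using w'i by (subst Bochner_Integration.integral_sum) auto
  also have "\<dots> \<le> expectation (\<lambda>\<omega>. e)"
  proof (intro integral_mono)
    fix \<omega>
    have "(\<Sum>j<L. v j * (w' j \<omega>)\<^sup>2) = (\<Sum>j<L. if (\<Sum>l\<le>j. v l * (w l \<omega>)\<^sup>2) \<le> e then v j * (w j \<omega>)\<^sup>2 else 0)"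
      by (intro sum.cong) (auto simp: w'_def)
    also have "\<dots> \<le> e"
      using e by (intro truncation_sum) (auto intro!: mult_nonneg_nonneg less_imp_le[OF v_pos])
    finally show "(\<Sum>j<L. v j * (w' j \<omega>)\<^sup>2) \<le> e" .
  qed (use w'i in auto)
  finally have EQ: "expectation (?Q w') \<le> e" by (simp add: prob_space)
  have "prob {\<omega>\<in>space M. ?Q w \<omega> > \<delta>}
      \<le> prob {\<omega>\<in>space M. (\<Sum>j<L. v j * (w j \<omega>)\<^sup>2) > e} + prob {\<omega>\<in>space M. ?Q w' \<omega> \<ge> \<delta>}"
  proof (rule prob_le_add)
    show "{\<omega>\<in>space M. (\<Sum>j<L. v j * (w j \<omega>)\<^sup>2) > e} \<in> events" by measurable
    show "{\<omega>\<in>space M. ?Q w' \<omega> \<ge> \<delta>} \<in> events" using Qi by measurable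
    show "{\<omega>\<in>space M. ?Q w \<omega> > \<delta>}
      \<subseteq> {\<omega>\<in>space M. (\<Sum>j<L. v j * (w j \<omega>)\<^sup>2) > e} \<union> {\<omega>\<in>space M. ?Q w' \<omega> \<ge> \<delta>}"
    proof safe
      fix \<omega> assume *: "?Q w \<omega> > \<delta>" "\<not> ?Q w' \<omega> \<ge> \<delta>"
      show "(\<Sum>j<L. v j * (w j \<omega>)\<^sup>2) > e"
      proof (rule ccontr)
        assume "\<not> ?thesis"
        then have le: "(\<Sum>j<L. v j * (w j \<omega>)\<^sup>2) \<le> e" by simp
        have "w' j \<omega> = w j \<omega>" if "j < L" for j
        proof -
          have "(\<Sum>l\<le>j. v l * (w l \<omega>)\<^sup>2) \<le> (\<Sum>j<L. v j * (w j \<omega>)\<^sup>2)"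
            using that by (intro sum_mono2) (auto intro!: mult_nonneg_nonneg less_imp_le[OF v_pos])
          with le show ?thesis by (simp add: w'_def)
        qed
        then have "?Q w' \<omega> = ?Q w \<omega>" using idx
          by (intro sum.cong arg_cong[where f="\<lambda>x. x\<^sup>2"] refl) (auto, fastforce)
        with * show False by simp
      qed
    qed
  qed
  also have "prob {\<omega>\<in>space M. ?Q w' \<omega> \<ge> \<delta>} \<le> expectation (?Q w') / \<delta>"
    using Qi \<delta> by (intro integral_Markov_inequality_measure) (auto intro!: sum_nonneg)
  also have "\<dots> \<le> e / \<delta>" using EQ \<delta> by (simp add: divide_right_mono)
  finally show ?thesis by simp
qed

lemma transform_bound:
  assumes w: "\<And>j. j < L \<Longrightarrow> w j \<in> borel_measurable (A j)"
    and \<delta>: "\<delta> > 0" and e: "e > 0"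
  shows "prob {\<omega>\<in>space M. \<bar>\<Sum>j<L. w j \<omega> * \<zeta> j \<omega>\<bar> > \<delta>}
      \<le> prob {\<omega>\<in>space M. (\<Sum>j<L. v j * (w j \<omega>)\<^sup>2) > e} + e / \<delta>\<^sup>2"
proof -
  have "\<bar>x\<bar> > \<delta> \<longleftrightarrow> x\<^sup>2 > \<delta>\<^sup>2" for x
    using \<delta> by (metis abs_le_square_iff abs_of_pos linorder_not_le)
  then show ?thesis
    using block_square_bound[of 1 L w "\<delta>\<^sup>2" e] assms by (simp add: atLeast0LessThan)
qed

end

section \<open>Partitions and common refinements\<close>

lemma increasing_less:
  fixes \<rho> :: "nat \<Rightarrow> real"
  assumes "\<And>l. l < r \<Longrightarrow> \<rho> l < \<rho> (Suc l)" and "i < j" "j \<le> r"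
  shows "\<rho> i < \<rho> j"
proof -
  have "i < j \<Longrightarrow> j \<le> r \<Longrightarrow> \<rho> i < \<rho> j" for j
  proof (induction j)
    case (Suc j)
    show ?case
    proof (cases "i = j")
      case False
      then have "\<rho> i < \<rho> j" using Suc by auto
      also have "\<dots> < \<rho> (Suc j)" using Suc by (intro assms(1)) auto
      finally show ?thesis .
    qed (use Suc assms(1) in auto)
  qed simp
  then show ?thesis using assms by blast
qed

lemma increasing_less_iff:
  fixes \<rho> :: "nat \<Rightarrow> real"
  assumes "\<And>l. l < r \<Longrightarrow> \<rho> l < \<rho> (Suc l)" and "i \<le> r" "j \<le> r"
  shows "\<rho> i < \<rho> j \<longleftrightarrow> i < j" and "\<rho> i \<le> \<rho> j \<longleftrightarrow> i \<le> j"
proof -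
  note less = increasing_less[of r \<rho>, OF assms(1)]
  consider "i < j" | "i = j" | "j < i" by linarith
  then have "(\<rho> i < \<rho> j \<longleftrightarrow> i < j) \<and> (\<rho> i \<le> \<rho> j \<longleftrightarrow> i \<le> j)"
  proof cases
    case 1 then show ?thesis using less[of i j] assms(3) by auto
  next
    case 3 then show ?thesis using less[of j i] assms(2) by auto
  qed simp
  then show "\<rho> i < \<rho> j \<longleftrightarrow> i < j" "\<rho> i \<le> \<rho> j \<longleftrightarrow> i \<le> j" by auto
qed

lemma increasing_locate:
  fixes \<rho> :: "nat \<Rightarrow> real"
  assumes "\<rho> 0 < s" "s \<le> \<rho> r"
  obtains l where "l < r" "\<rho> l < s" "s \<le> \<rho> (Suc l)"
proof -
  have "\<exists>l<r. \<rho> l < s \<and> s \<le> \<rho> (Suc l)"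
    using assms
  proof (induction r)
    case (Suc r)
    show ?case
    proof (cases "s \<le> \<rho> r")
      case True then show ?thesis using Suc less_SucI by blast
    next
      case False then show ?thesis using Suc by (intro exI[of _ r]) auto
    qed
  qed auto
  then show ?thesis using that by blast
qed

lemma common_refinement:
  fixes S :: "real set"
  assumes "finite S" "S \<noteq> {}"
  obtains r \<rho> where "\<And>l. l < r \<Longrightarrow> \<rho> l < \<rho> (Suc l)" "\<rho> ` {..r} = S"
proof -
  define xs where "xs = sorted_list_of_set S"
  have xs: "set xs = S" "sorted_wrt (<) xs" "length xs = card S"
    using assms by (auto simp: xs_def)
  have c: "card S > 0" using assms by (simp add: card_gt_0_iff)
  have "(!) xs ` {..card S - 1} = (!) xs ` {..<length xs}"
    using c by (intro arg_cong[where f="\<lambda>A. (!) xs ` A"]) (auto simp: xs)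
  also have "\<dots> = S" using xs by (auto simp: set_conv_nth)
  finally have im: "(!) xs ` {..card S - 1} = S" .
  show ?thesis
    by (rule that[of "card S - 1" "(!) xs", OF _ im])
      (use xs sorted_wrt_nth_less[OF xs(2)] in auto)
qed

text \<open>
  The partition \<open>\<tau>\<close> with \<open>n\<close> cells is refined by \<open>\<rho>\<close> with \<open>r\<close> cells. A step function over \<open>\<tau>\<close> is also
  one over \<open>\<rho>\<close>, and its value on the cell \<open>(\<rho> l, \<rho> (l+1)]\<close> can be read off at the right end
  point. This avoids bookkeeping of which cell of \<open>\<tau>\<close> contains which cell of \<open>\<rho>\<close>.
\<close>

locale refinement =
  fixes n r :: nat and \<tau> \<rho> :: "nat \<Rightarrow> real"
  assumes \<rho>_inc: "\<And>l. l < r \<Longrightarrow> \<rho> l < \<rho> (Suc l)"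
    and \<tau>_inc: "\<And>i. i < n \<Longrightarrow> \<tau> i < \<tau> (Suc i)"
    and refines: "\<tau> ` {..n} \<subseteq> \<rho> ` {..r}"
begin

lemma cell:
  assumes "i < n"
  obtains p p' where "p < p'" "p' \<le> r" "\<tau> i = \<rho> p" "\<tau> (Suc i) = \<rho> p'"
proof -
  have "\<tau> i \<in> \<rho> ` {..r}" "\<tau> (Suc i) \<in> \<rho> ` {..r}" using refines assms by auto
  then obtain p p' where p: "p \<le> r" "p' \<le> r" "\<tau> i = \<rho> p" "\<tau> (Suc i) = \<rho> p'" by auto
  moreover have "p < p'"
    using \<tau>_inc[OF assms] increasing_less_iff(1)[of r \<rho>, OF \<rho>_inc] p by auto
  ultimately show ?thesis using that by blast
qed

lemma cell_iff:
  assumes "i < n" "l < r" "\<rho> l < s" "s \<le> \<rho> (Suc l)"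
  shows "s \<in> {\<tau> i<..\<tau> (Suc i)} \<longleftrightarrow> \<rho> (Suc l) \<in> {\<tau> i<..\<tau> (Suc i)}"
    and "\<rho> (Suc l) \<in> {\<tau> i<..\<tau> (Suc i)} \<Longrightarrow> \<tau> i \<le> \<rho> l"
proof -
  obtain p p' where p: "p < p'" "p' \<le> r" "\<tau> i = \<rho> p" "\<tau> (Suc i) = \<rho> p'"
    by (rule cell[OF assms(1)])
  note iff = increasing_less_iff[of r \<rho>, OF \<rho>_inc]
  have A: "\<rho> (Suc l) \<in> {\<tau> i<..\<tau> (Suc i)} \<longleftrightarrow> p \<le> l \<and> Suc l \<le> p'"
    using p assms by (auto simp: iff)
  then show "\<rho> (Suc l) \<in> {\<tau> i<..\<tau> (Suc i)} \<Longrightarrow> \<tau> i \<le> \<rho> l"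
    using p assms by (auto simp: iff)
  show "s \<in> {\<tau> i<..\<tau> (Suc i)} \<longleftrightarrow> \<rho> (Suc l) \<in> {\<tau> i<..\<tau> (Suc i)}"
  proof (cases "p \<le> l \<and> Suc l \<le> p'")
    case True
    then have "\<rho> p \<le> \<rho> l" "\<rho> (Suc l) \<le> \<rho> p'" using p assms by (auto simp: iff)
    with True A p assms show ?thesis by auto
  next
    case False
    then have "\<rho> (Suc l) \<le> \<rho> p \<or> \<rho> p' \<le> \<rho> l" using p assms by (auto simp: iff)
    with A False p assms show ?thesis by auto
  qed
qed

lemma process_const:
  assumes "l < r" "\<rho> l < s" "s \<le> \<rho> (Suc l)"
  shows "elementary_process n \<tau> \<eta> s \<omega> = elementary_process n \<tau> \<eta> (\<rho> (Suc l)) \<omega>"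
  unfolding elementary_process_def
  by (intro sum.cong refl) (use cell_iff(1)[OF _ assms] in \<open>auto simp: indicator_def\<close>)

text \<open>
  Although evaluated at the right end point, the process is known at the left end point of the
  cell: a cell of \<open>\<tau>\<close> that contains \<open>\<rho> (l+1)\<close> begins no later than \<open>\<rho> l\<close>.
\<close>

lemma process_measurable:
  fixes \<eta> :: "nat \<Rightarrow> 'a \<Rightarrow> real"
  assumes "l < r" and \<eta>: "\<And>i. i < n \<Longrightarrow> \<eta> i \<in> borel_measurable (F (\<tau> i))"
    and F: "\<And>s t (f :: 'a \<Rightarrow> real). s \<le> t \<Longrightarrow> f \<in> borel_measurable (F s) \<Longrightarrow> f \<in> borel_measurable (F t)"
  shows "elementary_process n \<tau> \<eta> (\<rho> (Suc l)) \<in> borel_measurable (F (\<rho> l))"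
  unfolding elementary_process_def
proof (rule borel_measurable_sum)
  fix i assume i: "i \<in> {..<n}"
  show "(\<lambda>\<omega>. \<eta> i \<omega> * indicator {\<tau> i<..\<tau> (Suc i)} (\<rho> (Suc l))) \<in> borel_measurable (F (\<rho> l))"
  proof (cases "\<rho> (Suc l) \<in> {\<tau> i<..\<tau> (Suc i)}")
    case True
    from cell_iff(2)[OF _ \<open>l < r\<close> _ order_refl this] i \<rho>_inc[OF \<open>l < r\<close>]
    have "\<tau> i \<le> \<rho> l" by auto
    from F[OF this \<eta>[of i]] i True show ?thesis by simp
  qed simp
qed

lemma integral_refine:
  "elementary_integral W n \<tau> \<eta> \<omega> =
     (\<Sum>l<r. elementary_process n \<tau> \<eta> (\<rho> (Suc l)) \<omega> * (W (\<rho> (Suc l)) \<omega> - W (\<rho> l) \<omega>))"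
proof -
  note iff = increasing_less_iff[of r \<rho>, OF \<rho>_inc]
  have tel: "(\<Sum>l<r. indicator {\<tau> i<..\<tau> (Suc i)} (\<rho> (Suc l)) * (W (\<rho> (Suc l)) \<omega> - W (\<rho> l) \<omega>))
     = W (\<tau> (Suc i)) \<omega> - W (\<tau> i) \<omega>" if i: "i < n" for i
  proof -
    obtain p p' where p: "p < p'" "p' \<le> r" "\<tau> i = \<rho> p" "\<tau> (Suc i) = \<rho> p'"
      by (rule cell[OF i])
    have "(\<Sum>l<r. indicator {\<tau> i<..\<tau> (Suc i)} (\<rho> (Suc l)) * (W (\<rho> (Suc l)) \<omega> - W (\<rho> l) \<omega>))
        = (\<Sum>l\<in>{p..<p'}. W (\<rho> (Suc l)) \<omega> - W (\<rho> l) \<omega>)"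
      using p by (intro sum.mono_neutral_cong_right) (auto simp: indicator_def iff Suc_le_eq)
    also have "\<dots> = W (\<rho> p') \<omega> - W (\<rho> p) \<omega>"
      using p by (intro sum_Suc_diff') auto
    finally show ?thesis using p by simp
  qed
  have "(\<Sum>l<r. elementary_process n \<tau> \<eta> (\<rho> (Suc l)) \<omega> * (W (\<rho> (Suc l)) \<omega> - W (\<rho> l) \<omega>))
    = (\<Sum>i<n. \<eta> i \<omega> * (\<Sum>l<r. indicator {\<tau> i<..\<tau> (Suc i)} (\<rho> (Suc l)) * (W (\<rho> (Suc l)) \<omega> - W (\<rho> l) \<omega>)))"
    unfolding elementary_process_def sum_distrib_right sum_distrib_left
    by (subst sum.swap) (simp add: mult.assoc)
  also have "\<dots> = elementary_integral W n \<tau> \<eta> \<omega>"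
    unfolding elementary_integral_def by (intro sum.cong refl) (simp only: tel lessThan_iff)
  finally show ?thesis by simp
qed

end

section \<open>Brownian increments as noise\<close>

locale brownian_setting =
  fixes M :: "'a measure" and F :: "real \<Rightarrow> 'a measure" and W :: "real \<Rightarrow> 'a \<Rightarrow> real"
  assumes fps: "filtered_prob_space M F" and bm: "brownian_motion M F W"
begin

sublocale prob_space M using fps by (simp add: filtered_prob_space_def)

lemma sub_F: "subalgebra M (F t)"
  using fps unfolding filtered_prob_space_def by blast

lemma space_F: "space (F t) = space M"
  using sub_F by (simp add: subalgebra_def)

lemma sets_F_mono: "s \<le> t \<Longrightarrow> sets (F s) \<subseteq> sets (F t)"
  using fps filtration.sets_F_mono unfolding filtered_prob_space_def by blast

lemma F_mono: "s \<le> t \<Longrightarrow> f \<in> measurable (F s) N \<Longrightarrow> f \<in> measurable (F t) N"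
  by (rule measurable_from_subalg[of "F t" "F s"]) (simp_all add: subalgebra_def space_F sets_F_mono)

lemma F_M: "f \<in> measurable (F s) N \<Longrightarrow> f \<in> measurable M N"
  by (rule measurable_sub[OF sub_F])

lemma W_F: "0 \<le> t \<Longrightarrow> W t \<in> borel_measurable (F t)"
  using bm unfolding brownian_motion_def by blast

lemma W_M: "0 \<le> t \<Longrightarrow> W t \<in> borel_measurable M"
  by (rule F_M[OF W_F])

lemma increment_distributed:
  "0 \<le> s \<Longrightarrow> s < t \<Longrightarrow>
   distributed M lborel (\<lambda>\<omega>. W t \<omega> - W s \<omega>) (\<lambda>y. ennreal (normal_density 0 (sqrt (t - s)) y))"
  using bm unfolding brownian_motion_def by blast

lemma increment_indep_set:
  "0 \<le> s \<Longrightarrow> s < t \<Longrightarrow> indep_set (sets (F s)) (gen_sets M (\<lambda>\<omega>. W t \<omega> - W s \<omega>))"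
  using bm unfolding brownian_motion_def by blast

lemma indep_var_of_indep_set:
  assumes "indep_set (sets A) (gen_sets M X)" "subalgebra M A" "Y \<in> borel_measurable A"
    and [measurable]: "X \<in> borel_measurable M" "f \<in> borel_measurable borel"
  shows "indep_var borel Y borel (\<lambda>\<omega>. f (X \<omega>) :: real)"
proof -
  have Y[measurable]: "Y \<in> borel_measurable M" by (rule measurable_sub[OF assms(2,3)])
  have i: "indep_set (sets A) (sigma_sets (space M) {X -` S \<inter> space M |S. S \<in> sets borel})"
    using assms(1) by (simp add: gen_sets_def sets_vimage_algebra)
  have sA: "sets A = sigma_sets (space M) (sets A)"
    using assms(2) by (metis sets.sigma_sets_eq subalgebra_def)
  have sub: "sigma_sets (space M) {Y -` S \<inter> space M |S. S \<in> sets borel} \<subseteq> sets A"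
  proof (subst sA, rule sigma_sets_mono')
    show "{Y -` S \<inter> space M |S. S \<in> sets borel} \<subseteq> sets A"
      using measurable_sets[OF assms(3)] assms(2) by (auto simp: subalgebra_def)
  qed
  have "indep_set (sigma_sets (space M) {Y -` S \<inter> space M |S. S \<in> sets borel})
     (sigma_sets (space M) {X -` S \<inter> space M |S. S \<in> sets borel})"
    using i sub unfolding indep_set_def
    by (elim indep_sets_mono_sets) (auto split: bool.splits)
  then have "indep_var borel Y borel X"
    unfolding indep_var_eq using Y assms(4) by blast
  from indep_var_compose[OF this, of "\<lambda>x. x" borel f borel]
  show ?thesis by (simp add: comp_def)
qed

lemma increment_indep:
  assumes "0 \<le> s" "s < t" "Y \<in> borel_measurable (F s)" "f \<in> borel_measurable borel"
  shows "indep_var borel Y borel (\<lambda>\<omega>. f (W t \<omega> - W s \<omega>) :: real)"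
  using assms W_M[of s] W_M[of t] increment_indep_set
  by (intro indep_var_of_indep_set[OF _ sub_F[of s]]) auto

lemma increment_expectation:
  assumes "0 \<le> s" "s < t" "has_bochner_integral lborel (\<lambda>y. normal_density 0 (sqrt (t - s)) y * f y) c"
    and [measurable]: "f \<in> borel_measurable borel"
  shows "integrable M (\<lambda>\<omega>. f (W t \<omega> - W s \<omega>) :: real)"
    and "expectation (\<lambda>\<omega>. f (W t \<omega> - W s \<omega>)) = c"
proof -
  note d = increment_distributed[OF assms(1,2)]
  show "integrable M (\<lambda>\<omega>. f (W t \<omega> - W s \<omega>))"
    using distributed_integrable[OF d, of f] assms(3) by (auto simp: has_bochner_integral_iff)
  show "expectation (\<lambda>\<omega>. f (W t \<omega> - W s \<omega>)) = c"
    using distributed_integral[OF d, of f] assms(3) by (auto simp: has_bochner_integral_iff)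
qed

text \<open>
  Functions of the increments over a partition are noise in the sense of
  \<open>martingale_noise\<close>; mean and variance are integrals against normal densities.
\<close>

lemma increment_noise:
  assumes "0 \<le> \<rho> 0" and inc: "\<And>l. l < L \<Longrightarrow> \<rho> l < \<rho> (Suc l)"
    and f: "\<And>j. f j \<in> borel_measurable borel"
    and mean: "\<And>j. j < L \<Longrightarrow> has_bochner_integral lborel
          (\<lambda>y. normal_density 0 (sqrt (\<rho> (Suc j) - \<rho> j)) y * f j y) 0"
    and var: "\<And>j. j < L \<Longrightarrow> has_bochner_integral lborel
          (\<lambda>y. normal_density 0 (sqrt (\<rho> (Suc j) - \<rho> j)) y * (f j y)\<^sup>2) (u j)"
    and v: "\<And>j. j < L \<Longrightarrow> u j \<le> v j" "\<And>j. j < L \<Longrightarrow> v j > 0"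
  shows "martingale_noise M (\<lambda>j. F (\<rho> j)) (\<lambda>j \<omega>. f j (W (\<rho> (Suc j)) \<omega> - W (\<rho> j) \<omega>)) v L"
proof -
  have nonneg: "0 \<le> \<rho> j" if "j \<le> L" for j
    using increasing_less_iff(2)[of L \<rho> 0 j, OF inc] that assms(1) by auto
  show ?thesis
  proof
    fix i j :: nat assume "i \<le> j" "j \<le> L"
    then show "sets (F (\<rho> i)) \<subseteq> sets (F (\<rho> j))"
      using increasing_less_iff(2)[of L \<rho> i j, OF inc] by (intro sets_F_mono) auto
  next
    fix j assume j: "j < L"
    have n: "0 \<le> \<rho> j" "0 \<le> \<rho> (Suc j)" using nonneg[of j] nonneg[of "Suc j"] j by auto
    note [measurable] = f[of j] W_F[OF n(2)] F_mono[OF less_imp_le[OF inc[OF j]] W_F[OF n(1)]]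
    show "(\<lambda>\<omega>. f j (W (\<rho> (Suc j)) \<omega> - W (\<rho> j) \<omega>)) \<in> borel_measurable (F (\<rho> (Suc j)))"
      by measurable
    show "indep_var borel Y borel (\<lambda>\<omega>. f j (W (\<rho> (Suc j)) \<omega> - W (\<rho> j) \<omega>))"
      if "Y \<in> borel_measurable (F (\<rho> j))" for Y
      using increment_indep[OF nonneg inc[OF j] that f] j by auto
    have f2: "(\<lambda>y. (f j y)\<^sup>2) \<in> borel_measurable borel" by measurable
    note e = increment_expectation[OF nonneg inc[OF j] mean[OF j] f]
      increment_expectation[OF nonneg inc[OF j] var[OF j] f2]
    show "integrable M (\<lambda>\<omega>. (f j (W (\<rho> (Suc j)) \<omega> - W (\<rho> j) \<omega>))\<^sup>2)"
      "expectation (\<lambda>\<omega>. f j (W (\<rho> (Suc j)) \<omega> - W (\<rho> j) \<omega>)) = 0"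
      using e j by auto
    show "expectation (\<lambda>\<omega>. (f j (W (\<rho> (Suc j)) \<omega> - W (\<rho> j) \<omega>))\<^sup>2) \<le> v j"
      using e(4) v(1)[OF j] j by auto
    show "v j > 0" by (rule v(2)[OF j])
  qed (rule sub_F)
qed

lemma brownian_noise:
  assumes "0 \<le> \<rho> 0" and inc: "\<And>l. l < L \<Longrightarrow> \<rho> l < \<rho> (Suc l)"
  shows "martingale_noise M (\<lambda>j. F (\<rho> j)) (\<lambda>j \<omega>. W (\<rho> (Suc j)) \<omega> - W (\<rho> j) \<omega>) (\<lambda>j. \<rho> (Suc j) - \<rho> j) L"
proof (rule increment_noise[of \<rho> L "\<lambda>_ x. x" "\<lambda>j. \<rho> (Suc j) - \<rho> j", OF assms])
  fix j assume "j < L"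
  then have p: "sqrt (\<rho> (Suc j) - \<rho> j) > 0" "\<rho> (Suc j) - \<rho> j > 0" using inc[of j] by auto
  show "has_bochner_integral lborel (\<lambda>y. normal_density 0 (sqrt (\<rho> (Suc j) - \<rho> j)) y * y) 0"
    using normal_moment_nz_1[OF p(1)] .
  show "has_bochner_integral lborel (\<lambda>y. normal_density 0 (sqrt (\<rho> (Suc j) - \<rho> j)) y * y\<^sup>2) (\<rho> (Suc j) - \<rho> j)"
    using normal_moment_even[OF p(1), of 0 1] p(2) by (simp add: numeral_2_eq_2 diff_divide_distrib)
qed (use inc in auto)

end

section \<open>The Ito integral of a continuous integrand as a limit of Riemann sums\<close>

lemma has_ito_integral_approximations:
  assumes "has_ito_integral M F W a b H I"
  obtains n \<tau> \<eta> where "\<forall>k. elementary_integrand M F a b (n k) (\<tau> k) (\<eta> k)"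
    "\<forall>\<delta>>0. (\<lambda>k. measure M {\<omega> \<in> space M.
       (\<integral>\<^sup>+s\<in>{a..b}. ennreal ((H s \<omega> - elementary_process (n k) (\<tau> k) (\<eta> k) s \<omega>)\<^sup>2) \<partial>lborel) > ennreal \<delta>}) \<longlonglongrightarrow> 0"
    "tendsto_in_prob M (\<lambda>k. elementary_integral W (n k) (\<tau> k) (\<eta> k)) I"
  using assms unfolding has_ito_integral_def by (elim conjE exE) (rule that)

lemma elementary_process_measurable_time [measurable]:
  "(\<lambda>s. elementary_process n \<tau> \<eta> s \<omega>) \<in> borel_measurable borel"
  unfolding elementary_process_def by measurable

context brownian_setting
begin

lemma progressive_measurable_pair:
  assumes "progressively_measurable F a b H" "a \<le> b"
  shows "(\<lambda>(s, \<omega>). H s \<omega>) \<in> borel_measurable (restrict_space lborel {a..b} \<Otimes>\<^sub>M M)"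
proof -
  have H: "(\<lambda>(s, \<omega>). H s \<omega>) \<in> borel_measurable (restrict_space borel {a..b} \<Otimes>\<^sub>M F b)"
    using assms by (auto simp: progressively_measurable_def)
  have "(\<lambda>x. x) \<in> M \<rightarrow>\<^sub>M F b" by (rule F_M[of _ b]) simp
  then have s: "(\<lambda>x. snd x) \<in> restrict_space lborel {a..b} \<Otimes>\<^sub>M M \<rightarrow>\<^sub>M F b"
    by (rule measurable_compose[OF measurable_snd])
  have "sets (restrict_space lborel {a..b}) = sets (restrict_space borel {a..b} :: real measure)"
    by (intro sets_restrict_space_cong) simp
  then have "(\<lambda>x. x) \<in> restrict_space lborel {a..b} \<rightarrow>\<^sub>M (restrict_space borel {a..b} :: real measure)"
    by (intro measurable_ident_sets)
  then have f: "(\<lambda>x. fst x) \<in> restrict_space lborel {a..b} \<Otimes>\<^sub>M M \<rightarrow>\<^sub>M (restrict_space borel {a..b} :: real measure)"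
    by (rule measurable_compose[OF measurable_fst])
  have "(\<lambda>x. (fst x, snd x)) \<in> restrict_space lborel {a..b} \<Otimes>\<^sub>M M \<rightarrow>\<^sub>M restrict_space borel {a..b} \<Otimes>\<^sub>M F b"
    by (rule measurable_Pair[OF f s])
  from measurable_compose[OF this H] show ?thesis by simp
qed

lemma integrand_measurable_time:
  assumes "progressively_measurable F a b H" "a \<le> b" "\<omega> \<in> space M"
  shows "(\<lambda>s. H s \<omega>) \<in> borel_measurable (restrict_space lborel {a..b})"
proof -
  have "(\<lambda>s. (s, \<omega>)) \<in> restrict_space lborel {a..b} \<rightarrow>\<^sub>M restrict_space lborel {a..b} \<Otimes>\<^sub>M M"
    using assms(3) by simp
  from measurable_compose[OF this progressive_measurable_pair[OF assms(1,2)]]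
  show ?thesis by simp
qed

text \<open>
  Needed because \<^const>\<open>measure\<close> of a set that is not an event is 0, so that a statement about
  the probability of a large distance says something only for measurable distances.
\<close>

lemma distance_measurable:
  assumes "progressively_measurable F a b H" "a \<le> b"
    and \<eta>[measurable]: "\<And>i. i < n \<Longrightarrow> \<eta> i \<in> borel_measurable M"
  shows "(\<lambda>\<omega>. \<integral>\<^sup>+s\<in>{a..b}. ennreal ((H s \<omega> - elementary_process n \<tau> \<eta> s \<omega>)\<^sup>2) \<partial>lborel) \<in> borel_measurable M"
proof -
  let ?R = "restrict_space lborel {a..b}"
  interpret R: sigma_finite_measure ?R
    by (rule sigma_finite_measure_restrict_space) (simp_all add: sigma_finite_lborel)
  note [measurable] = progressive_measurable_pair[OF assms(1,2)]
  have [measurable]: "(\<lambda>x. fst x) \<in> borel_measurable (?R \<Otimes>\<^sub>M M)"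
    by (intro measurable_compose[OF measurable_fst] measurable_restrict_space1) simp
  have H': "(\<lambda>x. H (fst x) (snd x)) \<in> borel_measurable (?R \<Otimes>\<^sub>M M)"
    using progressive_measurable_pair[OF assms(1,2)] by (simp add: case_prod_beta')
  have p: "(\<lambda>x. elementary_process n \<tau> \<eta> (fst x) (snd x)) \<in> borel_measurable (?R \<Otimes>\<^sub>M M)"
    unfolding elementary_process_def by measurable
  have "(\<lambda>x. ennreal ((H (fst x) (snd x) - elementary_process n \<tau> \<eta> (fst x) (snd x))\<^sup>2))
      \<in> borel_measurable (?R \<Otimes>\<^sub>M M)"
    using H' p by measurable
  from R.borel_measurable_nn_integral_fst[OF measurable_pair_swap[OF this]]
  show ?thesis
    by (simp add: nn_integral_restrict_space case_prod_beta')
qed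

text \<open>
  On a common refinement the difference of the two integrals is a single transform of Brownian
  increments, and the squares of its weights, multiplied by the cell lengths, add up to the squared \<open>L\<^sup>2\<close>
  distance of the two integrands. That is at most twice the sum of the squared distances to \<open>H\<close>:
  if both are at most \<open>e\<close>, it is at most \<open>4 * e\<close>.
\<close>

lemma elementary_integral_compare:
  assumes "0 \<le> a" "a \<le> b"
    and \<tau>: "\<tau> 0 = a" "\<tau> n = b" "\<And>i. i < n \<Longrightarrow> \<tau> i < \<tau> (Suc i)"
    and \<eta>: "\<And>i. i < n \<Longrightarrow> \<eta> i \<in> borel_measurable (F (\<tau> i))"
    and \<sigma>: "\<sigma> 0 = a" "\<sigma> m = b" "\<And>i. i < m \<Longrightarrow> \<sigma> i < \<sigma> (Suc i)"
    and \<xi>: "\<And>i. i < m \<Longrightarrow> \<xi> i \<in> borel_measurable (F (\<sigma> i))"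
    and H: "progressively_measurable F a b H"
    and \<delta>: "\<delta> > 0" and e: "e > 0"
  shows "prob {\<omega>\<in>space M. \<bar>elementary_integral W n \<tau> \<eta> \<omega> - elementary_integral W m \<sigma> \<xi> \<omega>\<bar> > \<delta>}
    \<le> prob {\<omega>\<in>space M. (\<integral>\<^sup>+s\<in>{a..b}. ennreal ((H s \<omega> - elementary_process n \<tau> \<eta> s \<omega>)\<^sup>2) \<partial>lborel) > ennreal e}
    + prob {\<omega>\<in>space M. (\<integral>\<^sup>+s\<in>{a..b}. ennreal ((H s \<omega> - elementary_process m \<sigma> \<xi> s \<omega>)\<^sup>2) \<partial>lborel) > ennreal e}
    + 4 * e / \<delta>\<^sup>2"
proof -
  let ?\<phi> = "elementary_process n \<tau> \<eta>" and ?\<psi> = "elementary_process m \<sigma> \<xi>"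
  let ?d = "\<lambda>\<phi> \<omega>. \<integral>\<^sup>+s\<in>{a..b}. ennreal ((H s \<omega> - \<phi> s \<omega>)\<^sup>2) \<partial>lborel"
  obtain r \<rho> where \<rho>: "\<And>l. l < r \<Longrightarrow> \<rho> l < \<rho> (Suc l)" "\<rho> ` {..r} = \<tau> ` {..n} \<union> \<sigma> ` {..m}"
    by (rule common_refinement[of "\<tau> ` {..n} \<union> \<sigma> ` {..m}"]) auto
  interpret t: refinement n r \<tau> \<rho> using \<rho> \<tau> by unfold_locales auto
  interpret s: refinement m r \<sigma> \<rho> using \<rho> \<sigma> by unfold_locales auto
  have "\<tau> i \<in> {a..b}" if "i \<le> n" for i
    using increasing_less_iff(2)[of n \<tau>, OF \<tau>(3)] that \<tau>(1,2) by fastforce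
  moreover have "\<sigma> i \<in> {a..b}" if "i \<le> m" for i
    using increasing_less_iff(2)[of m \<sigma>, OF \<sigma>(3)] that \<sigma>(1,2) by fastforce
  ultimately have "\<rho> ` {..r} \<subseteq> {a..b}" using \<rho>(2) by auto
  then have \<rho>_in: "\<rho> l \<in> {a..b}" if "l \<le> r" for l using that by blast
  define w where "w l \<omega> = ?\<phi> (\<rho> (Suc l)) \<omega> - ?\<psi> (\<rho> (Suc l)) \<omega>" for l \<omega>
  have wF: "w l \<in> borel_measurable (F (\<rho> l))" if "l < r" for l
    unfolding w_def using that
    by (intro borel_measurable_diff t.process_measurable[where F=F and \<eta>=\<eta>, OF _ \<eta> F_mono]
      s.process_measurable[where F=F and \<eta>=\<xi>, OF _ \<xi> F_mono])
  interpret N: martingale_noise M "\<lambda>j. F (\<rho> j)" "\<lambda>j \<omega>. W (\<rho> (Suc j)) \<omega> - W (\<rho> j) \<omega>" "\<lambda>j. \<rho> (Suc j) - \<rho> j" r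
    using \<rho>_in[of 0] assms(1) by (intro brownian_noise \<rho>) auto
  have \<eta>M: "\<eta> i \<in> borel_measurable M" if "i < n" for i using F_M[OF \<eta>[OF that]] .
  have \<xi>M: "\<xi> i \<in> borel_measurable M" if "i < m" for i using F_M[OF \<xi>[OF that]] .
  note [measurable] = distance_measurable[OF H \<open>a \<le> b\<close> \<eta>M] distance_measurable[OF H \<open>a \<le> b\<close> \<xi>M]
  have le: "ennreal (\<Sum>l<r. (\<rho> (Suc l) - \<rho> l) * (w l \<omega>)\<^sup>2) \<le> 2 * ?d ?\<phi> \<omega> + 2 * ?d ?\<psi> \<omega>"
    if \<omega>: "\<omega> \<in> space M" for \<omega>
  proof -
    let ?R = "restrict_space lborel {a..b}"
    note [measurable] = integrand_measurable_time[OF H \<open>a \<le> b\<close> \<omega>]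
    have [measurable]: "(\<lambda>s. ?\<phi> s \<omega>) \<in> borel_measurable ?R" "(\<lambda>s. ?\<psi> s \<omega>) \<in> borel_measurable ?R"
      by (auto intro!: measurable_restrict_space1)
    \<comment> \<open>The left-hand side is the squared difference of the two step functions on the cells of \<open>\<rho>\<close>.\<close>
    have sum_ind: "(\<Sum>l<r. ennreal ((w l \<omega>)\<^sup>2) * indicator {\<rho> l<..\<rho> (Suc l)} s) \<le> ennreal ((?\<phi> s \<omega> - ?\<psi> s \<omega>)\<^sup>2) * indicator {a..b} s" for s
    proof (cases "\<exists>l<r. \<rho> l < s \<and> s \<le> \<rho> (Suc l)")
      case True
      then obtain l where l: "l < r" "\<rho> l < s" "s \<le> \<rho> (Suc l)" by blast
      have "s \<notin> {\<rho> k<..\<rho> (Suc k)}" if "k < r" "k \<noteq> l" for k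
      proof
        assume k: "s \<in> {\<rho> k<..\<rho> (Suc k)}"
        then have "\<rho> k < \<rho> (Suc l)" "\<rho> l < \<rho> (Suc k)" using l by auto
        then have "k < Suc l" "l < Suc k"
          using increasing_less_iff(1)[of r \<rho>, OF \<rho>(1)] that l(1) by auto
        with that show False by simp
      qed
      then have "(\<Sum>l<r. ennreal ((w l \<omega>)\<^sup>2) * indicator {\<rho> l<..\<rho> (Suc l)} s)
          = (\<Sum>k<r. if k = l then ennreal ((w l \<omega>)\<^sup>2) else 0)"
        using l by (intro sum.cong) (auto simp: indicator_def)
      also have "\<dots> = ennreal ((w l \<omega>)\<^sup>2)" using l by simp
      also have "\<dots> = ennreal ((?\<phi> s \<omega> - ?\<psi> s \<omega>)\<^sup>2) * indicator {a..b} s"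
        using \<rho>_in[of l] \<rho>_in[of "Suc l"] l t.process_const[OF l, of \<eta> \<omega>] s.process_const[OF l, of \<xi> \<omega>]
        by (simp add: w_def indicator_def)
      finally show ?thesis by simp
    next
      case False
      then have "(\<Sum>l<r. ennreal ((w l \<omega>)\<^sup>2) * indicator {\<rho> l<..\<rho> (Suc l)} s) = 0"
        by (intro sum.neutral) (auto simp: indicator_def)
      then show ?thesis by simp
    qed
    have "ennreal (\<Sum>l<r. (\<rho> (Suc l) - \<rho> l) * (w l \<omega>)\<^sup>2)
        = (\<Sum>l<r. ennreal ((w l \<omega>)\<^sup>2) * ennreal (\<rho> (Suc l) - \<rho> l))"
      using \<rho>(1) by (subst sum_ennreal[symmetric])
        (auto simp: ennreal_mult[symmetric] mult.commute less_imp_le intro!: sum.cong)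
    also have "\<dots> = (\<Sum>l<r. \<integral>\<^sup>+s. ennreal ((w l \<omega>)\<^sup>2) * indicator {\<rho> l<..\<rho> (Suc l)} s \<partial>lborel)"
      using \<rho>(1) by (intro sum.cong refl) (subst nn_integral_cmult_indicator, auto simp: less_imp_le)
    also have "\<dots> = (\<integral>\<^sup>+s. (\<Sum>l<r. ennreal ((w l \<omega>)\<^sup>2) * indicator {\<rho> l<..\<rho> (Suc l)} s) \<partial>lborel)"
      by (rule nn_integral_sum[symmetric]) measurable
    also have "\<dots> \<le> (\<integral>\<^sup>+s. ennreal ((?\<phi> s \<omega> - ?\<psi> s \<omega>)\<^sup>2) * indicator {a..b} s \<partial>lborel)"
      by (intro nn_integral_mono sum_ind)
    also have "\<dots> = (\<integral>\<^sup>+s. ennreal ((?\<phi> s \<omega> - ?\<psi> s \<omega>)\<^sup>2) \<partial>?R)"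
      by (simp add: nn_integral_restrict_space)
    also have "\<dots> \<le> (\<integral>\<^sup>+s. 2 * ennreal ((H s \<omega> - ?\<phi> s \<omega>)\<^sup>2) + 2 * ennreal ((H s \<omega> - ?\<psi> s \<omega>)\<^sup>2) \<partial>?R)"
    proof (rule nn_integral_mono)
      fix s
      have *: "(x - y)\<^sup>2 \<le> 2 * (h - x)\<^sup>2 + 2 * (h - y)\<^sup>2" for x y h :: real
        using zero_le_power2[of "(h - x) + (h - y)"] by (simp add: power2_eq_square algebra_simps)
      show "ennreal ((?\<phi> s \<omega> - ?\<psi> s \<omega>)\<^sup>2) \<le> 2 * ennreal ((H s \<omega> - ?\<phi> s \<omega>)\<^sup>2) + 2 * ennreal ((H s \<omega> - ?\<psi> s \<omega>)\<^sup>2)"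
        using ennreal_leI[OF *[of "?\<phi> s \<omega>" "?\<psi> s \<omega>" "H s \<omega>"]]
        by (simp add: ennreal_plus ennreal_mult)
    qed
    also have "\<dots> = 2 * (\<integral>\<^sup>+s. ennreal ((H s \<omega> - ?\<phi> s \<omega>)\<^sup>2) \<partial>?R) + 2 * (\<integral>\<^sup>+s. ennreal ((H s \<omega> - ?\<psi> s \<omega>)\<^sup>2) \<partial>?R)"
      by (subst nn_integral_add) (measurable, auto simp: nn_integral_cmult)
    finally show ?thesis by (simp add: nn_integral_restrict_space)
  qed
  have "elementary_integral W n \<tau> \<eta> \<omega> - elementary_integral W m \<sigma> \<xi> \<omega>
      = (\<Sum>j<r. w j \<omega> * (W (\<rho> (Suc j)) \<omega> - W (\<rho> j) \<omega>))" for \<omega>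
    unfolding t.integral_refine s.integral_refine w_def
    by (simp add: sum_subtractf left_diff_distrib)
  then have "prob {\<omega>\<in>space M. \<bar>elementary_integral W n \<tau> \<eta> \<omega> - elementary_integral W m \<sigma> \<xi> \<omega>\<bar> > \<delta>}
      \<le> prob {\<omega>\<in>space M. (\<Sum>l<r. (\<rho> (Suc l) - \<rho> l) * (w l \<omega>)\<^sup>2) > 4 * e} + 4 * e / \<delta>\<^sup>2"
    using N.transform_bound[of w \<delta> "4 * e", OF wF] \<delta> e by simp
  also have "prob {\<omega>\<in>space M. (\<Sum>l<r. (\<rho> (Suc l) - \<rho> l) * (w l \<omega>)\<^sup>2) > 4 * e}
      \<le> prob {\<omega>\<in>space M. ?d ?\<phi> \<omega> > ennreal e} + prob {\<omega>\<in>space M. ?d ?\<psi> \<omega> > ennreal e}"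
  proof (intro prob_le_add subsetI)
    fix \<omega> assume "\<omega> \<in> {\<omega>\<in>space M. (\<Sum>l<r. (\<rho> (Suc l) - \<rho> l) * (w l \<omega>)\<^sup>2) > 4 * e}"
    then have \<omega>: "\<omega> \<in> space M" "(\<Sum>l<r. (\<rho> (Suc l) - \<rho> l) * (w l \<omega>)\<^sup>2) > 4 * e" by auto
    have "\<not> (?d ?\<phi> \<omega> \<le> ennreal e \<and> ?d ?\<psi> \<omega> \<le> ennreal e)"
    proof safe
      assume "?d ?\<phi> \<omega> \<le> ennreal e" "?d ?\<psi> \<omega> \<le> ennreal e"
      then have "2 * ?d ?\<phi> \<omega> + 2 * ?d ?\<psi> \<omega> \<le> 2 * ennreal e + 2 * ennreal e"
        by (intro add_mono mult_left_mono) auto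
      also have "\<dots> = ennreal (2 * e + 2 * e)" using e by (subst ennreal_plus) (auto simp: ennreal_mult)
      also have "\<dots> = ennreal (4 * e)" by simp
      finally have "ennreal (\<Sum>l<r. (\<rho> (Suc l) - \<rho> l) * (w l \<omega>)\<^sup>2) \<le> ennreal (4 * e)"
        using le[OF \<omega>(1)] by order
      with \<omega>(2) e show False by (simp add: ennreal_le_iff)
    qed
    then show "\<omega> \<in> {\<omega>\<in>space M. ?d ?\<phi> \<omega> > ennreal e} \<union> {\<omega>\<in>space M. ?d ?\<psi> \<omega> > ennreal e}"
      using \<omega>(1) by (auto simp: not_le)
  qed measurable
  finally show ?thesis by simp
qed

end

lemma elementary_process_eq:
  assumes "\<And>i. i < n \<Longrightarrow> \<tau> i < \<tau> (Suc i)" "i < n" "\<tau> i < s" "s \<le> \<tau> (Suc i)"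
  shows "elementary_process n \<tau> \<eta> s \<omega> = \<eta> i \<omega>"
proof -
  have "s \<notin> {\<tau> k<..\<tau> (Suc k)}" if "k < n" "k \<noteq> i" for k
  proof
    assume k: "s \<in> {\<tau> k<..\<tau> (Suc k)}"
    then have "\<tau> k < \<tau> (Suc i)" "\<tau> i < \<tau> (Suc k)" using assms by auto
    then have "k < Suc i" "i < Suc k"
      using increasing_less_iff(1)[of n \<tau>, OF assms(1)] that assms(2) by auto
    with that show False by simp
  qed
  then have "elementary_process n \<tau> \<eta> s \<omega> = (\<Sum>k<n. if k = i then \<eta> i \<omega> else 0)"
    unfolding elementary_process_def using assms by (intro sum.cong) (auto simp: indicator_def)
  then show ?thesis using assms(2) by simp
qed

definition grid :: "real \<Rightarrow> real \<Rightarrow> nat \<Rightarrow> nat \<Rightarrow> real" where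
  "grid a b N i = a + (b - a) * (real i / real N)"

lemma grid_0 [simp]: "grid a b N 0 = a"
  by (simp add: grid_def)

lemma grid_end [simp]: "N > 0 \<Longrightarrow> grid a b N N = b"
  by (simp add: grid_def)

lemma grid_Suc: "grid a b N (Suc i) = grid a b N i + (b - a) / real N"
  by (simp add: grid_def field_simps add_divide_distrib)

lemma grid_less: "a < b \<Longrightarrow> N > 0 \<Longrightarrow> grid a b N i < grid a b N (Suc i)"
  by (simp add: grid_Suc)

lemma grid_in: "a \<le> b \<Longrightarrow> i \<le> N \<Longrightarrow> grid a b N i \<in> {a..b}"
proof -
  assume *: "a \<le> b" "i \<le> N"
  then have "real i / real N \<le> 1" by (cases "N = 0") auto
  with * have "(b - a) * (real i / real N) \<le> (b - a) * 1" by (intro mult_left_mono) auto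
  with * show ?thesis by (auto simp: grid_def)
qed

lemma eventually_mesh_less:
  assumes "0 < \<delta>" shows "\<forall>\<^sub>F N in sequentially. c / real N < \<delta>"
proof -
  have "(\<lambda>N. c / real N) \<longlonglongrightarrow> 0" by real_asymp
  from order_tendstoD(2)[OF this assms] show ?thesis .
qed

lemma uniform_modulus:
  fixes f :: "real \<Rightarrow> real"
  assumes "continuous_on {a..b} f" "0 < e"
  shows "\<forall>\<^sub>F N in sequentially. \<forall>u\<in>{a..b}. \<forall>v\<in>{a..b}. \<bar>u - v\<bar> \<le> (b - a) / real N \<longrightarrow> \<bar>f u - f v\<bar> < e"
proof -
  have "uniformly_continuous_on {a..b} f"
    using assms by (intro compact_uniformly_continuous) auto
  then obtain \<delta> where \<delta>: "\<delta> > 0" "\<And>u v. u \<in> {a..b} \<Longrightarrow> v \<in> {a..b} \<Longrightarrow> \<bar>u - v\<bar> < \<delta> \<Longrightarrow> \<bar>f u - f v\<bar> < e"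
    using assms(2) unfolding uniformly_continuous_on_def dist_real_def by metis
  show ?thesis
    using eventually_mesh_less[OF \<delta>(1), of "b - a"]
    by eventually_elim (auto intro!: \<delta>(2))
qed

context brownian_setting
begin

text \<open>
  The left end point \<open>a\<close>, where the step function is 0 because its cells are open on the left, is
  a null set.
\<close>

lemma riemann_distance_le:
  assumes "a < b" "N > 0" "c \<ge> 0"
    and c: "\<And>u v. u \<in> {a..b} \<Longrightarrow> v \<in> {a..b} \<Longrightarrow> \<bar>u - v\<bar> \<le> (b - a) / real N \<Longrightarrow> \<bar>H u \<omega> - H v \<omega>\<bar> \<le> c"
  shows "(\<integral>\<^sup>+s\<in>{a..b}. ennreal ((H s \<omega> - elementary_process N (grid a b N) (\<lambda>i. H (grid a b N i)) s \<omega>)\<^sup>2) \<partial>lborel)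
     \<le> ennreal (c\<^sup>2 * (b - a))"
proof -
  have "(\<integral>\<^sup>+s\<in>{a..b}. ennreal ((H s \<omega> - elementary_process N (grid a b N) (\<lambda>i. H (grid a b N i)) s \<omega>)\<^sup>2) \<partial>lborel)
      \<le> (\<integral>\<^sup>+s\<in>{a..b}. ennreal (c\<^sup>2) \<partial>lborel)"
  proof (rule nn_integral_mono_AE)
    have "(H s \<omega> - elementary_process N (grid a b N) (\<lambda>i. H (grid a b N i)) s \<omega>)\<^sup>2 \<le> c\<^sup>2"
      if s: "s \<in> {a..b}" "s \<noteq> a" for s
    proof -
      obtain i where i: "i < N" "grid a b N i < s" "s \<le> grid a b N (Suc i)"
        by (rule increasing_locate[of "grid a b N" s N]) (use s assms(2) in auto)
      have "\<bar>H s \<omega> - H (grid a b N i) \<omega>\<bar> \<le> c"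
        using s i grid_in[of a b i N] assms(1) by (intro c) (auto simp: grid_Suc)
      then show ?thesis
        using assms(3) by (simp add: elementary_process_eq[OF grid_less[OF assms(1,2)] i] abs_le_square_iff[symmetric])
    qed
    moreover have "AE s in lborel. s \<noteq> a" by (rule AE_lborel_singleton)
    ultimately show "AE s in lborel. ennreal ((H s \<omega> - elementary_process N (grid a b N) (\<lambda>i. H (grid a b N i)) s \<omega>)\<^sup>2) * indicator {a..b} s
      \<le> ennreal (c\<^sup>2) * indicator {a..b} s"
      by (auto simp: indicator_def ennreal_leI elim!: eventually_mono)
  qed
  also have "\<dots> = ennreal (c\<^sup>2 * (b - a))"
    using assms(1) by (subst nn_integral_cmult_indicator) (auto simp: ennreal_mult)
  finally show ?thesis .
qed

text \<open>
  The approximating sequence provided by the definition and the Riemann step functions both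
  converge to \<open>H\<close>, the latter by uniform continuity of the paths. By
  \<open>elementary_integral_compare\<close> their integrals have the same limit.
\<close>

theorem ito_integral_riemann:
  assumes ito: "has_ito_integral M F W a b H I" and "0 \<le> a" "a < b"
    and cont: "\<And>\<omega>. \<omega> \<in> space M \<Longrightarrow> continuous_on {a..b} (\<lambda>s. H s \<omega>)"
    and adapt: "\<And>s. s \<in> {a..b} \<Longrightarrow> H s \<in> borel_measurable (F s)"
  shows "tendsto_in_prob M (\<lambda>N \<omega>. \<Sum>i<N. H (grid a b N i) \<omega> * (W (grid a b N (Suc i)) \<omega> - W (grid a b N i) \<omega>)) I"
proof -
  have ab: "a \<le> b" using \<open>a < b\<close> by simp
  define \<psi> where "\<psi> N = elementary_process N (grid a b N) (\<lambda>i. H (grid a b N i))" for N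
  define R where "R N = elementary_integral W N (grid a b N) (\<lambda>i. H (grid a b N i))" for N
  define d where "d N \<omega> = (\<integral>\<^sup>+s\<in>{a..b}. ennreal ((H s \<omega> - \<psi> N s \<omega>)\<^sup>2) \<partial>lborel)" for N \<omega>
  have prog: "progressively_measurable F a b H" using ito by (simp add: has_ito_integral_def)
  from ito obtain n \<tau> \<eta> where el: "\<forall>k. elementary_integrand M F a b (n k) (\<tau> k) (\<eta> k)"
    and dist: "\<forall>\<delta>>0. (\<lambda>k. measure M {\<omega> \<in> space M.
       (\<integral>\<^sup>+s\<in>{a..b}. ennreal ((H s \<omega> - elementary_process (n k) (\<tau> k) (\<eta> k) s \<omega>)\<^sup>2) \<partial>lborel) > ennreal \<delta>}) \<longlonglongrightarrow> 0"
    and conv: "tendsto_in_prob M (\<lambda>k. elementary_integral W (n k) (\<tau> k) (\<eta> k)) I"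
    by (rule has_ito_integral_approximations)
  have HM: "H (grid a b N i) \<in> borel_measurable M" if "i < N" for N i
    by (rule F_M[OF adapt]) (use grid_in[OF ab] that in auto)
  have WM: "W (grid a b N i) \<in> borel_measurable M" if "i \<le> N" for N i
    by (rule W_M) (use grid_in[OF ab that] \<open>0 \<le> a\<close> in auto)
  have RM[measurable]: "R N \<in> borel_measurable M" for N
    unfolding R_def elementary_integral_def
    by (intro borel_measurable_sum borel_measurable_times borel_measurable_diff HM WM) auto
  note [measurable] = tendsto_in_prob_measurable[OF conv]
  have dM[measurable]: "d N \<in> borel_measurable M" for N
    unfolding d_def \<psi>_def by (rule distance_measurable[OF prog ab]) (rule HM)
  \<comment> \<open>Finiteness allows passing to the real-valued distance \<open>V\<close>.\<close>
  have fin: "d N \<omega> < \<infinity>" if "N > 0" "\<omega> \<in> space M" for N \<omega>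
  proof -
    have "bounded ((\<lambda>s. H s \<omega>) ` {a..b})"
      using cont[OF that(2)] by (intro compact_imp_bounded compact_continuous_image) auto
    then obtain B where B: "\<And>s. s \<in> {a..b} \<Longrightarrow> \<bar>H s \<omega>\<bar> \<le> B"
      unfolding bounded_iff by fastforce
    have Bp: "B \<ge> 0" using B[of a] ab by auto
    have b2: "\<bar>H u \<omega> - H v \<omega>\<bar> \<le> 2 * B" if "u \<in> {a..b}" "v \<in> {a..b}" for u v
      using B[OF that(1)] B[OF that(2)] by linarith
    have "d N \<omega> \<le> ennreal ((2 * B)\<^sup>2 * (b - a))"
      unfolding d_def \<psi>_def
      by (rule riemann_distance_le[OF \<open>a < b\<close> that(1)]) (use Bp b2 in auto)
    then show ?thesis by (simp add: order_le_less_trans)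
  qed
  define V where "V N \<omega> = enn2real (d N \<omega>)" for N \<omega>
  have V0: "tendsto_in_prob M V (\<lambda>_. 0)"
  proof (rule tendsto_in_prob_AE)
    show "V k \<in> borel_measurable M" for k unfolding V_def by measurable
    show "AE \<omega> in M. (\<lambda>k. V k \<omega>) \<longlonglongrightarrow> 0"
    proof (rule AE_I2)
      fix \<omega> assume \<omega>: "\<omega> \<in> space M"
      show "(\<lambda>k. V k \<omega>) \<longlonglongrightarrow> 0"
      proof (rule tendstoI)
        fix r :: real assume r: "r > 0"
        define c where "c = sqrt (r / (2 * (b - a)))"
        have c: "c > 0" "c\<^sup>2 * (b - a) = r / 2"
          using r \<open>a < b\<close> by (auto simp: c_def field_simps)
        show "\<forall>\<^sub>F k in sequentially. dist (V k \<omega>) 0 < r"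
          using uniform_modulus[OF cont[OF \<omega>] c(1)] eventually_gt_at_top[of 0]
        proof eventually_elim
          case (elim k)
          have "d k \<omega> \<le> ennreal (c\<^sup>2 * (b - a))"
            unfolding d_def \<psi>_def
          proof (rule riemann_distance_le[OF \<open>a < b\<close> elim(2)])
            show "c \<ge> 0" using c by simp
            show "\<bar>H u \<omega> - H v \<omega>\<bar> \<le> c" if "u \<in> {a..b}" "v \<in> {a..b}" "\<bar>u - v\<bar> \<le> (b - a) / real k" for u v
              using elim(1)[rule_format, OF that] by simp
          qed
          then have "V k \<omega> \<le> r / 2"
            unfolding V_def c(2) using r by (intro enn2real_leI) auto
          then show ?case using r by (auto simp: V_def)
        qed
      qed
    qed
  qed auto
  have "tendsto_in_prob M (\<lambda>N \<omega>. R N \<omega> - I \<omega>) (\<lambda>_. 0)"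
  proof (rule tendsto_in_prob_zeroI[OF _ V0])
    fix N :: nat and \<delta> e :: real assume N: "N > 0" and \<delta>: "\<delta> > 0" and e: "e > 0"
    let ?d = "\<lambda>k \<omega>. \<integral>\<^sup>+s\<in>{a..b}. ennreal ((H s \<omega> - elementary_process (n k) (\<tau> k) (\<eta> k) s \<omega>)\<^sup>2) \<partial>lborel"
    let ?I = "\<lambda>k. elementary_integral W (n k) (\<tau> k) (\<eta> k)"
    have dV: "prob {\<omega>\<in>space M. d N \<omega> > ennreal e} \<le> prob {\<omega>\<in>space M. V N \<omega> > e}"
    proof (intro finite_measure_mono)
      show "{\<omega>\<in>space M. d N \<omega> > ennreal e} \<subseteq> {\<omega>\<in>space M. V N \<omega> > e}"
      proof safe
        fix \<omega> assume \<omega>: "\<omega> \<in> space M" "d N \<omega> > ennreal e"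
        have "d N \<omega> = ennreal (V N \<omega>)"
          using fin[OF N \<omega>(1)] by (simp add: V_def)
        with \<omega>(2) e show "V N \<omega> > e" by (simp add: ennreal_less_iff)
      qed
      show "{\<omega>\<in>space M. V N \<omega> > e} \<in> events" unfolding V_def by measurable
    qed
    have "prob {\<omega>\<in>space M. \<bar>R N \<omega> - I \<omega>\<bar> > \<delta>}
      \<le> prob {\<omega>\<in>space M. \<bar>?I k \<omega> - I \<omega>\<bar> > \<delta>/2} + (prob {\<omega>\<in>space M. ?d k \<omega> > ennreal e}
        + (prob {\<omega>\<in>space M. V N \<omega> > e} + 16 / \<delta>\<^sup>2 * e))" for k
    proof -
      note elk = el[rule_format, of k, unfolded elementary_integrand_def]
      have "prob {\<omega>\<in>space M. \<bar>R N \<omega> - I \<omega>\<bar> > \<delta>}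
          \<le> prob {\<omega>\<in>space M. \<bar>?I k \<omega> - I \<omega>\<bar> > \<delta>/2} + prob {\<omega>\<in>space M. \<bar>?I k \<omega> - R N \<omega>\<bar> > \<delta>/2}"
        by (intro prob_le_add) (auto simp: abs_if split: if_splits)
      also have "prob {\<omega>\<in>space M. \<bar>?I k \<omega> - R N \<omega>\<bar> > \<delta>/2} \<le>
         prob {\<omega>\<in>space M. ?d k \<omega> > ennreal e} + prob {\<omega>\<in>space M. d N \<omega> > ennreal e} + 4 * e / (\<delta>/2)\<^sup>2"
        unfolding R_def d_def \<psi>_def
      proof (rule elementary_integral_compare[OF \<open>0 \<le> a\<close> ab _ _ _ _ _ _ _ _ prog])
        show "\<tau> k 0 = a" "\<tau> k (n k) = b" using elk by blast+
        show "\<tau> k i < \<tau> k (Suc i)" if "i < n k" for i using elk that by blast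
        show "\<eta> k i \<in> borel_measurable (F (\<tau> k i))" if "i < n k" for i using elk that by blast
        show "grid a b N 0 = a" "grid a b N N = b" using N by simp_all
        show "grid a b N i < grid a b N (Suc i)" for i by (rule grid_less[OF \<open>a < b\<close> N])
        show "H (grid a b N i) \<in> borel_measurable (F (grid a b N i))" if "i < N" for i
          using grid_in[OF ab, of i N] that by (intro adapt) auto
      qed (use \<delta> e in auto)
      also have "4 * e / (\<delta>/2)\<^sup>2 = 16 / \<delta>\<^sup>2 * e" by (simp add: power_divide)
      finally show ?thesis using dV by linarith
    qed
    note le = this
    \<comment> \<open>Letting \<open>k\<close> tend to infinity removes the given approximations from the bound.\<close>
    have lim: "(\<lambda>k. prob {\<omega>\<in>space M. \<bar>?I k \<omega> - I \<omega>\<bar> > \<delta>/2} + (prob {\<omega>\<in>space M. ?d k \<omega> > ennreal e}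
        + (prob {\<omega>\<in>space M. V N \<omega> > e} + 16 / \<delta>\<^sup>2 * e)))
        \<longlonglongrightarrow> 0 + (0 + (prob {\<omega>\<in>space M. V N \<omega> > e} + 16 / \<delta>\<^sup>2 * e))"
      using \<delta> by (intro tendsto_add tendsto_const dist[rule_format, OF e] tendsto_in_probD[OF conv]) simp
    show "prob {\<omega>\<in>space M. \<bar>R N \<omega> - I \<omega>\<bar> > \<delta>}
        \<le> prob {\<omega>\<in>space M. V N \<omega> > e} + 16 / \<delta>\<^sup>2 * e"
    proof -
      have "prob {\<omega>\<in>space M. \<bar>R N \<omega> - I \<omega>\<bar> > \<delta>}
          \<le> 0 + (0 + (prob {\<omega>\<in>space M. V N \<omega> > e} + 16 / \<delta>\<^sup>2 * e))"
        by (rule LIMSEQ_le_const[OF lim]) (intro exI allI impI, rule le)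
      then show ?thesis by simp
    qed
  qed measurable
  then have "tendsto_in_prob M R I"
    by (simp add: tendsto_in_prob_def)
  then show ?thesis by (simp add: R_def[abs_def] elementary_integral_def[abs_def])
qed

text \<open>
  Partition points increase strictly, so an elementary integrand on a single point has no cells.
\<close>

lemma ito_integral_trivial_interval:
  assumes "has_ito_integral M F W a a H I"
  shows "AE \<omega> in M. I \<omega> = 0"
proof -
  from assms obtain n \<tau> \<eta> where el: "\<forall>k. elementary_integrand M F a a (n k) (\<tau> k) (\<eta> k)"
    and dist: "\<forall>\<delta>>0. (\<lambda>k. measure M {\<omega> \<in> space M.
       (\<integral>\<^sup>+s\<in>{a..a}. ennreal ((H s \<omega> - elementary_process (n k) (\<tau> k) (\<eta> k) s \<omega>)\<^sup>2) \<partial>lborel) > ennreal \<delta>}) \<longlonglongrightarrow> 0"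
    and conv: "tendsto_in_prob M (\<lambda>k. elementary_integral W (n k) (\<tau> k) (\<eta> k)) I"
    by (rule has_ito_integral_approximations)
  have n: "n k = 0" for k
  proof (rule ccontr)
    assume "n k \<noteq> 0"
    have e: "\<tau> k 0 = a" "\<tau> k (n k) = a" "\<And>i. i < n k \<Longrightarrow> \<tau> k i < \<tau> k (Suc i)"
      using el[rule_format, of k] unfolding elementary_integrand_def by blast+
    have "\<tau> k 0 < \<tau> k (n k)"
      by (rule increasing_less[of "n k" "\<tau> k", OF e(3)]) (use \<open>n k \<noteq> 0\<close> in auto)
    then show False using e by simp
  qed
  have "(\<lambda>k. elementary_integral W (n k) (\<tau> k) (\<eta> k)) = (\<lambda>k \<omega>. 0)"
    unfolding elementary_integral_def n by simp
  with conv have c0: "tendsto_in_prob M (\<lambda>k \<omega>. 0) I" by simp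
  have "tendsto_in_prob M (\<lambda>(k::nat) \<omega>. 0) (\<lambda>_. 0)" by (simp add: tendsto_in_prob_def)
  from tendsto_in_prob_unique[OF c0 this] show ?thesis .
qed

end

section \<open>Moments of one Euler step of geometric Brownian motion\<close>

lemma gaussian_exp_tilt:
  assumes "h > 0"
  shows "normal_density 0 (sqrt h) y * exp (c * y) = exp (c\<^sup>2 * h / 2) * normal_density (c * h) (sqrt h) y"
proof -
  have "- (y\<^sup>2 / (2 * h)) + c * y = c\<^sup>2 * h / 2 - (y - c * h)\<^sup>2 / (2 * h)"
    using assms by (simp add: field_simps power2_eq_square)
  then show ?thesis
    using assms by (simp add: normal_density_def exp_add[symmetric])
qed

text \<open>
  The exponential factor turns the centred normal density into one with mean \<open>c * h\<close> and the same
  variance, whose first two moments are known.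
\<close>

lemma gaussian_exp_moments:
  assumes h: "h > 0"
  defines "C \<equiv> \<lambda>c. exp (c\<^sup>2 * h / 2)"
  shows "has_bochner_integral lborel (\<lambda>y. normal_density 0 (sqrt h) y * exp (c * y)) (C c)"
    and "has_bochner_integral lborel (\<lambda>y. normal_density 0 (sqrt h) y * exp (c * y) * y) (C c * (c * h))"
    and "has_bochner_integral lborel (\<lambda>y. normal_density 0 (sqrt h) y * exp (c * y) * y\<^sup>2) (C c * (h + (c * h)\<^sup>2))"
proof -
  have s: "sqrt h > 0" using h by simp
  have 0: "has_bochner_integral lborel (\<lambda>y. normal_density (c * h) (sqrt h) y) 1"
    using normal_moment_even[OF s, of "c * h" 0] by simp
  have 1: "has_bochner_integral lborel (\<lambda>y. normal_density (c * h) (sqrt h) y * y) (c * h)"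
    by (rule normal_moment_nz_1[OF s])
  have v: "has_bochner_integral lborel (\<lambda>y. normal_density (c * h) (sqrt h) y * (y - c * h)\<^sup>2) h"
    using normal_moment_even[OF s, of "c * h" 1] h by (simp add: numeral_2_eq_2)
  have "has_bochner_integral lborel
      (\<lambda>y. normal_density (c * h) (sqrt h) y * (y - c * h)\<^sup>2
        + (2 * (c * h)) * (normal_density (c * h) (sqrt h) y * y) - (c * h)\<^sup>2 * normal_density (c * h) (sqrt h) y)
      (h + (2 * (c * h)) * (c * h) - (c * h)\<^sup>2 * 1)"
    by (intro has_bochner_integral_add has_bochner_integral_diff has_bochner_integral_mult_right v 0 1)
  then have 2: "has_bochner_integral lborel (\<lambda>y. normal_density (c * h) (sqrt h) y * y\<^sup>2) (h + (c * h)\<^sup>2)"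
    by (simp add: power2_eq_square algebra_simps)
  show "has_bochner_integral lborel (\<lambda>y. normal_density 0 (sqrt h) y * exp (c * y)) (C c)"
    unfolding gaussian_exp_tilt[OF h] C_def using has_bochner_integral_mult_right[OF 0, of "exp (c\<^sup>2 * h / 2)"] by simp
  show "has_bochner_integral lborel (\<lambda>y. normal_density 0 (sqrt h) y * exp (c * y) * y) (C c * (c * h))"
    unfolding gaussian_exp_tilt[OF h] C_def mult.assoc by (rule has_bochner_integral_mult_right) (use 1 in simp)
  show "has_bochner_integral lborel (\<lambda>y. normal_density 0 (sqrt h) y * exp (c * y) * y\<^sup>2) (C c * (h + (c * h)\<^sup>2))"
    unfolding gaussian_exp_tilt[OF h] C_def mult.assoc by (rule has_bochner_integral_mult_right) (use 2 in simp)
qed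

locale geometric_parameters =
  fixes \<alpha> \<sigma> :: real
begin

text \<open>
  \<open>decay h\<close> is the reciprocal of the exact growth factor of geometric Brownian motion over a time
  step \<open>h\<close>, as a function of the Brownian increment.
\<close>

definition decay :: "real \<Rightarrow> real \<Rightarrow> real" where
  "decay h y = exp (- (\<alpha> - \<sigma>\<^sup>2 / 2) * h - \<sigma> * y)"

text \<open>
  The growth factor of one Euler step divided by that of the exact solution.
\<close>

definition euler_ratio :: "real \<Rightarrow> real \<Rightarrow> real" where
  "euler_ratio h y = decay h y * (1 + \<alpha> * h + \<sigma> * y)"

text \<open>
  The next three closed forms are expectations under a centred normal law of variance \<open>h\<close>
  (\<open>one_step_moments\<close>): mean and variance of \<open>euler_ratio h\<close>, and mean square of \<open>decay h - 1\<close>.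
\<close>

definition euler_ratio_mean :: "real \<Rightarrow> real" where
  "euler_ratio_mean h = exp ((\<sigma>\<^sup>2 - \<alpha>) * h) * (1 - (\<sigma>\<^sup>2 - \<alpha>) * h)"

definition euler_ratio_var :: "real \<Rightarrow> real" where
  "euler_ratio_var h = exp ((3 * \<sigma>\<^sup>2 - 2 * \<alpha>) * h) * ((1 + \<alpha> * h - 2 * \<sigma>\<^sup>2 * h)\<^sup>2 + \<sigma>\<^sup>2 * h) - (euler_ratio_mean h)\<^sup>2"

definition decay_dev :: "real \<Rightarrow> real" where
  "decay_dev h = exp ((3 * \<sigma>\<^sup>2 - 2 * \<alpha>) * h) - 2 * exp ((\<sigma>\<^sup>2 - \<alpha>) * h) + 1"

lemma decay_measurable [measurable]: "decay h \<in> borel_measurable borel"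
  unfolding decay_def[abs_def] by measurable

lemma euler_ratio_measurable [measurable]: "euler_ratio h \<in> borel_measurable borel"
  unfolding euler_ratio_def[abs_def] by measurable

text \<open>
  After expanding the squares, every integrand is a linear combination of \<open>exp (c * y)\<close>,
  \<open>y * exp (c * y)\<close> and \<open>y\<^sup>2 * exp (c * y)\<close> with \<open>c\<close> one of \<open>0\<close>, \<open>- \<sigma>\<close> and \<open>- 2 * \<sigma>\<close>.
\<close>

lemma one_step_moments:
  assumes "h > 0"
  shows "has_bochner_integral lborel (\<lambda>y. normal_density 0 (sqrt h) y * (euler_ratio h y - euler_ratio_mean h)) 0"
    and "has_bochner_integral lborel (\<lambda>y. normal_density 0 (sqrt h) y * (euler_ratio h y - euler_ratio_mean h)\<^sup>2) (euler_ratio_var h)"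
    and "has_bochner_integral lborel (\<lambda>y. normal_density 0 (sqrt h) y * (decay h y - 1)\<^sup>2) (decay_dev h)"
proof -
  let ?n = "normal_density 0 (sqrt h)"
  define A where "A = exp (- (\<alpha> - \<sigma>\<^sup>2 / 2) * h)"
  define B where "B = 1 + \<alpha> * h"
  define C where "C c = exp (c\<^sup>2 * h / 2)" for c :: real
  note mom = gaussian_exp_moments[OF assms, folded C_def]
  have d: "decay h y = A * exp (- \<sigma> * y)" for y
    by (simp add: decay_def A_def exp_add[symmetric])
  have d2: "(decay h y)\<^sup>2 = A\<^sup>2 * exp (- (2 * \<sigma>) * y)" for y
    unfolding d by (simp add: power_mult_distrib exp_double[symmetric] mult.assoc)
  have AC1: "A * C (- \<sigma>) = exp ((\<sigma>\<^sup>2 - \<alpha>) * h)"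
    unfolding A_def C_def exp_add[symmetric] by (simp add: field_simps)
  have AC2: "A\<^sup>2 * C (- (2 * \<sigma>)) = exp ((3 * \<sigma>\<^sup>2 - 2 * \<alpha>) * h)"
    unfolding A_def C_def exp_double[symmetric] exp_add[symmetric] by (simp add: field_simps power2_eq_square)
  have m: "euler_ratio_mean h = A * C (- \<sigma>) * (B - \<sigma>\<^sup>2 * h)"
    unfolding AC1 euler_ratio_mean_def B_def by (simp add: algebra_simps)
  \<comment> \<open>The factor \<open>exp (0 * y)\<close> brings the constant term into the same form as the others.\<close>
  have s1: "?n y * (euler_ratio h y - euler_ratio_mean h)
      = A * B * (?n y * exp (- \<sigma> * y)) + A * \<sigma> * (?n y * exp (- \<sigma> * y) * y) - euler_ratio_mean h * (?n y * exp (0 * y))" for y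
    by (simp add: euler_ratio_def d B_def algebra_simps)
  show "has_bochner_integral lborel (\<lambda>y. ?n y * (euler_ratio h y - euler_ratio_mean h)) 0"
  proof -
    have "has_bochner_integral lborel (\<lambda>y. ?n y * (euler_ratio h y - euler_ratio_mean h))
        (A * B * C (- \<sigma>) + A * \<sigma> * (C (- \<sigma>) * (- \<sigma> * h)) - euler_ratio_mean h * C 0)"
      unfolding s1
      by (intro has_bochner_integral_add has_bochner_integral_diff has_bochner_integral_mult_right mom)
    moreover have "A * B * C (- \<sigma>) + A * \<sigma> * (C (- \<sigma>) * (- \<sigma> * h)) - euler_ratio_mean h * C 0 = 0"
      unfolding m by (simp add: C_def algebra_simps power2_eq_square)
    ultimately show ?thesis by simp
  qed
  have s2: "?n y * (euler_ratio h y - euler_ratio_mean h)\<^sup>2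
      = A\<^sup>2 * B\<^sup>2 * (?n y * exp (- (2 * \<sigma>) * y)) + 2 * A\<^sup>2 * B * \<sigma> * (?n y * exp (- (2 * \<sigma>) * y) * y)
        + A\<^sup>2 * \<sigma>\<^sup>2 * (?n y * exp (- (2 * \<sigma>) * y) * y\<^sup>2)
        - 2 * euler_ratio_mean h * A * B * (?n y * exp (- \<sigma> * y)) - 2 * euler_ratio_mean h * A * \<sigma> * (?n y * exp (- \<sigma> * y) * y)
        + (euler_ratio_mean h)\<^sup>2 * (?n y * exp (0 * y))" for y
  proof -
    have "euler_ratio h y = decay h y * (B + \<sigma> * y)" by (simp add: euler_ratio_def B_def)
    then have e: "(euler_ratio h y - euler_ratio_mean h)\<^sup>2
        = (decay h y)\<^sup>2 * (B + \<sigma> * y)\<^sup>2 - 2 * (decay h y * (B + \<sigma> * y)) * euler_ratio_mean h + (euler_ratio_mean h)\<^sup>2"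
      by (simp only: power2_diff power_mult_distrib)
    show ?thesis
      unfolding e d2 unfolding d power2_sum power_mult_distrib by (simp add: algebra_simps)
  qed
  show "has_bochner_integral lborel (\<lambda>y. ?n y * (euler_ratio h y - euler_ratio_mean h)\<^sup>2) (euler_ratio_var h)"
  proof -
    have "has_bochner_integral lborel (\<lambda>y. ?n y * (euler_ratio h y - euler_ratio_mean h)\<^sup>2)
       (A\<^sup>2 * B\<^sup>2 * C (- (2 * \<sigma>)) + 2 * A\<^sup>2 * B * \<sigma> * (C (- (2 * \<sigma>)) * (- (2 * \<sigma>) * h))
        + A\<^sup>2 * \<sigma>\<^sup>2 * (C (- (2 * \<sigma>)) * (h + (- (2 * \<sigma>) * h)\<^sup>2))
        - 2 * euler_ratio_mean h * A * B * C (- \<sigma>) - 2 * euler_ratio_mean h * A * \<sigma> * (C (- \<sigma>) * (- \<sigma> * h))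
        + (euler_ratio_mean h)\<^sup>2 * C 0)"
      unfolding s2
      by (intro has_bochner_integral_add has_bochner_integral_diff has_bochner_integral_mult_right mom)
    moreover have "A\<^sup>2 * B\<^sup>2 * C (- (2 * \<sigma>)) + 2 * A\<^sup>2 * B * \<sigma> * (C (- (2 * \<sigma>)) * (- (2 * \<sigma>) * h))
        + A\<^sup>2 * \<sigma>\<^sup>2 * (C (- (2 * \<sigma>)) * (h + (- (2 * \<sigma>) * h)\<^sup>2))
        - 2 * euler_ratio_mean h * A * B * C (- \<sigma>) - 2 * euler_ratio_mean h * A * \<sigma> * (C (- \<sigma>) * (- \<sigma> * h))
        + (euler_ratio_mean h)\<^sup>2 * C 0
        = (A\<^sup>2 * C (- (2 * \<sigma>))) * ((B - 2 * \<sigma>\<^sup>2 * h)\<^sup>2 + \<sigma>\<^sup>2 * h)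
          - 2 * euler_ratio_mean h * (A * C (- \<sigma>) * (B - \<sigma>\<^sup>2 * h)) + (euler_ratio_mean h)\<^sup>2"
      by (simp add: C_def power2_eq_square algebra_simps)
    moreover have "\<dots> = euler_ratio_var h"
      unfolding m[symmetric] AC2 unfolding euler_ratio_var_def B_def by (simp add: power2_eq_square algebra_simps)
    ultimately show ?thesis by simp
  qed
  show "has_bochner_integral lborel (\<lambda>y. ?n y * (decay h y - 1)\<^sup>2) (decay_dev h)"
  proof -
    have s3: "?n y * (decay h y - 1)\<^sup>2 = A\<^sup>2 * (?n y * exp (- (2 * \<sigma>) * y)) - 2 * A * (?n y * exp (- \<sigma> * y)) + ?n y * exp (0 * y)" for y
      unfolding power2_diff d2 unfolding d by (simp add: algebra_simps)
    have "has_bochner_integral lborel (\<lambda>y. ?n y * (decay h y - 1)\<^sup>2) (A\<^sup>2 * C (- (2 * \<sigma>)) - 2 * A * C (- \<sigma>) + C 0)"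
      unfolding s3
      by (intro has_bochner_integral_add has_bochner_integral_diff has_bochner_integral_mult_right mom)
    then show ?thesis unfolding AC2 decay_dev_def AC1[symmetric] by (simp add: C_def mult.assoc)
  qed
qed

end

lemma scaled_limit_of_derivative:
  fixes f :: "real \<Rightarrow> real"
  assumes "(f has_real_derivative D) (at 0)" "f 0 = 0" "t > 0"
  shows "(\<lambda>n. real n * f (t / real n)) \<longlonglongrightarrow> t * D"
proof -
  have "((\<lambda>h. f h / h) \<longlongrightarrow> D) (at 0)"
    using assms(1,2) by (simp add: DERIV_def)
  moreover have "filterlim (\<lambda>n. t / real n) (at 0) sequentially"
    unfolding filterlim_at using assms(3)
    by (auto intro!: real_tendsto_divide_at_top filterlim_real_sequentially eventually_gt_at_top
        elim!: eventually_mono[OF eventually_gt_at_top[of 0]])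
  ultimately have "(\<lambda>n. f (t / real n) / (t / real n)) \<longlonglongrightarrow> D"
    by (rule filterlim_compose)
  then have "(\<lambda>n. t * (f (t / real n) / (t / real n))) \<longlonglongrightarrow> t * D"
    by (rule tendsto_mult_left)
  then show ?thesis
    using assms(3) by (simp add: mult.commute)
qed

context geometric_parameters
begin

text \<open>
  The sum over \<open>n\<close> steps of length \<open>t / n\<close> converges to \<open>t\<close> times the derivative at step length 0.
  For mean and variance of the Euler ratio this derivative is 0: for the mean because of the Ito
  correction \<open>\<sigma>\<^sup>2 / 2\<close> in the exponent, for the variance because the terms linear in the
  Brownian increment cancel.
\<close>

lemma euler_ratio_mean_limit: "t > 0 \<Longrightarrow> (\<lambda>n. real n * (euler_ratio_mean (t / real n) - 1)) \<longlonglongrightarrow> 0"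
proof -
  assume t: "t > 0"
  have "((\<lambda>h. euler_ratio_mean h - 1) has_real_derivative 0) (at 0)"
    unfolding euler_ratio_mean_def by (auto intro!: derivative_eq_intros)
  from scaled_limit_of_derivative[OF this _ t] show ?thesis
    by (simp add: euler_ratio_mean_def)
qed

lemma euler_ratio_var_limit: "t > 0 \<Longrightarrow> (\<lambda>n. real n * euler_ratio_var (t / real n)) \<longlonglongrightarrow> 0"
proof -
  assume t: "t > 0"
  have "(euler_ratio_var has_real_derivative 0) (at 0)"
    unfolding euler_ratio_var_def[abs_def] euler_ratio_mean_def
    by (auto intro!: derivative_eq_intros simp: algebra_simps)
  from scaled_limit_of_derivative[OF this _ t] show ?thesis
    by (simp add: euler_ratio_var_def euler_ratio_mean_def)
qed

lemma decay_dev_limit: "t > 0 \<Longrightarrow> (\<lambda>n. real n * decay_dev (t / real n)) \<longlonglongrightarrow> t * \<sigma>\<^sup>2"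
proof -
  assume t: "t > 0"
  have "(decay_dev has_real_derivative \<sigma>\<^sup>2) (at 0)"
    unfolding decay_dev_def[abs_def]
    by (auto intro!: derivative_eq_intros simp: algebra_simps)
  from scaled_limit_of_derivative[OF this _ t] show ?thesis
    by (simp add: decay_dev_def)
qed

end

section \<open>Explicit solution of the linear stochastic differential equation\<close>

lemma continuous_bounded_interval:
  fixes f :: "real \<Rightarrow> real"
  assumes "continuous_on {a..b} f"
  obtains B where "B > 0" "\<And>s. s \<in> {a..b} \<Longrightarrow> \<bar>f s\<bar> \<le> B"
proof -
  have "bounded (f ` {a..b})"
    using assms by (intro compact_imp_bounded compact_continuous_image) auto
  then obtain B where "\<And>s. s \<in> {a..b} \<Longrightarrow> \<bar>f s\<bar> \<le> B"
    unfolding bounded_iff by fastforce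
  then show ?thesis using that[of "max B 1"] by fastforce
qed

lemma grid_sum_limit:
  fixes y :: "real \<Rightarrow> real"
  assumes y: "continuous_on {0..t} y" and "t > 0" and c: "(\<lambda>n. real n * c n) \<longlonglongrightarrow> 0"
  shows "(\<lambda>n. \<Sum>i<n. c n * y (grid 0 t n i)) \<longlonglongrightarrow> 0"
proof -
  obtain B where "B > 0" and B: "\<And>s. s \<in> {0..t} \<Longrightarrow> \<bar>y s\<bar> \<le> B"
    using continuous_bounded_interval[OF y] by metis
  show ?thesis
  proof (rule Lim_null_comparison)
    show "\<forall>\<^sub>F n in sequentially. norm (\<Sum>i<n. c n * y (grid 0 t n i)) \<le> \<bar>real n * c n\<bar> * B"
    proof (rule always_eventually, rule allI)
      fix n
      have "norm (\<Sum>i<n. c n * y (grid 0 t n i)) \<le> (\<Sum>i<n. \<bar>c n\<bar> * B)"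
        using grid_in[of 0 t _ n] \<open>t > 0\<close> by (intro sum_norm_le) (auto simp: abs_mult intro!: mult_left_mono B)
      then show "norm (\<Sum>i<n. c n * y (grid 0 t n i)) \<le> \<bar>real n * c n\<bar> * B"
        by (simp add: abs_mult)
    qed
    show "(\<lambda>n. \<bar>real n * c n\<bar> * B) \<longlonglongrightarrow> 0"
      by (rule tendsto_mult_left_zero) (rule tendsto_rabs_zero[OF c])
  qed
qed

locale geometric_brownian = brownian_setting M F W + geometric_parameters \<alpha> \<sigma>
  for M :: "'a measure" and F W and \<alpha> \<sigma> :: real
begin

text \<open>
  The deviation of the Euler ratio from 1 splits into its centred part, controlled by
  \<open>transform_bound\<close> since \<open>n\<close> times its variance vanishes in the limit, and a
  deterministic bias, of which \<open>n\<close> times the size vanishes as well. Path continuity bounds the weights.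
\<close>

lemma euler_defect_vanishes:
  assumes "t > 0"
    and Y: "\<And>s. s \<in> {0..t} \<Longrightarrow> Y s \<in> borel_measurable (F s)"
    and cont: "\<And>\<omega>. \<omega> \<in> space M \<Longrightarrow> continuous_on {0..t} (\<lambda>s. Y s \<omega>)"
  shows "tendsto_in_prob M (\<lambda>n \<omega>. \<Sum>i<n. Y (grid 0 t n i) \<omega> *
           (euler_ratio (t / real n) (W (grid 0 t n (Suc i)) \<omega> - W (grid 0 t n i) \<omega>) - 1)) (\<lambda>_. 0)"
proof -
  let ?g = "grid 0 t"
  have t0: "0 \<le> t" using \<open>t > 0\<close> by simp
  define \<zeta> where "\<zeta> n i \<omega> = euler_ratio (t / real n) (W (?g n (Suc i)) \<omega> - W (?g n i) \<omega>) - euler_ratio_mean (t / real n)" for n i \<omega>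
  \<comment> \<open>The second summand only makes the bound positive when the variance is 0.\<close>
  define v where "v n = \<bar>euler_ratio_var (t / real n)\<bar> + (t / real n)\<^sup>2" for n
  have YM: "Y (?g n i) \<in> borel_measurable M" if "i < n" for n i
    by (rule F_M[OF Y]) (use grid_in[OF t0, of i n] that in auto)
  have WM: "W (?g n i) \<in> borel_measurable M" if "i \<le> n" for n i
    by (rule W_M) (use grid_in[OF t0 that] in auto)
  have noise: "martingale_noise M (\<lambda>j. F (?g n j)) (\<zeta> n) (\<lambda>_. v n) n" if n: "n > 0" for n
    unfolding \<zeta>_def[abs_def]
  proof (rule increment_noise[where f="\<lambda>_ y. euler_ratio (t / real n) y - euler_ratio_mean (t / real n)" and u="\<lambda>_. euler_ratio_var (t / real n)"])
    have h: "t / real n > 0" using n \<open>t > 0\<close> by simp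
    show "?g n l < ?g n (Suc l)" for l by (rule grid_less[OF \<open>t > 0\<close> n])
    have d: "?g n (Suc j) - ?g n j = t / real n" for j by (simp add: grid_Suc)
    show "has_bochner_integral lborel (\<lambda>y. normal_density 0 (sqrt (?g n (Suc j) - ?g n j)) y * (euler_ratio (t / real n) y - euler_ratio_mean (t / real n))) 0" for j
      unfolding d by (rule one_step_moments(1)[OF h])
    show "has_bochner_integral lborel (\<lambda>y. normal_density 0 (sqrt (?g n (Suc j) - ?g n j)) y * (euler_ratio (t / real n) y - euler_ratio_mean (t / real n))\<^sup>2) (euler_ratio_var (t / real n))" for j
      unfolding d by (rule one_step_moments(2)[OF h])
    show "euler_ratio_var (t / real n) \<le> v n" by (simp add: v_def abs_le_iff add_increasing2)
    show "0 < v n" unfolding v_def using h by (intro add_nonneg_pos zero_less_power) auto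
  qed (simp, measurable)
  have nv: "(\<lambda>n. real n * v n) \<longlonglongrightarrow> 0"
  proof -
    have "(\<lambda>n. \<bar>real n * euler_ratio_var (t / real n)\<bar> + real n * (t / real n)\<^sup>2) \<longlonglongrightarrow> 0 + 0"
    proof (intro tendsto_add tendsto_rabs_zero euler_ratio_var_limit[OF \<open>t > 0\<close>])
      show "(\<lambda>n. real n * (t / real n)\<^sup>2) \<longlonglongrightarrow> 0" using \<open>t > 0\<close> by real_asymp
    qed
    then show ?thesis by (simp add: v_def abs_mult distrib_left)
  qed
  define V where "V n \<omega> = (\<Sum>i<n. v n * (Y (?g n i) \<omega>)\<^sup>2)" for n \<omega>
  have V0: "tendsto_in_prob M V (\<lambda>_. 0)"
  proof (rule tendsto_in_prob_AE)
    show "V n \<in> borel_measurable M" for n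
      unfolding V_def[abs_def] by (intro borel_measurable_sum borel_measurable_times borel_measurable_power borel_measurable_const YM) auto
    show "AE \<omega> in M. (\<lambda>n. V n \<omega>) \<longlonglongrightarrow> 0"
      unfolding V_def by (intro AE_I2 grid_sum_limit[OF _ \<open>t > 0\<close> nv] continuous_on_power cont)
  qed auto
  have S1: "tendsto_in_prob M (\<lambda>n \<omega>. \<Sum>i<n. Y (?g n i) \<omega> * \<zeta> n i \<omega>) (\<lambda>_. 0)"
  proof (rule tendsto_in_prob_zeroI[OF _ V0])
    show "(\<lambda>\<omega>. \<Sum>i<n. Y (?g n i) \<omega> * \<zeta> n i \<omega>) \<in> borel_measurable M" for n
    proof (intro borel_measurable_sum borel_measurable_times)
      fix i assume "i \<in> {..<n}"
      then have [measurable]: "W (?g n i) \<in> borel_measurable M" "W (?g n (Suc i)) \<in> borel_measurable M"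
        by (auto intro!: WM)
      show "\<zeta> n i \<in> borel_measurable M" unfolding \<zeta>_def[abs_def] by measurable
    qed (use YM in auto)
    fix n :: nat and \<delta> e :: real assume "n > 0" "\<delta> > 0" "e > 0"
    interpret N: martingale_noise M "\<lambda>j. F (?g n j)" "\<zeta> n" "\<lambda>_. v n" n
      by (rule noise[OF \<open>n > 0\<close>])
    have "Y (?g n j) \<in> borel_measurable (F (?g n j))" if "j < n" for j
      using grid_in[OF t0, of j n] that by (intro Y) auto
    from N.transform_bound[OF this \<open>\<delta> > 0\<close> \<open>e > 0\<close>]
    show "prob {\<omega>\<in>space M. \<bar>\<Sum>i<n. Y (?g n i) \<omega> * \<zeta> n i \<omega>\<bar> > \<delta>} \<le> prob {\<omega>\<in>space M. V n \<omega> > e} + 1 / \<delta>\<^sup>2 * e"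
      by (simp add: V_def)
  qed
  have S2: "tendsto_in_prob M (\<lambda>n \<omega>. \<Sum>i<n. (euler_ratio_mean (t / real n) - 1) * Y (?g n i) \<omega>) (\<lambda>_. 0)"
  proof (rule tendsto_in_prob_AE)
    show "AE \<omega> in M. (\<lambda>n. \<Sum>i<n. (euler_ratio_mean (t / real n) - 1) * Y (?g n i) \<omega>) \<longlonglongrightarrow> 0"
      by (intro AE_I2 grid_sum_limit[OF _ \<open>t > 0\<close> euler_ratio_mean_limit[OF \<open>t > 0\<close>]] cont)
  qed (auto intro!: borel_measurable_sum borel_measurable_times YM)
  from tendsto_in_prob_add[OF S1 S2] show ?thesis
    by (simp add: \<zeta>_def sum.distrib[symmetric] algebra_simps)
qed

text \<open>
  A coarse grid of \<open>n\<close> cells is subdivided into \<open>n * N n\<close> fine cells. On each coarse cell the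
  Riemann sum of \<open>H\<close> over the fine cells is compared with its left-point value. The factor
  \<open>Y * decay\<close> is known only at the end of the coarse cell, so it is split as
  \<open>Y + Y * (decay - 1)\<close>. The first part is a transform with adapted weights, which are small by
  uniform continuity of \<open>H\<close>. For the second, \<open>decay - 1\<close> has mean square of order \<open>1/n\<close>, so its
  squares have a bounded expected sum over the \<open>n\<close> cells, and by Cauchy-Schwarz it suffices that
  the sum of the squared block sums is small.
\<close>

lemma block_residual_vanishes:
  assumes "t > 0" and N: "\<And>n. N n > 0"
    and Y: "\<And>s. s \<in> {0..t} \<Longrightarrow> Y s \<in> borel_measurable (F s)"
    and contY: "\<And>\<omega>. \<omega> \<in> space M \<Longrightarrow> continuous_on {0..t} (\<lambda>s. Y s \<omega>)"
    and H: "\<And>s. s \<in> {0..t} \<Longrightarrow> H s \<in> borel_measurable (F s)"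
    and contH: "\<And>\<omega>. \<omega> \<in> space M \<Longrightarrow> continuous_on {0..t} (\<lambda>s. H s \<omega>)"
  shows "tendsto_in_prob M (\<lambda>n \<omega>. \<Sum>i<n. Y (grid 0 t n i) \<omega> *
       decay (t / real n) (W (grid 0 t n (Suc i)) \<omega> - W (grid 0 t n i) \<omega>) *
       (\<Sum>j=i * N n..<i * N n + N n. (H (grid 0 t (n * N n) j) \<omega> - H (grid 0 t n i) \<omega>) *
          (W (grid 0 t (n * N n) (Suc j)) \<omega> - W (grid 0 t (n * N n) j) \<omega>))) (\<lambda>_. 0)"
proof -
  let ?g = "grid 0 t" and ?q = "\<lambda>n. grid 0 t (n * N n)"
  have t0: "0 \<le> t" using \<open>t > 0\<close> by simp
  define w where "w n j \<omega> = Y (?g n (j div N n)) \<omega> * (H (?q n j) \<omega> - H (?g n (j div N n)) \<omega>)" for n j \<omega>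
  define dW where "dW n j \<omega> = W (?q n (Suc j)) \<omega> - W (?q n j) \<omega>" for n j \<omega>
  define D where "D n i \<omega> = decay (t / real n) (W (?g n (Suc i)) \<omega> - W (?g n i) \<omega>) - 1" for n i \<omega>
  define V where "V n \<omega> = (\<Sum>j<n * N n. t / real (n * N n) * (w n j \<omega>)\<^sup>2)" for n \<omega>
  have idx: "j div N n < n" if "j < n * N n" for j n
    using that N[of n] by (simp add: less_mult_imp_div_less)
  have blk: "j div N n = i" if "j \<in> {i * N n..<i * N n + N n}" for i j n
    using that N[of n] by (intro div_nat_eqI) (auto simp: mult.commute)
  have blk_less: "j < n * N n" if "i < n" "j \<in> {i * N n..<i * N n + N n}" for i j n
  proof -
    have "Suc i * N n \<le> n * N n" using that(1) by (intro mult_le_mono1) simp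
    then show ?thesis using that(2) by simp
  qed
  have coarse: "?g n i = ?q n (i * N n)" if "n > 0" for n i
    using N[of n] that by (simp add: grid_def)
  have before: "?g n (j div N n) \<le> ?q n j" "?q n j - ?g n (j div N n) \<le> t / real n" if "n > 0" for n j
  proof -
    have "j div N n * N n \<le> j" "j \<le> j div N n * N n + N n"
      using N[of n] mod_less_divisor[of "N n" j] by (auto simp: div_times_less_eq_dividend intro!: less_imp_le) (metis add.commute dividend_less_div_times less_imp_le)
    then have r: "real (j div N n * N n) \<le> real j" "real j \<le> real (j div N n * N n) + real (N n)"
      by (simp_all only: of_nat_add[symmetric] of_nat_le_iff)
    show "?g n (j div N n) \<le> ?q n j"
      unfolding coarse[OF that] using r(1) t0 by (auto simp: grid_def intro!: mult_left_mono divide_right_mono simp del: of_nat_mult)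
    have "t * (real j / real (n * N n)) - t * (real (j div N n * N n) / real (n * N n)) = t * ((real j - real (j div N n * N n)) / real (n * N n))"
      by (simp add: right_diff_distrib diff_divide_distrib)
    also have "\<dots> \<le> t * (real (N n) / real (n * N n))"
      using r(2) t0 by (intro mult_left_mono divide_right_mono) auto
    also have "\<dots> = t / real n" using N[of n] by simp
    finally show "?q n j - ?g n (j div N n) \<le> t / real n"
      unfolding coarse[OF that] by (simp add: grid_def)
  qed
  have q_in: "?q n j \<in> {0..t}" if "j \<le> n * N n" for n j by (rule grid_in[OF t0 that])
  have g_in: "?g n i \<in> {0..t}" if "i \<le> n" for n i by (rule grid_in[OF t0 that])
  have wF: "w n j \<in> borel_measurable (F (?q n j))" if j: "j < n * N n" for n j
  proof -
    have n: "n > 0" using j by (cases n) auto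
    have i: "?g n (j div N n) \<in> {0..t}" using idx[OF j] by (intro g_in) simp
    have [measurable]: "Y (?g n (j div N n)) \<in> borel_measurable (F (?q n j))"
      "H (?g n (j div N n)) \<in> borel_measurable (F (?q n j))"
      by (rule F_mono[OF before(1)[OF n] Y[OF i]], rule F_mono[OF before(1)[OF n] H[OF i]])
    have [measurable]: "H (?q n j) \<in> borel_measurable (F (?q n j))"
      using j by (intro H q_in) simp
    show ?thesis unfolding w_def[abs_def] by measurable
  qed
  have wM[measurable]: "w n j \<in> borel_measurable M" if "j < n * N n" for n j
    by (rule F_M[OF wF[OF that]])
  have dWM[measurable]: "dW n j \<in> borel_measurable M" if "j < n * N n" for n j
    unfolding dW_def[abs_def] by (intro borel_measurable_diff W_M) (use q_in[of j n] q_in[of "Suc j" n] that in auto)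
  have DM[measurable]: "D n i \<in> borel_measurable M" if "i < n" for n i
  proof -
    have [measurable]: "W (?g n i) \<in> borel_measurable M" "W (?g n (Suc i)) \<in> borel_measurable M"
      using g_in[of i n] g_in[of "Suc i" n] that by (auto intro!: W_M)
    show ?thesis unfolding D_def[abs_def] by measurable
  qed
  have noise: "martingale_noise M (\<lambda>j. F (?q n j)) (dW n) (\<lambda>_. t / real (n * N n)) (n * N n)" if n: "n > 0" for n
  proof -
    have "martingale_noise M (\<lambda>j. F (?q n j)) (dW n) (\<lambda>j. ?q n (Suc j) - ?q n j) (n * N n)"
      unfolding dW_def[abs_def] using n N[of n] by (intro brownian_noise grid_less \<open>t > 0\<close>) auto
    then show ?thesis by (simp add: grid_Suc)
  qed
  have Vnn: "V n \<omega> \<ge> 0" for n \<omega> unfolding V_def using t0 by (intro sum_nonneg) auto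
  have VM[measurable]: "V n \<in> borel_measurable M" for n unfolding V_def[abs_def] by measurable
  have Vlim: "(\<lambda>n. V n \<omega>) \<longlonglongrightarrow> 0" if \<omega>: "\<omega> \<in> space M" for \<omega>
  proof (rule tendstoI)
    fix r :: real assume r: "r > 0"
    obtain B where B: "B > 0" "\<And>s. s \<in> {0..t} \<Longrightarrow> \<bar>Y s \<omega>\<bar> \<le> B"
      using continuous_bounded_interval[OF contY[OF \<omega>]] by metis
    define c where "c = sqrt (r / (2 * t * B\<^sup>2))"
    have c: "c > 0" "t * (B * c)\<^sup>2 = r / 2"
      using r \<open>t > 0\<close> B(1) by (auto simp: c_def power_mult_distrib field_simps)
    show "\<forall>\<^sub>F n in sequentially. dist (V n \<omega>) 0 < r"
      using uniform_modulus[OF contH[OF \<omega>] c(1)] eventually_gt_at_top[of 0]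
    proof eventually_elim
      case (elim n)
      have "V n \<omega> \<le> (\<Sum>j<n * N n. t / real (n * N n) * (B * c)\<^sup>2)"
        unfolding V_def
      proof (intro sum_mono mult_left_mono)
        fix j assume "j \<in> {..<n * N n}"
        then have j: "?q n j \<in> {0..t}" "?g n (j div N n) \<in> {0..t}"
          using q_in[of j n] g_in[of "j div N n" n] idx[of j n] by auto
        have "\<bar>H (?q n j) \<omega> - H (?g n (j div N n)) \<omega>\<bar> < c"
          using elim(1)[rule_format, OF j] before[OF elim(2), of j] by auto
        then have "\<bar>w n j \<omega>\<bar> \<le> B * c"
          unfolding w_def abs_mult using B(1) by (intro mult_mono B(2) j) auto
        then show "(w n j \<omega>)\<^sup>2 \<le> (B * c)\<^sup>2"
          using abs_le_square_iff[of "w n j \<omega>" "B * c"] B(1) c(1) by simp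
      qed (use t0 in auto)
      also have "\<dots> = r / 2" using c(2) elim(2) N[of n] by simp
      finally show ?case using r Vnn[of n \<omega>] by simp
    qed
  qed
  have V0: "tendsto_in_prob M V (\<lambda>_. 0)"
    by (intro tendsto_in_prob_AE AE_I2 Vlim) auto
  \<comment> \<open>The bound on the block sums is applied with \<open>e\<^sup>2\<close> in place of \<open>e\<close>, hence the square root.\<close>
  have sV0: "tendsto_in_prob M (\<lambda>n \<omega>. sqrt (V n \<omega>)) (\<lambda>_. 0)"
    by (intro tendsto_in_prob_AE AE_I2) (auto intro: tendsto_eq_intros Vlim)
  have S1: "tendsto_in_prob M (\<lambda>n \<omega>. \<Sum>j<n * N n. w n j \<omega> * dW n j \<omega>) (\<lambda>_. 0)"
  proof (rule tendsto_in_prob_zeroI[OF _ V0])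
    fix n :: nat and \<delta> e :: real assume "n > 0" "\<delta> > 0" "e > 0"
    interpret N: martingale_noise M "\<lambda>j. F (?q n j)" "dW n" "\<lambda>_. t / real (n * N n)" "n * N n"
      by (rule noise[OF \<open>n > 0\<close>])
    from N.transform_bound[OF wF \<open>\<delta> > 0\<close> \<open>e > 0\<close>]
    show "prob {\<omega>\<in>space M. \<bar>\<Sum>j<n * N n. w n j \<omega> * dW n j \<omega>\<bar> > \<delta>} \<le> prob {\<omega>\<in>space M. V n \<omega> > e} + 1 / \<delta>\<^sup>2 * e"
      by (simp add: V_def)
  qed measurable
  define Bl where "Bl n i \<omega> = (\<Sum>j=i * N n..<i * N n + N n. w n j \<omega> * dW n j \<omega>)" for n i \<omega>
  have BlM[measurable]: "Bl n i \<in> borel_measurable M" if "i < n" for n i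
    unfolding Bl_def[abs_def] using blk_less[OF that] by (intro borel_measurable_sum borel_measurable_times wM dWM) auto
  obtain K where K: "K > 0" "\<And>n. \<bar>real n * decay_dev (t / real n)\<bar> \<le> K"
  proof -
    from decay_dev_limit[OF \<open>t > 0\<close>] have "convergent (\<lambda>n. real n * decay_dev (t / real n))"
      by (auto simp: convergent_def)
    then have "Bseq (\<lambda>n. real n * decay_dev (t / real n))" by (rule convergent_imp_Bseq)
    then show ?thesis using that by (elim BseqE) auto
  qed
  have S2: "tendsto_in_prob M (\<lambda>n \<omega>. \<Sum>i<n. D n i \<omega> * Bl n i \<omega>) (\<lambda>_. 0)"
  proof (rule tendsto_in_prob_zeroI[OF _ sV0])
    fix n :: nat and \<delta> e :: real assume n: "n > 0" and \<delta>: "\<delta> > 0" and e: "e > 0"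
    interpret N: martingale_noise M "\<lambda>j. F (?q n j)" "dW n" "\<lambda>_. t / real (n * N n)" "n * N n"
      by (rule noise[OF n])
    have h: "t / real n > 0" using n \<open>t > 0\<close> by simp
    have Dsq: "integrable M (\<lambda>\<omega>. (D n i \<omega>)\<^sup>2)" "expectation (\<lambda>\<omega>. (D n i \<omega>)\<^sup>2) = decay_dev (t / real n)" if "i < n" for i
    proof -
      have g: "0 \<le> ?g n i" "?g n i < ?g n (Suc i)" "?g n (Suc i) - ?g n i = t / real n"
        using g_in[of i n] that grid_less[OF \<open>t > 0\<close> n] by (auto simp: grid_Suc)
      have m: "(\<lambda>y. (decay (t / real n) y - 1)\<^sup>2) \<in> borel_measurable borel" by measurable
      show "integrable M (\<lambda>\<omega>. (D n i \<omega>)\<^sup>2)" "expectation (\<lambda>\<omega>. (D n i \<omega>)\<^sup>2) = decay_dev (t / real n)"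
        using increment_expectation[OF g(1,2) _ m, unfolded g(3), OF one_step_moments(3)[OF h]] by (simp_all add: D_def)
    qed
    have DI: "integrable M (\<lambda>\<omega>. \<Sum>i<n. (D n i \<omega>)\<^sup>2)" using Dsq by auto
    have DE: "expectation (\<lambda>\<omega>. \<Sum>i<n. (D n i \<omega>)\<^sup>2) \<le> K"
      using Dsq K(2)[of n] by (subst Bochner_Integration.integral_sum) (auto simp: abs_le_iff)
    have [measurable]: "(\<lambda>\<omega>. \<Sum>i<n. (D n i \<omega>)\<^sup>2) \<in> borel_measurable M" by measurable
    have "prob {\<omega>\<in>space M. \<bar>\<Sum>i<n. D n i \<omega> * Bl n i \<omega>\<bar> > \<delta>}
        \<le> prob {\<omega>\<in>space M. (\<Sum>i<n. (Bl n i \<omega>)\<^sup>2) > \<delta> * e} + prob {\<omega>\<in>space M. (\<Sum>i<n. (D n i \<omega>)\<^sup>2) \<ge> \<delta> / e}"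
    proof (intro prob_le_add subsetI)
      fix \<omega> assume *: "\<omega> \<in> {\<omega>\<in>space M. \<bar>\<Sum>i<n. D n i \<omega> * Bl n i \<omega>\<bar> > \<delta>}"
      \<comment> \<open>The weight \<open>e\<close> in this form of Cauchy-Schwarz balances the bounded sum of the \<open>(D n i)\<^sup>2\<close>
        against the small sum of the \<open>(Bl n i)\<^sup>2\<close>.\<close>
      have am: "\<bar>x * y\<bar> \<le> (e * x\<^sup>2 + y\<^sup>2 / e) / 2" for x y
      proof -
        have "0 \<le> (e * \<bar>x\<bar> - \<bar>y\<bar>)\<^sup>2 / e" using e by simp
        also have "\<dots> = e * x\<^sup>2 + y\<^sup>2 / e - 2 * (\<bar>x\<bar> * \<bar>y\<bar>)"
          using e by (simp add: power2_diff power_mult_distrib field_simps power2_eq_square)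
        finally show ?thesis by (simp add: abs_mult)
      qed
      have "\<bar>\<Sum>i<n. D n i \<omega> * Bl n i \<omega>\<bar> \<le> (\<Sum>i<n. (e * (D n i \<omega>)\<^sup>2 + (Bl n i \<omega>)\<^sup>2 / e) / 2)"
        by (rule order_trans[OF sum_abs sum_mono[OF am]])
      also have "\<dots> = (e * (\<Sum>i<n. (D n i \<omega>)\<^sup>2) + (\<Sum>i<n. (Bl n i \<omega>)\<^sup>2) / e) / 2"
        by (simp add: sum_divide_distrib[symmetric] sum.distrib sum_distrib_left)
      finally have "2 * \<delta> < e * (\<Sum>i<n. (D n i \<omega>)\<^sup>2) + (\<Sum>i<n. (Bl n i \<omega>)\<^sup>2) / e"
        using * by simp
      then have "e * (\<Sum>i<n. (D n i \<omega>)\<^sup>2) \<ge> \<delta> \<or> (\<Sum>i<n. (Bl n i \<omega>)\<^sup>2) / e > \<delta>" by linarith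
      then show "\<omega> \<in> {\<omega>\<in>space M. (\<Sum>i<n. (Bl n i \<omega>)\<^sup>2) > \<delta> * e} \<union> {\<omega>\<in>space M. (\<Sum>i<n. (D n i \<omega>)\<^sup>2) \<ge> \<delta> / e}"
        using * e by (auto simp: field_simps)
    qed measurable
    also have "prob {\<omega>\<in>space M. (\<Sum>i<n. (D n i \<omega>)\<^sup>2) \<ge> \<delta> / e} \<le> expectation (\<lambda>\<omega>. \<Sum>i<n. (D n i \<omega>)\<^sup>2) / (\<delta> / e)"
      using DI \<delta> e by (intro integral_Markov_inequality_measure) (auto intro!: sum_nonneg)
    also have "\<dots> \<le> K / (\<delta> / e)" using DE \<delta> e by (intro divide_right_mono) auto
    also have "prob {\<omega>\<in>space M. (\<Sum>i<n. (Bl n i \<omega>)\<^sup>2) > \<delta> * e} \<le> prob {\<omega>\<in>space M. V n \<omega> > e\<^sup>2} + e\<^sup>2 / (\<delta> * e)"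
      unfolding Bl_def V_def using \<delta> e by (intro N.block_square_bound wF) auto
    also have "{\<omega>\<in>space M. V n \<omega> > e\<^sup>2} = {\<omega>\<in>space M. sqrt (V n \<omega>) > e}"
      using e Vnn[of n] by (auto simp: real_less_rsqrt) (metis real_sqrt_less_iff real_sqrt_abs abs_of_pos)+
    finally show "prob {\<omega>\<in>space M. \<bar>\<Sum>i<n. D n i \<omega> * Bl n i \<omega>\<bar> > \<delta>}
        \<le> prob {\<omega>\<in>space M. sqrt (V n \<omega>) > e} + ((K + 1) / \<delta>) * e"
      using e \<delta> by (simp add: power2_eq_square field_simps)
  qed measurable
  have "(\<Sum>i<n. Y (?g n i) \<omega> * decay (t / real n) (W (?g n (Suc i)) \<omega> - W (?g n i) \<omega>) *
       (\<Sum>j=i * N n..<i * N n + N n. (H (?q n j) \<omega> - H (?g n i) \<omega>) * (W (?q n (Suc j)) \<omega> - W (?q n j) \<omega>)))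
      = (\<Sum>j<n * N n. w n j \<omega> * dW n j \<omega>) + (\<Sum>i<n. D n i \<omega> * Bl n i \<omega>)" for n \<omega>
  proof -
    have "Y (?g n i) \<omega> * decay (t / real n) (W (?g n (Suc i)) \<omega> - W (?g n i) \<omega>) *
       (\<Sum>j=i * N n..<i * N n + N n. (H (?q n j) \<omega> - H (?g n i) \<omega>) * (W (?q n (Suc j)) \<omega> - W (?q n j) \<omega>))
      = (D n i \<omega> + 1) * Bl n i \<omega>" for i
    proof -
      have "Bl n i \<omega> = Y (?g n i) \<omega> * (\<Sum>j=i * N n..<i * N n + N n. (H (?q n j) \<omega> - H (?g n i) \<omega>) * (W (?q n (Suc j)) \<omega> - W (?q n j) \<omega>))"
        unfolding Bl_def sum_distrib_left by (intro sum.cong refl) (auto simp: w_def dW_def blk)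
      then show ?thesis by (simp add: D_def algebra_simps)
    qed
    moreover have "(\<Sum>j<n * N n. w n j \<omega> * dW n j \<omega>) = (\<Sum>i<n. Bl n i \<omega>)"
      unfolding Bl_def by (rule sum.nat_group[symmetric])
    ultimately show ?thesis by (simp add: distrib_right sum.distrib)
  qed
  with tendsto_in_prob_add[OF S1 S2] show ?thesis by simp
qed

end

text \<open>
  The increment of the integral over a coarse cell is the difference of two integrals that start
  at 0. Both have Riemann sums over the same fine grid, so only the fine cells inside the coarse
  cell remain.
\<close>

lemma (in brownian_setting) ito_block_riemann:
  assumes "t > 0"
    and ito: "\<And>s. s \<in> {0..t} \<Longrightarrow> has_ito_integral M F W 0 s H (I s)"
    and H: "\<And>s. s \<in> {0..t} \<Longrightarrow> H s \<in> borel_measurable (F s)"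
    and cont: "\<And>\<omega>. \<omega> \<in> space M \<Longrightarrow> continuous_on {0..t} (\<lambda>s. H s \<omega>)"
    and i: "i < n"
  shows "tendsto_in_prob M (\<lambda>K \<omega>. \<Sum>j=i * Suc K..<i * Suc K + Suc K.
            (H (grid 0 t (n * Suc K) j) \<omega> - H (grid 0 t n i) \<omega>) *
            (W (grid 0 t (n * Suc K) (Suc j)) \<omega> - W (grid 0 t (n * Suc K) j) \<omega>))
         (\<lambda>\<omega>. I (grid 0 t n (Suc i)) \<omega> - I (grid 0 t n i) \<omega>
            - H (grid 0 t n i) \<omega> * (W (grid 0 t n (Suc i)) \<omega> - W (grid 0 t n i) \<omega>))"
proof -
  let ?g = "grid 0 t n" and ?q = "\<lambda>K. grid 0 t (n * Suc K)"
  have t0: "0 \<le> t" and n: "n > 0" using \<open>t > 0\<close> i by auto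
  have g_in: "?g i \<in> {0..t}" if "i \<le> n" for i by (rule grid_in[OF t0 that])
  have coarse: "?q K (i * Suc K) = ?g i" for K i
    using n by (simp add: grid_def del: mult_Suc_right of_nat_Suc)
  have R: "tendsto_in_prob M (\<lambda>K \<omega>. \<Sum>j<i * Suc K. H (?q K j) \<omega> * (W (?q K (Suc j)) \<omega> - W (?q K j) \<omega>)) (I (?g i))"
    if "i \<le> n" for i
  proof (cases "i = 0")
    case True
    have "has_ito_integral M F W 0 0 H (I 0)" using ito[of 0] t0 by simp
    then have "AE \<omega> in M. I 0 \<omega> = 0" "I 0 \<in> borel_measurable M"
      by (rule ito_integral_trivial_interval, auto simp: has_ito_integral_def tendsto_in_prob_def)
    then show ?thesis using True
      by (intro tendsto_in_prob_AE) (auto elim!: eventually_mono)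
  next
    case False
    have gi: "0 < ?g i" using False \<open>t > 0\<close> n by (simp add: grid_def)
    have "tendsto_in_prob M (\<lambda>N \<omega>. \<Sum>j<N. H (grid 0 (?g i) N j) \<omega> * (W (grid 0 (?g i) N (Suc j)) \<omega> - W (grid 0 (?g i) N j) \<omega>)) (I (?g i))"
    proof (rule ito_integral_riemann[OF ito[OF g_in[OF that]] order_refl gi])
      show "continuous_on {0..?g i} (\<lambda>s. H s \<omega>)" if "\<omega> \<in> space M" for \<omega>
        by (rule continuous_on_subset[OF cont[OF that]]) (use g_in[OF \<open>i \<le> n\<close>] in auto)
      show "H s \<in> borel_measurable (F s)" if "s \<in> {0..?g i}" for s
        using that g_in[OF \<open>i \<le> n\<close>] by (intro H) auto
    qed
    moreover have "strict_mono (\<lambda>K. i * Suc K)" using False by (auto simp: strict_mono_def)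
    ultimately have *: "tendsto_in_prob M (\<lambda>K \<omega>. \<Sum>j<i * Suc K. H (grid 0 (?g i) (i * Suc K) j) \<omega>
        * (W (grid 0 (?g i) (i * Suc K) (Suc j)) \<omega> - W (grid 0 (?g i) (i * Suc K) j) \<omega>)) (I (?g i))"
      by (rule tendsto_in_prob_subseq)
    have "grid 0 (?g i) (i * Suc K) j = ?q K j" for K j
      using False n by (simp add: grid_def field_simps del: mult_Suc_right of_nat_Suc)
    with * show ?thesis by simp
  qed
  have WM: "(\<lambda>\<omega>. H (?g i) \<omega> * (W (?g (Suc i)) \<omega> - W (?g i) \<omega>)) \<in> borel_measurable M"
    using g_in[of i] g_in[of "Suc i"] i
    by (intro borel_measurable_times borel_measurable_diff W_M F_M[OF H]) auto
  have "tendsto_in_prob M (\<lambda>K \<omega>. (\<Sum>j<Suc i * Suc K. H (?q K j) \<omega> * (W (?q K (Suc j)) \<omega> - W (?q K j) \<omega>))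
      - (\<Sum>j<i * Suc K. H (?q K j) \<omega> * (W (?q K (Suc j)) \<omega> - W (?q K j) \<omega>))
      - H (?g i) \<omega> * (W (?g (Suc i)) \<omega> - W (?g i) \<omega>))
    (\<lambda>\<omega>. I (?g (Suc i)) \<omega> - I (?g i) \<omega> - H (?g i) \<omega> * (W (?g (Suc i)) \<omega> - W (?g i) \<omega>))"
    using i by (intro tendsto_in_prob_diff R tendsto_in_prob_const[OF WM]) auto
  moreover have "(\<Sum>j<Suc i * Suc K. H (?q K j) \<omega> * (W (?q K (Suc j)) \<omega> - W (?q K j) \<omega>))
      - (\<Sum>j<i * Suc K. H (?q K j) \<omega> * (W (?q K (Suc j)) \<omega> - W (?q K j) \<omega>))
      - H (?g i) \<omega> * (W (?g (Suc i)) \<omega> - W (?g i) \<omega>)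
    = (\<Sum>j=i * Suc K..<i * Suc K + Suc K. (H (?q K j) \<omega> - H (?g i) \<omega>) * (W (?q K (Suc j)) \<omega> - W (?q K j) \<omega>))" for K \<omega>
  proof -
    have e: "Suc i * Suc K = i * Suc K + Suc K" by simp
    have split: "(\<Sum>j<Suc i * Suc K. f j) - (\<Sum>j<i * Suc K. f j) = (\<Sum>j=i * Suc K..<i * Suc K + Suc K. f j)" for f :: "nat \<Rightarrow> real"
      unfolding e lessThan_atLeast0 by (subst sum.atLeastLessThan_concat[of 0 "i * Suc K" "i * Suc K + Suc K", symmetric]) auto
    have "(\<Sum>j=i * Suc K..<i * Suc K + Suc K. W (?q K (Suc j)) \<omega> - W (?q K j) \<omega>) = W (?q K (Suc i * Suc K)) \<omega> - W (?q K (i * Suc K)) \<omega>"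
      unfolding e by (rule sum_Suc_diff') simp
    then have tel: "(\<Sum>j=i * Suc K..<i * Suc K + Suc K. W (?q K (Suc j)) \<omega> - W (?q K j) \<omega>) = W (?g (Suc i)) \<omega> - W (?g i) \<omega>"
      unfolding coarse .
    show ?thesis unfolding split tel[symmetric] sum_distrib_left sum_subtractf[symmetric] left_diff_distrib[symmetric] ..
  qed
  ultimately show ?thesis by simp
qed

lemma drift_increment:
  fixes x :: "real \<Rightarrow> real"
  assumes x: "continuous_on {0..} x" and "0 \<le> u" "u \<le> v"
    and e: "\<And>r. r \<in> {u..v} \<Longrightarrow> \<bar>x r - c\<bar> \<le> e"
  shows "\<bar>(LBINT r:{0..v}. x r) - (LBINT r:{0..u}. x r) - (v - u) * c\<bar> \<le> (v - u) * e"
proof -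
  have LB: "(LBINT r:{0..s}. x r) = integral {0..s} x" for s
    by (intro set_borel_integral_eq_integral borel_integrable_atLeastAtMost' continuous_on_subset[OF x]) auto
  have io: "x integrable_on {p..s}" if "0 \<le> p" for p s
    by (intro integrable_continuous_interval continuous_on_subset[OF x]) (use that in auto)
  have comb: "integral {0..u} x + integral {u..v} x = integral {0..v} x"
    using assms(2,3) io by (intro Henstock_Kurzweil_Integration.integral_combine) auto
  have hi: "((\<lambda>r. x r - c) has_integral (integral {u..v} x - (v - u) * c)) {u..v}"
    using has_integral_diff[OF integrable_integral[OF io[OF \<open>0 \<le> u\<close>]] has_integral_const_real[of c u v]] \<open>u \<le> v\<close>
    by (simp add: mult.commute)
  have e0: "0 \<le> e" using e[of u] \<open>u \<le> v\<close> by (simp add: order_trans[OF abs_ge_zero])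
  have "norm (integral {u..v} x - (v - u) * c) \<le> e * Henstock_Kurzweil_Integration.content {u..v}"
    by (rule has_integral_bound_real[OF e0 finite.emptyI hi]) (use e in auto)
  then show ?thesis using comb \<open>u \<le> v\<close> by (simp add: LB mult.commute algebra_simps)
qed

lemma drift_sum_limit:
  fixes x e :: "real \<Rightarrow> real"
  assumes x: "continuous_on {0..} x" and e: "continuous_on {0..t} e" and "t > 0"
  shows "(\<lambda>n. \<Sum>i<n. e (grid 0 t n (Suc i)) * ((LBINT r:{0..grid 0 t n (Suc i)}. x r)
            - (LBINT r:{0..grid 0 t n i}. x r) - t / real n * x (grid 0 t n i))) \<longlonglongrightarrow> 0"
proof (rule tendstoI)
  fix r :: real assume r: "r > 0"
  have t0: "0 \<le> t" using \<open>t > 0\<close> by simp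
  obtain B where B: "B > 0" "\<And>s. s \<in> {0..t} \<Longrightarrow> \<bar>e s\<bar> \<le> B"
    using continuous_bounded_interval[OF e] by metis
  define c where "c = r / (2 * (B * t))"
  have c: "c > 0" "B * t * c = r / 2" using r B(1) \<open>t > 0\<close> by (auto simp: c_def)
  have x': "continuous_on {0..t} x" by (rule continuous_on_subset[OF x]) auto
  show "\<forall>\<^sub>F n in sequentially. dist (\<Sum>i<n. e (grid 0 t n (Suc i)) * ((LBINT r:{0..grid 0 t n (Suc i)}. x r)
            - (LBINT r:{0..grid 0 t n i}. x r) - t / real n * x (grid 0 t n i))) 0 < r"
    using uniform_modulus[OF x' c(1)] eventually_gt_at_top[of 0]
  proof eventually_elim
    case (elim n)
    have "norm (\<Sum>i<n. e (grid 0 t n (Suc i)) * ((LBINT r:{0..grid 0 t n (Suc i)}. x r)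
            - (LBINT r:{0..grid 0 t n i}. x r) - t / real n * x (grid 0 t n i))) \<le> (\<Sum>i<n. B * (t / real n * c))"
    proof (rule sum_norm_le)
      fix i assume "i \<in> {..<n}"
      then have g: "grid 0 t n i \<in> {0..t}" "grid 0 t n (Suc i) \<in> {0..t}" "grid 0 t n i \<le> grid 0 t n (Suc i)"
        using grid_in[OF t0, of i n] grid_in[OF t0, of "Suc i" n] grid_less[OF \<open>t > 0\<close> elim(2), of i] by auto
      have d: "grid 0 t n (Suc i) - grid 0 t n i = t / real n" by (simp add: grid_Suc)
      have osc: "\<bar>x s - x (grid 0 t n i)\<bar> \<le> c" if "s \<in> {grid 0 t n i..grid 0 t n (Suc i)}" for s
      proof -
        have "s \<in> {0..t}" "\<bar>s - grid 0 t n i\<bar> \<le> (t - 0) / real n" using that g d by auto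
        from elim(1)[rule_format, OF this(1) g(1) this(2)] show ?thesis by simp
      qed
      have "\<bar>(LBINT r:{0..grid 0 t n (Suc i)}. x r) - (LBINT r:{0..grid 0 t n i}. x r)
          - (grid 0 t n (Suc i) - grid 0 t n i) * x (grid 0 t n i)\<bar> \<le> (grid 0 t n (Suc i) - grid 0 t n i) * c"
        using g by (intro drift_increment[OF x _ g(3) osc]) auto
      then show "norm (e (grid 0 t n (Suc i)) * ((LBINT r:{0..grid 0 t n (Suc i)}. x r)
            - (LBINT r:{0..grid 0 t n i}. x r) - t / real n * x (grid 0 t n i))) \<le> B * (t / real n * c)"
        unfolding d real_norm_def abs_mult using B(1) B(2)[OF g(2)] by (intro mult_mono) auto
    qed
    also have "\<dots> = r / 2" using c(2) elim(2) by simp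
    finally show ?case using r by simp
  qed
qed

text \<open>
  One step of the product of \<open>E\<close> and \<open>X\<close>: \<open>e\<close> and \<open>x\<close> are the values at the left end point, \<open>e * d\<close>
  and \<open>x + p + j\<close> those at the right end point, where \<open>p\<close> is the drift contribution and \<open>j\<close> the
  increment of the stochastic integral.
\<close>

lemma product_increment:
  fixes e x d p j :: real
  shows "e * d * (x + p + j) - e * x =
    e * x * (d * (1 + a * h + s * w) - 1) + e * d * (p - h * (a * x)) + e * d * (j - s * x * w)"
  by (simp add: algebra_simps)

context geometric_brownian
begin

text \<open>
  The product of \<open>X\<close> and the reciprocal \<open>E\<close> of the claimed growth factor is constant in time. Its
  increment up to \<open>t\<close> is the sum of the Euler defects \<open>T1\<close>, the drift errors and the
  left-point errors \<open>T3\<close> of the stochastic integral. As \<open>X\<close> may fail to be integrable,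
  convergence in probability is the right notion throughout.
\<close>

theorem linear_sde_solution_eq:
  assumes sol: "sde_solution M F W (\<lambda>t u. \<alpha> * u) (\<lambda>t u. \<sigma> * u) {0..} 0 X" and "0 \<le> t"
  shows "AE \<omega> in M. X t \<omega> = X 0 \<omega> * exp ((\<alpha> - \<sigma>\<^sup>2 / 2) * t + \<sigma> * (W t \<omega> - W 0 \<omega>))"
proof (cases "t = 0")
  case False
  then have t: "t > 0" using \<open>0 \<le> t\<close> by simp
  let ?g = "grid 0 t"
  have XF: "\<And>s. 0 \<le> s \<Longrightarrow> X s \<in> borel_measurable (F s)"
    and Xcont: "\<And>\<omega>. \<omega> \<in> space M \<Longrightarrow> continuous_on {0..} (\<lambda>s. X s \<omega>)"
    and ex: "\<forall>s\<in>{0..}. \<exists>I. has_ito_integral M F W 0 s (\<lambda>s \<omega>. \<sigma> * X s \<omega>) I \<and>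
         (AE \<omega> in M. X s \<omega> = X 0 \<omega> + (LBINT r:{0..s}. \<alpha> * X r \<omega>) + I \<omega>)"
    using sol unfolding sde_solution_def by auto
  from bchoice[OF ex] obtain I where
    ito: "\<And>s. 0 \<le> s \<Longrightarrow> has_ito_integral M F W 0 s (\<lambda>s \<omega>. \<sigma> * X s \<omega>) (I s)" and
    eq: "\<And>s. 0 \<le> s \<Longrightarrow> AE \<omega> in M. X s \<omega> = X 0 \<omega> + (LBINT r:{0..s}. \<alpha> * X r \<omega>) + I s \<omega>"
    by auto
  have Wcont: "\<And>\<omega>. \<omega> \<in> space M \<Longrightarrow> continuous_on {0..} (\<lambda>s. W s \<omega>)"
    using bm unfolding brownian_motion_def by blast
  define E where "E s \<omega> = exp (- (\<alpha> - \<sigma>\<^sup>2 / 2) * s - \<sigma> * (W s \<omega> - W 0 \<omega>))" for s \<omega>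
  have EF: "E s \<in> borel_measurable (F s)" if "0 \<le> s" for s
  proof -
    note [measurable] = W_F[OF that] F_mono[OF that W_F[OF order_refl]]
    show ?thesis unfolding E_def[abs_def] by measurable
  qed
  have Econt: "continuous_on {0..} (\<lambda>s. E s \<omega>)" if "\<omega> \<in> space M" for \<omega>
    unfolding E_def by (intro continuous_intros Wcont that)
  have E_Suc: "E (?g n (Suc i)) \<omega> = E (?g n i) \<omega> * decay (t / real n) (W (?g n (Suc i)) \<omega> - W (?g n i) \<omega>)" for n i \<omega>
    unfolding E_def decay_def exp_add[symmetric] by (simp add: grid_Suc algebra_simps)
  have g_in: "?g n i \<in> {0..t}" if "i \<le> n" for n i by (rule grid_in[OF \<open>0 \<le> t\<close> that])
  have EM[measurable]: "E s \<in> borel_measurable M" if "0 \<le> s" for s using F_M[OF EF[OF that]] .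
  have XM[measurable]: "X s \<in> borel_measurable M" if "0 \<le> s" for s using F_M[OF XF[OF that]] .
  define T1 where "T1 n \<omega> = (\<Sum>i<n. (E (?g n i) \<omega> * X (?g n i) \<omega>) *
      (euler_ratio (t / real n) (W (?g n (Suc i)) \<omega> - W (?g n i) \<omega>) - 1))" for n \<omega>
  define T3 where "T3 n \<omega> = (\<Sum>i<n. E (?g n (Suc i)) \<omega> * (I (?g n (Suc i)) \<omega> - I (?g n i) \<omega>
      - (\<sigma> * X (?g n i) \<omega>) * (W (?g n (Suc i)) \<omega> - W (?g n i) \<omega>)))" for n \<omega>
  have T1_lim: "tendsto_in_prob M T1 (\<lambda>_. 0)"
    unfolding T1_def[abs_def]
  proof (rule euler_defect_vanishes[OF t])
    show "(\<lambda>\<omega>. E s \<omega> * X s \<omega>) \<in> borel_measurable (F s)" if "s \<in> {0..t}" for s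
      using that by (intro borel_measurable_times EF XF) auto
    show "continuous_on {0..t} (\<lambda>s. E s \<omega> * X s \<omega>)" if "\<omega> \<in> space M" for \<omega>
      by (rule continuous_on_subset[OF continuous_on_mult[OF Econt[OF that] Xcont[OF that]]]) auto
  qed
  have T3_lim: "tendsto_in_prob M T3 (\<lambda>_. 0)"
  proof (rule tendsto_in_prob_diagonal)
    let ?H = "\<lambda>s \<omega>. \<sigma> * X s \<omega>"
    let ?S = "\<lambda>n K \<omega>. \<Sum>i<n. E (?g n (Suc i)) \<omega> * (\<Sum>j=i * Suc K..<i * Suc K + Suc K.
            (?H (?g (n * Suc K) j) \<omega> - ?H (?g n i) \<omega>) * (W (?g (n * Suc K) (Suc j)) \<omega> - W (?g (n * Suc K) j) \<omega>))"
    have H: "?H s \<in> borel_measurable (F s)" if "s \<in> {0..t}" for s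
      using that by (intro borel_measurable_times XF) auto
    have contH: "continuous_on {0..t} (\<lambda>s. ?H s \<omega>)" if "\<omega> \<in> space M" for \<omega>
      by (intro continuous_on_mult_left continuous_on_subset[OF Xcont[OF that]]) auto
    show "tendsto_in_prob M (?S n) (T3 n)" for n
      unfolding T3_def[abs_def]
    proof (intro tendsto_in_prob_sum tendsto_in_prob_mult_rv ito_block_riemann[OF t _ H contH])
      show "has_ito_integral M F W 0 s ?H (I s)" if "s \<in> {0..t}" for s using that by (intro ito) auto
      show "E (?g n (Suc i)) \<in> borel_measurable M" if "i \<in> {..<n}" for i
        using g_in[of "Suc i" n] that by (intro EM) auto
    qed auto
    show "tendsto_in_prob M (\<lambda>n. ?S n (K n)) (\<lambda>_. 0)" for K :: "nat \<Rightarrow> nat"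
      unfolding E_Suc
    proof (rule block_residual_vanishes[OF t _ _ _ H contH, where N="\<lambda>n. Suc (K n)"])
      show "E s \<in> borel_measurable (F s)" if "s \<in> {0..t}" for s using that by (intro EF) auto
      show "continuous_on {0..t} (\<lambda>s. E s \<omega>)" if "\<omega> \<in> space M" for \<omega>
        by (rule continuous_on_subset[OF Econt[OF that]]) auto
    qed auto
  qed
  define \<Delta> where "\<Delta> \<omega> = E t \<omega> * X t \<omega> - E 0 \<omega> * X 0 \<omega>" for \<omega>
  have \<Delta>M: "\<Delta> \<in> borel_measurable M"
    unfolding \<Delta>_def[abs_def] by (intro borel_measurable_diff borel_measurable_times EM XM) (use t in auto)
  have "AE \<omega> in M. \<forall>n i. i \<le> n \<longrightarrow> X (?g n i) \<omega> = X 0 \<omega> + (LBINT r:{0..?g n i}. \<alpha> * X r \<omega>) + I (?g n i) \<omega>"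
    unfolding AE_all_countable
  proof (intro allI)
    fix n i
    show "AE \<omega> in M. i \<le> n \<longrightarrow> X (?g n i) \<omega> = X 0 \<omega> + (LBINT r:{0..?g n i}. \<alpha> * X r \<omega>) + I (?g n i) \<omega>"
      using eq[of "?g n i"] g_in[of i n] by (cases "i \<le> n") auto
  qed
  \<comment> \<open>The drift part is defined as the remaining difference, which is measurable; on almost every
    path it equals the sum of the drift errors.\<close>
  then have T2_lim: "AE \<omega> in M. (\<lambda>n. \<Delta> \<omega> - T1 n \<omega> - T3 n \<omega>) \<longlonglongrightarrow> 0"
    using AE_space
  proof eventually_elim
    case (elim \<omega>)
    let ?\<Phi> = "\<lambda>s. LBINT r:{0..s}. \<alpha> * X r \<omega>"
    have "\<Delta> \<omega> - T1 n \<omega> - T3 n \<omega> = (\<Sum>i<n. E (?g n (Suc i)) \<omega> * (?\<Phi> (?g n (Suc i)) - ?\<Phi> (?g n i) - t / real n * (\<alpha> * X (?g n i) \<omega>)))"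
      if n: "n > 0" for n
    proof -
      have "\<Delta> \<omega> = (\<Sum>i<n. E (?g n (Suc i)) \<omega> * X (?g n (Suc i)) \<omega> - E (?g n i) \<omega> * X (?g n i) \<omega>)"
        unfolding sum_lessThan_telescope[of "\<lambda>i. E (?g n i) \<omega> * X (?g n i) \<omega>"] \<Delta>_def using n by simp
      also have "\<dots> = (\<Sum>i<n. (E (?g n i) \<omega> * X (?g n i) \<omega>) * (euler_ratio (t / real n) (W (?g n (Suc i)) \<omega> - W (?g n i) \<omega>) - 1)
         + E (?g n (Suc i)) \<omega> * (?\<Phi> (?g n (Suc i)) - ?\<Phi> (?g n i) - t / real n * (\<alpha> * X (?g n i) \<omega>))
         + E (?g n (Suc i)) \<omega> * (I (?g n (Suc i)) \<omega> - I (?g n i) \<omega> - (\<sigma> * X (?g n i) \<omega>) * (W (?g n (Suc i)) \<omega> - W (?g n i) \<omega>)))"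
      proof (rule sum.cong[OF refl])
        fix i assume "i \<in> {..<n}"
        then have "X (?g n (Suc i)) \<omega> = X (?g n i) \<omega> + (?\<Phi> (?g n (Suc i)) - ?\<Phi> (?g n i)) + (I (?g n (Suc i)) \<omega> - I (?g n i) \<omega>)"
          using elim(1)[rule_format, of "Suc i" n] elim(1)[rule_format, of i n] by simp
        then show "E (?g n (Suc i)) \<omega> * X (?g n (Suc i)) \<omega> - E (?g n i) \<omega> * X (?g n i) \<omega>
         = (E (?g n i) \<omega> * X (?g n i) \<omega>) * (euler_ratio (t / real n) (W (?g n (Suc i)) \<omega> - W (?g n i) \<omega>) - 1)
         + E (?g n (Suc i)) \<omega> * (?\<Phi> (?g n (Suc i)) - ?\<Phi> (?g n i) - t / real n * (\<alpha> * X (?g n i) \<omega>))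
         + E (?g n (Suc i)) \<omega> * (I (?g n (Suc i)) \<omega> - I (?g n i) \<omega> - (\<sigma> * X (?g n i) \<omega>) * (W (?g n (Suc i)) \<omega> - W (?g n i) \<omega>))"
          unfolding euler_ratio_def E_Suc by (rule ssubst) (rule product_increment)
      qed
      finally show ?thesis unfolding T1_def T3_def by (simp add: sum.distrib)
    qed
    note form = this
    have "(\<lambda>n. \<Sum>i<n. E (?g n (Suc i)) \<omega> * (?\<Phi> (?g n (Suc i)) - ?\<Phi> (?g n i) - t / real n * (\<alpha> * X (?g n i) \<omega>))) \<longlonglongrightarrow> 0"
      by (rule drift_sum_limit[OF _ _ t, of "\<lambda>r. \<alpha> * X r \<omega>" "\<lambda>r. E r \<omega>"])
        (use elim(2) in \<open>auto intro!: continuous_on_mult_left Xcont continuous_on_subset[OF Econt]\<close>)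
    then show ?case
      by (rule Lim_transform_eventually) (use form in \<open>auto intro!: eventually_mono[OF eventually_gt_at_top[of 0]]\<close>)
  qed
  have T2: "tendsto_in_prob M (\<lambda>n \<omega>. \<Delta> \<omega> - T1 n \<omega> - T3 n \<omega>) (\<lambda>_. 0)"
    by (rule tendsto_in_prob_AE[OF _ _ T2_lim])
      (auto intro!: borel_measurable_diff \<Delta>M tendsto_in_prob_measurable(1)[OF T1_lim] tendsto_in_prob_measurable(1)[OF T3_lim])
  from tendsto_in_prob_add[OF tendsto_in_prob_add[OF T2 T1_lim] T3_lim]
  have "tendsto_in_prob M (\<lambda>n::nat. \<Delta>) (\<lambda>_. 0)" by simp
  from tendsto_in_prob_unique[OF this tendsto_in_prob_const[OF \<Delta>M]] have "AE \<omega> in M. \<Delta> \<omega> = 0" by (auto elim: eventually_mono)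
  then show ?thesis
  proof eventually_elim
    case (elim \<omega>)
    have "E t \<omega> * exp ((\<alpha> - \<sigma>\<^sup>2 / 2) * t + \<sigma> * (W t \<omega> - W 0 \<omega>)) = 1"
      unfolding E_def exp_add[symmetric] by (simp add: algebra_simps)
    moreover have "E t \<omega> * X t \<omega> = X 0 \<omega>" using elim by (simp add: \<Delta>_def E_def)
    ultimately show ?case by (metis mult.assoc mult.commute mult.right_neutral)
  qed
qed simp

end

section \<open>Normal and lognormal laws\<close>

lemma distributed_AE_cong:
  assumes d: "distributed M N X f" and eq: "AE \<omega> in M. X \<omega> = Y \<omega>" and Y: "Y \<in> measurable M N"
  shows "distributed M N Y f"
proof -
  have "distr M N X = distr M N Y"
    using d Y eq by (intro distr_cong_AE refl) (auto simp: distributed_def)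
  then show ?thesis using d Y by (auto simp: distributed_def)
qed

lemma (in prob_space) normal_affine:
  assumes X: "distributed M lborel X (normal_density \<mu> \<sigma>)" and "0 < \<sigma>" "c \<noteq> 0"
    and eq: "AE \<omega> in M. Y \<omega> = a + c * X \<omega>" and Y: "Y \<in> borel_measurable M"
  shows "distributed M lborel Y (normal_density (a + c * \<mu>) (\<bar>c\<bar> * \<sigma>))"
  by (rule distributed_AE_cong[OF normal_density_affine[OF X]]) (use assms in \<open>auto elim: eventually_mono\<close>)

lemma lognormal_density_measurable [measurable]: "lognormal_density \<mu> \<nu> \<in> borel_measurable borel"
  unfolding lognormal_density_def[abs_def] by measurable

lemma lognormal_density_exp:
  assumes "\<nu> > 0"
  shows "exp y * lognormal_density \<mu> \<nu> (exp y) = normal_density \<mu> (sqrt \<nu>) y"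
  using assms by (simp add: lognormal_density_def normal_density_def)

lemma ln_le_exp: "0 < u \<Longrightarrow> ln u \<le> a \<longleftrightarrow> u \<le> exp (a::real)"
  by (metis exp_le_cancel_iff exp_ln)

text \<open>
  Substituting \<open>u = exp y\<close> in the distribution function, by \<open>lognormal_density_exp\<close>.
\<close>

lemma (in prob_space) ln_lognormal:
  assumes X: "distributed M lborel X (\<lambda>u. ennreal (lognormal_density \<mu> \<nu> u))"
    and "\<nu> > 0" and pos: "AE \<omega> in M. X \<omega> > 0"
  shows "distributed M lborel (\<lambda>\<omega>. ln (X \<omega>)) (normal_density \<mu> (sqrt \<nu>))"
proof (rule distributedI_borel_atMost)
  have XM[measurable]: "X \<in> borel_measurable M" using X by (auto simp: distributed_def)
  show "(\<lambda>\<omega>. ln (X \<omega>)) \<in> borel_measurable M" by measurable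
  have s: "sqrt \<nu> > 0" using assms by simp
  fix a :: real
  let ?n = "normal_density \<mu> (sqrt \<nu>)" and ?l = "lognormal_density \<mu> \<nu>"
  have ai: "?n absolutely_integrable_on {..a}"
    using integrable_normal_density[OF s, of \<mu>]
    by (intro set_integrable_subset[where A=UNIV and B="{..a}"])
      (auto simp: set_integrable_def integrable_completion)
  have img: "exp ` {..a} = {0<..exp a}"
  proof (intro equalityI subsetI)
    fix u assume "u \<in> {0<..exp a}"
    then have "u = exp (ln u)" "ln u \<le> a" using ln_le_exp[of u a] by auto
    then show "u \<in> exp ` {..a}" by blast
  qed auto
  have "(\<lambda>y. \<bar>exp y\<bar> * ?l (exp y)) absolutely_integrable_on {..a} \<and>
      integral {..a} (\<lambda>y. \<bar>exp y\<bar> * ?l (exp y)) = integral {..a} ?n"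
    using ai by (simp add: lognormal_density_exp[OF \<open>\<nu> > 0\<close>])
  then have "?l absolutely_integrable_on exp ` {..a} \<and> integral (exp ` {..a}) ?l = integral {..a} ?n"
    by (subst (asm) has_absolute_integral_change_of_variables_1') (auto intro!: derivative_eq_intros inj_onI)
  then have hl: "(?l has_integral integral {..a} ?n) {0<..exp a}"
    unfolding img by (metis absolutely_integrable_on_def integrable_integral)
  have hn: "(?n has_integral integral {..a} ?n) {..a}"
    using ai by (metis absolutely_integrable_on_def integrable_integral)
  show "(\<integral>\<^sup>+ y. ?n y * indicator {..a} y \<partial>lborel) = ennreal (integral {..a} ?n)"
  proof -
    have "(\<integral>\<^sup>+ y. ennreal (?n y * indicator {..a} y) \<partial>lborel) = (\<integral>\<^sup>+ y. ennreal (?n y) * indicator {..a} y \<partial>lborel)"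
      by (intro nn_integral_cong) (auto split: split_indicator)
    also have "\<dots> = ennreal (integral {..a} ?n)"
      by (rule nn_integral_has_integral_lebesgue'[OF _ hn]) (simp add: normal_density_nonneg)
    finally show ?thesis .
  qed
  have "emeasure M {\<omega>\<in>space M. ln (X \<omega>) \<le> a} = emeasure M (X -` {0<..exp a} \<inter> space M)"
  proof (rule emeasure_eq_AE)
    show "AE \<omega> in M. (\<omega> \<in> {\<omega>\<in>space M. ln (X \<omega>) \<le> a}) = (\<omega> \<in> X -` {0<..exp a} \<inter> space M)"
      using pos by eventually_elim (auto simp: ln_le_exp)
  qed measurable
  also have "\<dots> = (\<integral>\<^sup>+ u. ennreal (?l u) * indicator {0<..exp a} u \<partial>lborel)"
    by (rule distributed_emeasure[OF X]) simp
  also have "\<dots> = ennreal (integral {..a} ?n)"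
    using \<open>\<nu> > 0\<close> by (intro nn_integral_has_integral_lebesgue'[OF _ hl]) (auto simp: lognormal_density_def)
  finally show "emeasure M {\<omega>\<in>space M. ln (X \<omega>) \<le> a} = ennreal (integral {..a} ?n)" .
qed (auto simp: normal_density_nonneg)

text \<open>
  For \<open>c \<noteq> 0\<close>, the expectation is the convolution of \<open>normal_density \<mu> \<sigma>\<close> with the density of
  \<open>- c * Z\<close>, taken at \<open>a\<close>.
\<close>

lemma (in prob_space) gaussian_smoothing:
  assumes Z: "distributed M lborel Z (normal_density 0 s)" and "0 < s" "0 < \<sigma>"
  shows "expectation (\<lambda>\<omega>. normal_density \<mu> \<sigma> (a + c * Z \<omega>)) = normal_density \<mu> (sqrt (\<sigma>\<^sup>2 + (c * s)\<^sup>2)) a"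
proof (cases "c = 0")
  case True
  then show ?thesis using \<open>0 < \<sigma>\<close> by (simp add: prob_space)
next
  case False
  have ZM: "Z \<in> borel_measurable M" using Z by (auto simp: distributed_def)
  then have mZ: "(\<lambda>\<omega>. - c * Z \<omega>) \<in> borel_measurable M" by measurable
  have cs: "0 < \<bar>c\<bar> * s" using False \<open>0 < s\<close> by simp
  have Y: "distributed M lborel (\<lambda>\<omega>. - c * Z \<omega>) (normal_density 0 (\<bar>c\<bar> * s))"
    using normal_affine[OF Z \<open>0 < s\<close>, of "- c" "\<lambda>\<omega>. - c * Z \<omega>" 0] mZ False by simp
  have "expectation (\<lambda>\<omega>. normal_density \<mu> \<sigma> (a + c * Z \<omega>)) = expectation (\<lambda>\<omega>. normal_density 0 \<sigma> ((a - \<mu>) - (- c * Z \<omega>)))"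
    by (simp add: normal_density_def algebra_simps)
  also have "\<dots> = (\<integral>y. normal_density 0 (\<bar>c\<bar> * s) y * normal_density 0 \<sigma> ((a - \<mu>) - y) \<partial>lborel)"
    by (rule distributed_integral[OF Y, symmetric]) (auto simp: normal_density_nonneg)
  also have "\<dots> = enn2real (\<integral>\<^sup>+y. ennreal (normal_density 0 \<sigma> ((a - \<mu>) - y) * normal_density 0 (\<bar>c\<bar> * s) y) \<partial>lborel)"
    by (subst integral_eq_nn_integral) (auto simp: normal_density_nonneg mult.commute)
  also have "\<dots> = normal_density 0 (sqrt (\<sigma>\<^sup>2 + (\<bar>c\<bar> * s)\<^sup>2)) (a - \<mu>)"
    using fun_cong[OF conv_normal_density_zero_mean[OF \<open>0 < \<sigma>\<close> cs], of "a - \<mu>"] by (simp add: normal_density_nonneg)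
  also have "\<dots> = normal_density \<mu> (sqrt (\<sigma>\<^sup>2 + (c * s)\<^sup>2)) a"
    by (simp add: normal_density_def power_mult_distrib)
  finally show ?thesis .
qed

lemma (in prob_space) uniform_measure_full_event:
  assumes "A \<in> events" "AE \<omega> in M. \<omega> \<in> A"
  shows "uniform_measure M A = M"
proof -
  have e: "emeasure M A = 1" using assms by (simp add: emeasure_eq_1_AE)
  have "uniform_measure M A = density M (\<lambda>_. 1)"
    unfolding uniform_measure_def e
    by (rule density_cong) (use assms in \<open>auto elim!: eventually_mono\<close>)
  then show ?thesis by (simp add: density_1)
qed

section \<open>The Cole-Hopf solution and the representation of its density\<close>

lemma (in brownian_setting) ito_integral_const:
  assumes ito: "has_ito_integral M F W a b (\<lambda>s \<omega>. c) I" and "0 \<le> a" "a \<le> b"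
  shows "AE \<omega> in M. I \<omega> = c * (W b \<omega> - W a \<omega>)"
proof (cases "a = b")
  case True
  then show ?thesis using ito_integral_trivial_interval[of b "\<lambda>s \<omega>. c" I] ito by simp
next
  case False
  then have ab: "a < b" using \<open>a \<le> b\<close> by simp
  let ?R = "\<lambda>N \<omega>. \<Sum>i<N. c * (W (grid a b N (Suc i)) \<omega> - W (grid a b N i) \<omega>)"
  have R: "tendsto_in_prob M ?R I"
    by (rule ito_integral_riemann[OF ito \<open>0 \<le> a\<close> ab]) auto
  have [measurable]: "W a \<in> borel_measurable M" "W b \<in> borel_measurable M"
    using \<open>0 \<le> a\<close> ab by (auto intro!: W_M)
  have "?R N \<omega> = c * (W b \<omega> - W a \<omega>)" if "N > 0" for N \<omega>
    unfolding sum_distrib_left[symmetric] sum_lessThan_telescope[of "\<lambda>i. W (grid a b N i) \<omega>"]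
    using that by simp
  then have "tendsto_in_prob M ?R (\<lambda>\<omega>. c * (W b \<omega> - W a \<omega>))"
    by (intro tendsto_in_prob_AE tendsto_in_prob_measurable(1)[OF R] AE_I2 tendsto_eventually)
      (auto intro!: eventually_mono[OF eventually_gt_at_top[of 0]])
  from tendsto_in_prob_unique[OF R this] show ?thesis .
qed

lemma eigf_nonzero:
  assumes "m \<ge> 1" "x \<in> {real k / real m<..<(real k + 1) / real m}"
  shows "eigf m x \<noteq> 0"
proof
  assume "eigf m x = 0"
  then have "sin (real m * pi * x) = 0" by (simp add: eigf_def)
  then obtain i :: int where "real m * pi * x = of_int i * pi" by (auto simp: sin_zero_iff_int2)
  then have i: "real m * x = of_int i" by (simp add: mult.commute mult.left_commute)
  have "real k < real m * x" "real m * x < real k + 1"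
    using assms by (auto simp: field_simps)
  then have "real_of_int (int k) < of_int i" "real_of_int i < of_int (int k + 1)"
    unfolding i by simp_all
  then show False by (simp only: of_int_less_iff)
qed

lemma kpz_density_eq_normal:
  assumes "nu_tilde M X \<theta> \<xi> \<epsilon> q m t > 0"
  shows "kpz_density M X \<theta> \<xi> \<epsilon> q m y t x =
    normal_density (mu_tilde M X \<theta> \<xi> \<epsilon> q m t x) (sqrt (nu_tilde M X \<theta> \<xi> \<epsilon> q m t)) y"
  using assms by (simp add: kpz_density_def normal_density_def)

lemma deriv_reversed_affine: "deriv (\<lambda>r. a + c * (T - r)) s = - c" for a c :: real
  by (rule DERIV_imp_deriv) (auto intro!: derivative_eq_intros)

lemma deriv_mu_tilde_reversed:
  "deriv (\<lambda>r. mu_tilde M X \<theta> \<xi> \<epsilon> q m (T - r) x) s = - (2 * \<theta> / \<xi> * b_tilde \<theta> \<epsilon> q m)"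
proof -
  have "(\<lambda>r. mu_tilde M X \<theta> \<xi> \<epsilon> q m (T - r) x) =
      (\<lambda>r. 2 * \<theta> / \<xi> * (log_mean M X + ln \<bar>eigf m x\<bar>) + (2 * \<theta> / \<xi> * b_tilde \<theta> \<epsilon> q m) * (T - r))"
    unfolding mu_tilde_def by (simp add: fun_eq_iff distrib_left mult.assoc)
  then show ?thesis by (simp only: deriv_reversed_affine)
qed

lemma deriv_nu_tilde_reversed:
  "deriv (\<lambda>r. nu_tilde M X \<theta> \<xi> \<epsilon> q m (T - r)) s = - (2 * \<theta> / \<xi> * (\<epsilon> * q m))\<^sup>2"
proof -
  have "(\<lambda>r. nu_tilde M X \<theta> \<xi> \<epsilon> q m (T - r)) =
      (\<lambda>r. 4 * \<theta>\<^sup>2 / \<xi>\<^sup>2 * log_var M X + (2 * \<theta> / \<xi> * (\<epsilon> * q m))\<^sup>2 * (T - r))"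
    unfolding nu_tilde_def by (simp add: fun_eq_iff distrib_left mult.assoc power_mult_distrib power_divide)
  then show ?thesis by (simp only: deriv_reversed_affine)
qed

lemma she_coefficient_eq:
  assumes "filtered_prob_space M F" "q_wiener_modes M F q W" "she_solution M F \<theta> \<epsilon> q W m U" "n \<ge> 1" "0 \<le> t"
  shows "AE \<omega> in M. U n t \<omega> = U n 0 \<omega> * exp (b_tilde \<theta> \<epsilon> q n * t + \<epsilon> * q n * W n t \<omega>)"
proof -
  have bm: "brownian_motion M F (W n)" using assms(2,4) by (simp add: q_wiener_modes_def)
  interpret geometric_brownian M F "W n" "- \<theta> * (real n * pi)\<^sup>2" "\<epsilon> * q n"
    by (intro geometric_brownian.intro brownian_setting.intro assms(1) bm)
  have "sde_solution M F (W n) (\<lambda>t u. - \<theta> * (real n * pi)\<^sup>2 * u) (\<lambda>t u. \<epsilon> * q n * u) {0..} 0 (U n)"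
    using assms(3,4) by (simp add: she_solution_def)
  from linear_sde_solution_eq[OF this \<open>0 \<le> t\<close>]
  have "AE \<omega> in M. U n t \<omega> = U n 0 \<omega> * exp ((- \<theta> * (real n * pi)\<^sup>2 - (\<epsilon> * q n)\<^sup>2 / 2) * t + \<epsilon> * q n * (W n t \<omega> - W n 0 \<omega>))" .
  moreover have "AE \<omega> in M. W n 0 \<omega> = 0" using bm by (simp add: brownian_motion_def)
  ultimately show ?thesis
    by eventually_elim (simp add: b_tilde_def)
qed

text \<open>
  By \<open>she_coefficient_eq\<close> a mode that starts at 0 stays 0, so the series has a single term.
\<close>

lemma she_field_eq:
  assumes "filtered_prob_space M F" "q_wiener_modes M F q W" "she_solution M F \<theta> \<epsilon> q W m U" "m \<ge> 1" "0 \<le> t"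
  shows "AE \<omega> in M. she_field U t x \<omega> = U m t \<omega> * eigf m x"
proof -
  have "AE \<omega> in M. n \<ge> 1 \<longrightarrow> n \<noteq> m \<longrightarrow> U n t \<omega> = 0" for n
  proof (cases "n \<ge> 1 \<and> n \<noteq> m")
    case True
    then have "AE \<omega> in M. U n 0 \<omega> = 0" using assms(3) by (simp add: she_solution_def)
    with she_coefficient_eq[OF assms(1-3) _ \<open>0 \<le> t\<close>, of n] True show ?thesis
      by (auto elim: eventually_elim2)
  qed auto
  then have "AE \<omega> in M. \<forall>n. n \<ge> 1 \<longrightarrow> n \<noteq> m \<longrightarrow> U n t \<omega> = 0" by (simp add: AE_all_countable)
  then show ?thesis
  proof eventually_elim
    case (elim \<omega>)
    have "she_field U t x \<omega> = (\<Sum>n\<in>{m - 1}. U (Suc n) t \<omega> * eigf (Suc n) x)"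
      unfolding she_field_def using elim \<open>m \<ge> 1\<close> by (intro suminf_finite) auto
    then show ?case using \<open>m \<ge> 1\<close> by simp
  qed
qed

text \<open>
  The logarithm turns the explicit solution into an affine combination of the independent
  Gaussian variables \<open>ln (U m 0)\<close> and \<open>W m t\<close>.
\<close>

lemma kpz_distributed:
  fixes M :: "'a measure"
  assumes "\<theta> > 0" and "\<xi> \<noteq> 0" and "m \<ge> 1" and nz: "eigf m x \<noteq> 0" and x: "x \<in> {xl..xr}"
    and fps: "filtered_prob_space M F" and qw: "q_wiener_modes M F q W"
    and she: "she_solution M F \<theta> \<epsilon> q W m U"
    and ind: "indep_of_noise M (U m 0) W"
    and K: "kpz_cole_hopf_solution M \<theta> \<xi> m xl xr U K"
    and ln: "lognormal_rv M (U m 0)" and "0 \<le> t"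
  shows "distributed M lborel (K t x) (\<lambda>y. ennreal (kpz_density M (U m 0) \<theta> \<xi> \<epsilon> q m y t x))"
proof -
  have bm: "brownian_motion M F (W m)" using qw \<open>m \<ge> 1\<close> by (simp add: q_wiener_modes_def)
  interpret brownian_setting M F "W m" by (intro brownian_setting.intro fps bm)
  define \<mu> where "\<mu> = log_mean M (U m 0)"
  define \<nu> where "\<nu> = log_var M (U m 0)"
  have \<nu>: "\<nu> > 0" and Upos: "AE \<omega> in M. U m 0 \<omega> > 0"
    and Ud: "distributed M lborel (U m 0) (\<lambda>u. ennreal (lognormal_density \<mu> \<nu> u))"
    using ln by (auto simp: lognormal_rv_def \<mu>_def \<nu>_def)
  have UM[measurable]: "U n s \<in> borel_measurable M" if "n \<ge> 1" "0 \<le> s" for n s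
    by (rule F_M[of _ s]) (use she that in \<open>simp add: she_solution_def sde_solution_def\<close>)
  have KM: "K t x \<in> borel_measurable M"
  proof -
    have "(\<lambda>\<omega>. 2 * \<theta> / \<xi> * ln \<bar>she_field U t x \<omega>\<bar>) \<in> borel_measurable M"
      unfolding she_field_def using \<open>0 \<le> t\<close> by measurable
    then show ?thesis
      by (rule measurable_cong[THEN iffD2, rotated]) (use K x \<open>0 \<le> t\<close> in \<open>simp add: kpz_cole_hopf_solution_def\<close>)
  qed
  define L where "L \<omega> = ln (U m 0 \<omega>)" for \<omega>
  define b where "b = 2 * \<theta> / \<xi>"
  define a where "a = b * (b_tilde \<theta> \<epsilon> q m * t + ln \<bar>eigf m x\<bar>)"
  define c where "c = b * (\<epsilon> * q m)"
  have b: "b \<noteq> 0" using assms(1,2) by (simp add: b_def)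
  have LM[measurable]: "L \<in> borel_measurable M" unfolding L_def[abs_def] using \<open>m \<ge> 1\<close> by measurable
  have WM[measurable]: "W m t \<in> borel_measurable M" by (rule W_M[OF \<open>0 \<le> t\<close>])
  have Ld: "distributed M lborel L (normal_density \<mu> (sqrt \<nu>))"
    unfolding L_def[abs_def] by (rule ln_lognormal[OF Ud \<nu> Upos])
  have W0: "AE \<omega> in M. W m 0 \<omega> = 0" using bm by (simp add: brownian_motion_def)
  have Keq: "AE \<omega> in M. K t x \<omega> = a + b * L \<omega> + c * W m t \<omega>"
    using she_field_eq[OF fps qw she \<open>m \<ge> 1\<close> \<open>0 \<le> t\<close>, of x] she_coefficient_eq[OF fps qw she \<open>m \<ge> 1\<close> \<open>0 \<le> t\<close>] Upos AE_space
  proof eventually_elim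
    case (elim \<omega>)
    have "K t x \<omega> = b * ln \<bar>she_field U t x \<omega>\<bar>"
      using K x \<open>0 \<le> t\<close> elim(4) by (simp add: kpz_cole_hopf_solution_def b_def)
    also have "ln \<bar>she_field U t x \<omega>\<bar> = L \<omega> + (b_tilde \<theta> \<epsilon> q m * t + \<epsilon> * q m * W m t \<omega>) + ln \<bar>eigf m x\<bar>"
      using elim(3) nz unfolding elim(1,2) by (simp add: abs_mult ln_mult L_def)
    finally show ?case by (simp add: a_def c_def algebra_simps)
  qed
  have nu: "nu_tilde M (U m 0) \<theta> \<xi> \<epsilon> q m t = b\<^sup>2 * \<nu> + c\<^sup>2 * t"
    by (simp add: nu_tilde_def b_def c_def \<nu>_def power_mult_distrib power_divide algebra_simps)
  have mu: "mu_tilde M (U m 0) \<theta> \<xi> \<epsilon> q m t x = a + b * \<mu>"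
    by (simp add: mu_tilde_def b_def a_def \<mu>_def algebra_simps)
  have nu_pos: "nu_tilde M (U m 0) \<theta> \<xi> \<epsilon> q m t > 0"
    unfolding nu using b \<nu> \<open>0 \<le> t\<close> by (intro add_pos_nonneg) auto
  have "distributed M lborel (K t x) (normal_density (a + b * \<mu>) (sqrt (b\<^sup>2 * \<nu> + c\<^sup>2 * t)))"
  \<comment> \<open>A vanishing noise term is not normal with positive variance and is treated separately.\<close>
  proof (cases "c = 0 \<or> t = 0")
    case True
    have "AE \<omega> in M. K t x \<omega> = a + b * L \<omega>" using Keq W0 True by (auto elim: eventually_elim2)
    from normal_affine[OF Ld _ b this KM] \<nu>
    have "distributed M lborel (K t x) (normal_density (a + b * \<mu>) (\<bar>b\<bar> * sqrt \<nu>))" by simp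
    moreover have "sqrt (b\<^sup>2 * \<nu> + c\<^sup>2 * t) = \<bar>b\<bar> * sqrt \<nu>"
      using True by (auto simp: real_sqrt_mult)
    ultimately show ?thesis by simp
  next
    case False
    then have c: "c \<noteq> 0" and t: "0 < t" using \<open>0 \<le> t\<close> by auto
    have inc: "distributed M lborel (\<lambda>\<omega>. W m t \<omega> - W m 0 \<omega>) (normal_density 0 (sqrt t))"
      using increment_distributed[of 0 t] t by simp
    have Wd: "distributed M lborel (W m t) (normal_density 0 (sqrt t))"
      by (rule distributed_AE_cong[OF inc]) (use W0 in \<open>auto elim: eventually_mono\<close>)
    have X1: "distributed M lborel (\<lambda>\<omega>. a + b * L \<omega>) (normal_density (a + b * \<mu>) (\<bar>b\<bar> * sqrt \<nu>))"
      by (rule normal_affine[OF Ld _ b]) (use \<nu> in auto)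
    have X2: "distributed M lborel (\<lambda>\<omega>. c * W m t \<omega>) (normal_density (0 + c * 0) (\<bar>c\<bar> * sqrt t))"
      by (rule normal_affine[OF Wd _ c]) (use t in auto)
    let ?A = "vimage_algebra (space M) (U m 0) borel"
    have sub: "subalgebra M ?A"
      using UM[OF \<open>m \<ge> 1\<close> order_refl] by (auto simp: subalgebra_def sets_vimage_algebra2)
    have "indep_set (sets ?A) (gen_sets M (W m t))"
    proof -
      have "gen_sets M (W m t) \<subseteq> process_sets M (W m)"
        unfolding process_sets_def using \<open>0 \<le> t\<close> by (auto intro!: sigma_sets.Basic)
      then have "gen_sets M (W m t) \<subseteq> sigma_sets (space M) (\<Union>n\<in>{1..}. process_sets M (W n))"
        using \<open>m \<ge> 1\<close> by (auto intro!: sigma_sets.Basic)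
      then show ?thesis
        using ind unfolding indep_of_noise_def indep_set_def gen_sets_def
        by (elim indep_sets_mono_sets) (auto split: bool.splits)
    qed
    moreover have "(\<lambda>\<omega>. a + b * L \<omega>) \<in> borel_measurable ?A"
    proof -
      have [measurable]: "U m 0 \<in> borel_measurable ?A" by (rule measurable_vimage_algebra1) auto
      show ?thesis unfolding L_def by measurable
    qed
    ultimately have "indep_var borel (\<lambda>\<omega>. a + b * L \<omega>) borel (\<lambda>\<omega>. c * W m t \<omega>)"
      using sub by (intro indep_var_of_indep_set[where A="?A" and f="\<lambda>x. c * x"]) auto
    from add_indep_normal[OF this _ _ X1 X2] b c \<nu> t
    have s: "distributed M lborel (\<lambda>\<omega>. a + b * L \<omega> + c * W m t \<omega>)
        (normal_density (a + b * \<mu>) (sqrt ((\<bar>b\<bar> * sqrt \<nu>)\<^sup>2 + (\<bar>c\<bar> * sqrt t)\<^sup>2)))" by simp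
    have "(\<bar>b\<bar> * sqrt \<nu>)\<^sup>2 + (\<bar>c\<bar> * sqrt t)\<^sup>2 = b\<^sup>2 * \<nu> + c\<^sup>2 * t"
      using \<nu> t by (simp add: power_mult_distrib)
    with s have s': "distributed M lborel (\<lambda>\<omega>. a + b * L \<omega> + c * W m t \<omega>)
        (normal_density (a + b * \<mu>) (sqrt (b\<^sup>2 * \<nu> + c\<^sup>2 * t)))" by simp
    show ?thesis
      by (rule distributed_AE_cong[OF s']) (use Keq KM in \<open>auto elim: eventually_mono\<close>)
  qed
  then show ?thesis
    unfolding kpz_density_eq_normal[OF nu_pos] mu nu .
qed

text \<open>
  The coefficients are the time derivatives of mean and variance run backwards, and both are
  constant. Over a time of length \<open>t\<close> the diffusion therefore adds exactly the variance
  \<open>nu_tilde t - nu_tilde 0\<close>, and the drift the shift \<open>mu_tilde 0 - mu_tilde t\<close>.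
\<close>

lemma kpz_density_expectation:
  assumes fps: "filtered_prob_space N G" and bm: "brownian_motion N G B"
    and sol: "sde_solution N G B
           (\<lambda>s y. deriv (\<lambda>r. mu_tilde M X \<theta> \<xi> \<epsilon> q m (T - r) x) s)
           (\<lambda>s y. sqrt (- deriv (\<lambda>r. nu_tilde M X \<theta> \<xi> \<epsilon> q m (T - r)) s))
           {T - t..T} (T - t) Y"
    and init: "AE \<omega> in N. Y (T - t) \<omega> = \<kappa>"
    and t: "0 \<le> t" "t \<le> T" and pos: "\<theta> > 0" "\<xi> \<noteq> 0" "log_var M X > 0"
  shows "kpz_density M X \<theta> \<xi> \<epsilon> q m \<kappa> t x = (LINT \<omega>|N. kpz_density M X \<theta> \<xi> \<epsilon> q m (Y T \<omega>) 0 x)"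
proof -
  interpret brownian_setting N G B by (intro brownian_setting.intro fps bm)
  define d where "d = - (2 * \<theta> / \<xi> * b_tilde \<theta> \<epsilon> q m)"
  define c where "c = \<bar>2 * \<theta> / \<xi> * (\<epsilon> * q m)\<bar>"
  define p where "p = kpz_density M X \<theta> \<xi> \<epsilon> q m"
  have YM: "Y T \<in> borel_measurable N"
    by (rule F_M[of _ T]) (use sol t in \<open>simp add: sde_solution_def\<close>)
  have "\<exists>I. has_ito_integral N G B (T - t) T (\<lambda>s \<omega>. c) I \<and>
      (AE \<omega> in N. Y T \<omega> = Y (T - t) \<omega> + (LBINT s:{T - t..T}. d) + I \<omega>)"
    using sol t unfolding sde_solution_def deriv_mu_tilde_reversed deriv_nu_tilde_reversed d_def c_def by auto
  then obtain I where ito: "has_ito_integral N G B (T - t) T (\<lambda>s \<omega>. c) I"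
    and Yeq: "AE \<omega> in N. Y T \<omega> = Y (T - t) \<omega> + (LBINT s:{T - t..T}. d) + I \<omega>" by blast
  have "(LBINT s:{T - t..T}. d) = d * t"
    using t by (simp add: set_lebesgue_integral_def)
  then have Yc: "AE \<omega> in N. Y T \<omega> = (\<kappa> + d * t) + c * (B T \<omega> - B (T - t) \<omega>)"
    using Yeq init ito_integral_const[OF ito] t by (auto elim!: eventually_elim2 simp: eventually_conj_iff)
  have nu: "nu_tilde M X \<theta> \<xi> \<epsilon> q m s = nu_tilde M X \<theta> \<xi> \<epsilon> q m 0 + c\<^sup>2 * s" for s
    by (simp add: nu_tilde_def c_def power_mult_distrib power_divide algebra_simps)
  have nu0: "nu_tilde M X \<theta> \<xi> \<epsilon> q m 0 > 0"
    using pos by (simp add: nu_tilde_def)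
  have nut: "nu_tilde M X \<theta> \<xi> \<epsilon> q m t > 0"
    using nu[of t] nu0 t by (simp add: add_pos_nonneg)
  have mu: "mu_tilde M X \<theta> \<xi> \<epsilon> q m t x = mu_tilde M X \<theta> \<xi> \<epsilon> q m 0 x - d * t"
    by (simp add: mu_tilde_def d_def algebra_simps)
  let ?n0 = "normal_density (mu_tilde M X \<theta> \<xi> \<epsilon> q m 0 x) (sqrt (nu_tilde M X \<theta> \<xi> \<epsilon> q m 0))"
  have BM[measurable]: "B T \<in> borel_measurable N" "B (T - t) \<in> borel_measurable N"
    using t by (auto intro!: W_M)
  note [measurable] = YM
  have "(LINT \<omega>|N. kpz_density M X \<theta> \<xi> \<epsilon> q m (Y T \<omega>) 0 x)
      = (LINT \<omega>|N. ?n0 ((\<kappa> + d * t) + c * (B T \<omega> - B (T - t) \<omega>)))"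
    unfolding kpz_density_eq_normal[OF nu0]
    by (rule integral_cong_AE) (use Yc in \<open>auto elim: eventually_mono\<close>)
  also have "\<dots> = normal_density (mu_tilde M X \<theta> \<xi> \<epsilon> q m 0 x) (sqrt (nu_tilde M X \<theta> \<xi> \<epsilon> q m t)) (\<kappa> + d * t)"
  proof (cases "t = 0")
    case True
    then show ?thesis by (simp add: prob_space)
  next
    case False
    then have "T - t < T" "0 < sqrt t" using t by auto
    have Z: "distributed N lborel (\<lambda>\<omega>. B T \<omega> - B (T - t) \<omega>) (normal_density 0 (sqrt t))"
      using increment_distributed[OF _ \<open>T - t < T\<close>] t by simp
    show ?thesis
      using gaussian_smoothing[OF Z \<open>0 < sqrt t\<close>, of "sqrt (nu_tilde M X \<theta> \<xi> \<epsilon> q m 0)"] nu0 nu[of t] t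
      by (simp add: power_mult_distrib)
  qed
  also have "\<dots> = kpz_density M X \<theta> \<xi> \<epsilon> q m \<kappa> t x"
    unfolding kpz_density_eq_normal[OF nut] mu by (simp add: normal_density_def algebra_simps)
  finally show ?thesis by simp
qed

theorem theorem6:
  fixes M :: "'a measure" and F :: "real \<Rightarrow> 'a measure"
    and N :: "'b measure" and G :: "real \<Rightarrow> 'b measure"
    and W U :: "nat \<Rightarrow> real \<Rightarrow> 'a \<Rightarrow> real"
    and K :: "real \<Rightarrow> real \<Rightarrow> 'a \<Rightarrow> real"
    and B :: "real \<Rightarrow> 'b \<Rightarrow> real"
    and Khat :: "real \<Rightarrow> real \<Rightarrow> 'b \<Rightarrow> real"
    and q :: "nat \<Rightarrow> real"
    and \<theta> \<xi> \<epsilon> xl xr T t \<kappa> x :: real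
    and m k :: nat
  assumes "\<theta> > 0" and "\<xi> \<noteq> 0" and "\<epsilon> > 0"
    and "m \<ge> 1" and "k \<in> {0..m - 1}"
    and "xl < xr" and "{xl<..<xr} \<subseteq> {real k / real m<..<(real k + 1) / real m}"
    and "filtered_prob_space M F"
    and "q_wiener_modes M F q W"
    and "she_solution M F \<theta> \<epsilon> q W m U"
    and "indep_of_noise M (U m 0) W"
    and "kpz_cole_hopf_solution M \<theta> \<xi> m xl xr U K"
    and "lognormal_rv M (U m 0)"
    and "T > 0" and "t \<in> {0..T}" and "x \<in> {xl<..<xr}"
    and "filtered_prob_space N G"
    and "brownian_motion N G B"
    and "sde_solution N G B
           (\<lambda>s y. deriv (\<lambda>r. mu_tilde M (U m 0) \<theta> \<xi> \<epsilon> q m (T - r) x) s)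
           (\<lambda>s y. sqrt (- deriv (\<lambda>r. nu_tilde M (U m 0) \<theta> \<xi> \<epsilon> q m (T - r)) s))
           {T - t..T} (T - t) (\<lambda>s. Khat s x)"
    and "AE \<omega> in N. Khat (T - t) x \<omega> = \<kappa>"
  shows "distributed M lborel (K t x)
           (\<lambda>y. ennreal (kpz_density M (U m 0) \<theta> \<xi> \<epsilon> q m y t x)) \<and>
         kpz_density M (U m 0) \<theta> \<xi> \<epsilon> q m \<kappa> t x =
           cond_expectation_event N
             (\<lambda>\<omega>. kpz_density M (U m 0) \<theta> \<xi> \<epsilon> q m (Khat T x \<omega>) 0 x)
             {\<omega> \<in> space N. Khat (T - t) x \<omega> = \<kappa>}"
proof
  have t: "0 \<le> t" "t \<le> T" using assms by auto
  have nz: "eigf m x \<noteq> 0" using assms by (intro eigf_nonzero[of m x k]) auto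
  have x: "x \<in> {xl..xr}" using assms by auto
  show "distributed M lborel (K t x) (\<lambda>y. ennreal (kpz_density M (U m 0) \<theta> \<xi> \<epsilon> q m y t x))"
    by (rule kpz_distributed[OF assms(1,2,4) nz x assms(8-13) t(1)])
  interpret N: brownian_setting N G B by (intro brownian_setting.intro assms)
  have pos: "log_var M (U m 0) > 0" using assms by (simp add: lognormal_rv_def)
  have [measurable]: "Khat (T - t) x \<in> borel_measurable N"
    by (rule N.F_M[of _ "T - t"]) (use assms(19) t in \<open>simp add: sde_solution_def\<close>)
  have "uniform_measure N {\<omega> \<in> space N. Khat (T - t) x \<omega> = \<kappa>} = N"
    by (rule N.uniform_measure_full_event) (use assms(20) in \<open>auto elim: eventually_elim2[OF _ AE_space]\<close>)
  then show "kpz_density M (U m 0) \<theta> \<xi> \<epsilon> q m \<kappa> t x =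
           cond_expectation_event N
             (\<lambda>\<omega>. kpz_density M (U m 0) \<theta> \<xi> \<epsilon> q m (Khat T x \<omega>) 0 x)
             {\<omega> \<in> space N. Khat (T - t) x \<omega> = \<kappa>}"
    unfolding cond_expectation_event_def
    using kpz_density_expectation[OF assms(17-20) t assms(1,2) pos] by simp
qed

end
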